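(* Let $s\ge 1$ be a fixed integer and for $n\ge s$ let $o_{sn}=u_{11}+\cdots+u_{ss}\in A_o(n)$. Then the variable $(n/s)^{1/2}\,o_{sn}$ is asymptotically semicircular as $n\to\infty$; that is, for every integer $m\ge 1$, $$\lim_{n\to\infty}\int\left((n/s)^{1/2}o_{sn}\right)^m=\frac{1}{2\pi}\int_{-2}^{2}x^m\sqrt{4-x^2}\,dx ,$$ where the left-hand integral is the Haar functional of $A_o(n)$.
   Context: $A_o(n)$ is the universal (unital) $C^*$-algebra generated by $n^2$ elements $u_{ij}$, $1\le i,j\le n$, subject to the relations making $u=(u_{ij})$ an orthogonal matrix, i.e. $u_{ij}=u_{ij}^*$ for all $i,j$ and $uu^t=u^tu=1$. It is a Hopf $C^*$-algebra with comultiplication $\Delta(u_{ij})=\sum_{k} u_{ik}\otimes u_{kj}$. The Haar functional $\int:A_o(n)\to\mathbb{C}$ is the unique positive unital linear form satisfying $(\mathrm{id}\otimes\int)\Delta(a)=(\int\otimes \mathrm{id})\Delta(a)=(\int a)\,1$ for all $a$. The semicircle law is the probability measure on $[-2,2]$ with density $\frac{1}{2\pi}\sqrt{4-x^2}$. *)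

theory Defs
  imports "HOL-Analysis.Analysis" "HOL-Algebra.Ring"
begin

record 'a star_algebra = "'a ring" +
  cscale :: "complex \<Rightarrow> 'a \<Rightarrow> 'a"
  adj :: "'a \<Rightarrow> 'a"

record 'a normed_star_algebra = "'a star_algebra" +
  cnorm :: "'a \<Rightarrow> real"

definition diff :: "('a, 'b) star_algebra_scheme \<Rightarrow> 'a \<Rightarrow> 'a \<Rightarrow> 'a" where
  "diff X x y = x \<oplus>\<^bsub>X\<^esub> cscale X (-1) y"

definition linear_between ::
  "('a, 'b) star_algebra_scheme \<Rightarrow> ('c, 'd) star_algebra_scheme \<Rightarrow> ('a \<Rightarrow> 'c) \<Rightarrow> bool" where
  "linear_between X Y f \<longleftrightarrow>
     f \<in> carrier X \<rightarrow> carrier Y \<and>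
     (\<forall>x\<in>carrier X. \<forall>y\<in>carrier X. f (x \<oplus>\<^bsub>X\<^esub> y) = f x \<oplus>\<^bsub>Y\<^esub> f y) \<and>
     (\<forall>c. \<forall>x\<in>carrier X. f (cscale X c x) = cscale Y c (f x))"

definition unital_star_hom ::
  "('a, 'b) star_algebra_scheme \<Rightarrow> ('c, 'd) star_algebra_scheme \<Rightarrow> ('a \<Rightarrow> 'c) \<Rightarrow> bool" where
  "unital_star_hom X Y f \<longleftrightarrow>
     linear_between X Y f \<and>
     (\<forall>x\<in>carrier X. \<forall>y\<in>carrier X. f (x \<otimes>\<^bsub>X\<^esub> y) = f x \<otimes>\<^bsub>Y\<^esub> f y) \<and>
     f \<one>\<^bsub>X\<^esub> = \<one>\<^bsub>Y\<^esub> \<and>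
     (\<forall>x\<in>carrier X. f (adj X x) = adj Y (f x))"

definition bounded_between ::
  "('a, 'b) normed_star_algebra_scheme \<Rightarrow> ('c, 'd) normed_star_algebra_scheme \<Rightarrow> ('a \<Rightarrow> 'c) \<Rightarrow> bool" where
  "bounded_between X Y f \<longleftrightarrow> (\<exists>K. \<forall>x\<in>carrier X. cnorm Y (f x) \<le> K * cnorm X x)"

definition linear_form :: "('a, 'b) star_algebra_scheme \<Rightarrow> ('a \<Rightarrow> complex) \<Rightarrow> bool" where
  "linear_form X h \<longleftrightarrow>
     (\<forall>x\<in>carrier X. \<forall>y\<in>carrier X. h (x \<oplus>\<^bsub>X\<^esub> y) = h x + h y) \<and>
     (\<forall>c. \<forall>x\<in>carrier X. h (cscale X c x) = c * h x)"

definition positive_form :: "('a, 'b) star_algebra_scheme \<Rightarrow> ('a \<Rightarrow> complex) \<Rightarrow> bool" where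
  "positive_form X h \<longleftrightarrow> (\<forall>x\<in>carrier X. h (adj X x \<otimes>\<^bsub>X\<^esub> x) \<in> \<real>\<^sub>\<ge>\<^sub>0)"

definition cstar_seminorm :: "('a, 'b) star_algebra_scheme \<Rightarrow> ('a \<Rightarrow> real) \<Rightarrow> bool" where
  "cstar_seminorm X p \<longleftrightarrow>
     (\<forall>x\<in>carrier X. 0 \<le> p x) \<and>
     (\<forall>x\<in>carrier X. \<forall>y\<in>carrier X. p (x \<oplus>\<^bsub>X\<^esub> y) \<le> p x + p y) \<and>
     (\<forall>c. \<forall>x\<in>carrier X. p (cscale X c x) = cmod c * p x) \<and>
     (\<forall>x\<in>carrier X. \<forall>y\<in>carrier X. p (x \<otimes>\<^bsub>X\<^esub> y) \<le> p x * p y) \<and>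
     (\<forall>x\<in>carrier X. p (adj X x \<otimes>\<^bsub>X\<^esub> x) = (p x)\<^sup>2)"

text \<open>A relation \<open>(x, y)\<close> stands for the equation \<open>x = y\<close>.\<close>

definition respects_relations ::
  "('a, 'b) star_algebra_scheme \<Rightarrow> ('a \<times> 'a) set \<Rightarrow> ('a \<Rightarrow> real) \<Rightarrow> bool" where
  "respects_relations X R p \<longleftrightarrow> (\<forall>(x, y)\<in>R. p (diff X x y) = 0)"

definition sup_seminorm :: "('a \<Rightarrow> real) set \<Rightarrow> 'a \<Rightarrow> real" where
  "sup_seminorm P x = (SUP p\<in>P. p x)"

definition cauchy_seqs ::
  "('a, 'b) star_algebra_scheme \<Rightarrow> ('a \<Rightarrow> real) \<Rightarrow> (nat \<Rightarrow> 'a) set" where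
  "cauchy_seqs X p =
     {a. (\<forall>k. a k \<in> carrier X) \<and>
         (\<forall>e>0. \<exists>N. \<forall>j\<ge>N. \<forall>k\<ge>N. p (diff X (a j) (a k)) < e)}"

definition null_rel ::
  "('a, 'b) star_algebra_scheme \<Rightarrow> ('a \<Rightarrow> real) \<Rightarrow> ((nat \<Rightarrow> 'a) \<times> (nat \<Rightarrow> 'a)) set" where
  "null_rel X p =
     {(a, b). a \<in> cauchy_seqs X p \<and> b \<in> cauchy_seqs X p \<and>
        (\<lambda>k. p (diff X (a k) (b k))) \<longlonglongrightarrow> 0}"

definition embed ::
  "('a, 'b) star_algebra_scheme \<Rightarrow> ('a \<Rightarrow> real) \<Rightarrow> 'a \<Rightarrow> (nat \<Rightarrow> 'a) set" where
  "embed X p x = null_rel X p `` {\<lambda>_. x}"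

text \<open>
  Separated completion of a *-algebra for a C*-seminorm \<open>p\<close>: Cauchy sequences modulo
  null sequences, with termwise operations. It is a unital C*-algebra, in which \<open>embed X p\<close>
  maps \<open>X\<close> onto a dense *-subalgebra.
\<close>

definition cstar_completion ::
  "('a, 'b) star_algebra_scheme \<Rightarrow> ('a \<Rightarrow> real) \<Rightarrow> (nat \<Rightarrow> 'a) set normed_star_algebra" where
  "cstar_completion X p =
     \<lparr>carrier = cauchy_seqs X p // null_rel X p,
      mult = (\<lambda>S T. \<Union>a\<in>S. \<Union>b\<in>T. null_rel X p `` {\<lambda>k. a k \<otimes>\<^bsub>X\<^esub> b k}),
      one = embed X p \<one>\<^bsub>X\<^esub>,
      zero = embed X p \<zero>\<^bsub>X\<^esub>,
      add = (\<lambda>S T. \<Union>a\<in>S. \<Union>b\<in>T. null_rel X p `` {\<lambda>k. a k \<oplus>\<^bsub>X\<^esub> b k}),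
      cscale = (\<lambda>c S. \<Union>a\<in>S. null_rel X p `` {\<lambda>k. cscale X c (a k)}),
      adj = (\<lambda>S. \<Union>a\<in>S. null_rel X p `` {\<lambda>k. adj X (a k)}),
      cnorm = (\<lambda>S. THE r. \<forall>a\<in>S. (\<lambda>k. p (a k)) \<longlonglongrightarrow> r)\<rparr>"

definition delta :: "'m \<Rightarrow> 'm \<Rightarrow> complex" where
  "delta x = (\<lambda>z. if z = x then 1 else 0)"

text \<open>
  Formal finite linear combinations of elements of \<open>G\<close>, the element \<open>x\<close> of \<open>G\<close> being
  \<open>delta x\<close>. The product is convolution; the adjoint extends the involution \<open>st\<close> of \<open>G\<close>
  antilinearly.
\<close>

definition monoid_star_algebra ::
  "('m, 'b) monoid_scheme \<Rightarrow> ('m \<Rightarrow> 'm) \<Rightarrow> ('m \<Rightarrow> complex) star_algebra" where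
  "monoid_star_algebra G st =
     \<lparr>carrier = {f. finite {z. f z \<noteq> 0} \<and> {z. f z \<noteq> 0} \<subseteq> carrier G},
      mult = (\<lambda>f g z. \<Sum>(x, y)\<in>{(x, y). f x \<noteq> 0 \<and> g y \<noteq> 0 \<and> x \<otimes>\<^bsub>G\<^esub> y = z}. f x * g y),
      one = delta \<one>\<^bsub>G\<^esub>,
      zero = (\<lambda>z. 0),
      add = (\<lambda>f g z. f z + g z),
      cscale = (\<lambda>c f z. c * f z),
      adj = (\<lambda>f z. if z \<in> carrier G then cnj (f (st z)) else 0)\<rparr>"

text \<open>
  Free unital *-algebra on the set \<open>S\<close>: noncommutative words in letters \<open>(x, False)\<close>,
  standing for \<open>x\<close>, and \<open>(x, True)\<close>, standing for the adjoint of \<open>x\<close>.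
\<close>

definition free_star_algebra :: "'g set \<Rightarrow> (('g \<times> bool) list \<Rightarrow> complex) star_algebra" where
  "free_star_algebra S =
     monoid_star_algebra \<lparr>carrier = lists (S \<times> UNIV), mult = (@), one = []\<rparr>
       (\<lambda>w. rev (map (\<lambda>(x, b). (x, \<not> b)) w))"

text \<open>
  Universal C*-algebra with generators \<open>S\<close> and relations \<open>R\<close>: completion of the free *-algebra
  for the largest C*-seminorm compatible with the relations (provided that the supremum is
  finite, as it is for orthogonal matrices).
\<close>

definition universal_seminorm ::
  "'g set \<Rightarrow> ((('g \<times> bool) list \<Rightarrow> complex) \<times> (('g \<times> bool) list \<Rightarrow> complex)) set
     \<Rightarrow> (('g \<times> bool) list \<Rightarrow> complex) \<Rightarrow> real" where
  "universal_seminorm S R =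
     sup_seminorm {p. cstar_seminorm (free_star_algebra S) p \<and>
                      respects_relations (free_star_algebra S) R p}"

definition universal_cstar_algebra ::
  "'g set \<Rightarrow> ((('g \<times> bool) list \<Rightarrow> complex) \<times> (('g \<times> bool) list \<Rightarrow> complex)) set
     \<Rightarrow> (nat \<Rightarrow> ('g \<times> bool) list \<Rightarrow> complex) set normed_star_algebra" where
  "universal_cstar_algebra S R =
     cstar_completion (free_star_algebra S) (universal_seminorm S R)"

definition universal_generator ::
  "'g set \<Rightarrow> ((('g \<times> bool) list \<Rightarrow> complex) \<times> (('g \<times> bool) list \<Rightarrow> complex)) set
     \<Rightarrow> 'g \<Rightarrow> (nat \<Rightarrow> ('g \<times> bool) list \<Rightarrow> complex) set" where
  "universal_generator S R x =
     embed (free_star_algebra S) (universal_seminorm S R) (delta [(x, False)])"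

text \<open>
  \<open>A \<times>\<times> B\<close> is the product of the multiplicative monoids. Its *-algebra modulo the
  bilinearity relations is the algebraic tensor product of \<open>A\<close> and \<open>B\<close>, with \<open>delta (a, b)\<close>
  representing the elementary tensor of \<open>a\<close> and \<open>b\<close>.
\<close>

definition pre_tensor ::
  "('a, 'c) star_algebra_scheme \<Rightarrow> ('b, 'd) star_algebra_scheme
     \<Rightarrow> ('a \<times> 'b \<Rightarrow> complex) star_algebra" where
  "pre_tensor A B = monoid_star_algebra (A \<times>\<times> B) (\<lambda>(a, b). (adj A a, adj B b))"

definition bilinear_relations ::
  "('a, 'c) star_algebra_scheme \<Rightarrow> ('b, 'd) star_algebra_scheme
     \<Rightarrow> (('a \<times> 'b \<Rightarrow> complex) \<times> ('a \<times> 'b \<Rightarrow> complex)) set" where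
  "bilinear_relations A B =
     (let X = pre_tensor A B in
       {(delta (a \<oplus>\<^bsub>A\<^esub> a', b), delta (a, b) \<oplus>\<^bsub>X\<^esub> delta (a', b)) |a a' b.
          a \<in> carrier A \<and> a' \<in> carrier A \<and> b \<in> carrier B} \<union>
       {(delta (a, b \<oplus>\<^bsub>B\<^esub> b'), delta (a, b) \<oplus>\<^bsub>X\<^esub> delta (a, b')) |a b b'.
          a \<in> carrier A \<and> b \<in> carrier B \<and> b' \<in> carrier B} \<union>
       {(delta (cscale A c a, b), cscale X c (delta (a, b))) |c a b.
          a \<in> carrier A \<and> b \<in> carrier B} \<union>
       {(delta (a, cscale B c b), cscale X c (delta (a, b))) |c a b.
          a \<in> carrier A \<and> b \<in> carrier B})"

text \<open>
  The maximal C*-tensor norm. The last condition restricts nothing: on the algebraic tensor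
  product of C*-algebras every C*-seminorm satisfies it. It makes the finiteness of the
  supremum apparent.
\<close>

definition tensor_seminorm ::
  "('a, 'c) normed_star_algebra_scheme \<Rightarrow> ('b, 'd) normed_star_algebra_scheme
     \<Rightarrow> ('a \<times> 'b \<Rightarrow> complex) \<Rightarrow> real" where
  "tensor_seminorm A B =
     sup_seminorm {p. cstar_seminorm (pre_tensor A B) p \<and>
                      respects_relations (pre_tensor A B) (bilinear_relations A B) p \<and>
                      (\<forall>a\<in>carrier A. \<forall>b\<in>carrier B. p (delta (a, b)) \<le> cnorm A a * cnorm B b)}"

definition cstar_tensor ::
  "('a, 'c) normed_star_algebra_scheme \<Rightarrow> ('b, 'd) normed_star_algebra_scheme
     \<Rightarrow> (nat \<Rightarrow> 'a \<times> 'b \<Rightarrow> complex) set normed_star_algebra" where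
  "cstar_tensor A B = cstar_completion (pre_tensor A B) (tensor_seminorm A B)"

definition tens ::
  "('a, 'c) normed_star_algebra_scheme \<Rightarrow> ('b, 'd) normed_star_algebra_scheme
     \<Rightarrow> 'a \<Rightarrow> 'b \<Rightarrow> (nat \<Rightarrow> 'a \<times> 'b \<Rightarrow> complex) set" where
  "tens A B a b = embed (pre_tensor A B) (tensor_seminorm A B) (delta (a, b))"

text \<open>
  \<open>E\<close> is the bounded extension of the linear maps written id \<open>\<otimes>\<close> \<open>h\<close> and \<open>h\<close> \<open>\<otimes>\<close> id
  respectively; it is unique because the elementary tensors span a dense subspace.
\<close>

definition is_id_tensor_form ::
  "('a, 'c) normed_star_algebra_scheme \<Rightarrow> ('a \<Rightarrow> complex) \<Rightarrow>
     ((nat \<Rightarrow> 'a \<times> 'a \<Rightarrow> complex) set \<Rightarrow> 'a) \<Rightarrow> bool" where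
  "is_id_tensor_form A h E \<longleftrightarrow>
     linear_between (cstar_tensor A A) A E \<and> bounded_between (cstar_tensor A A) A E \<and>
     (\<forall>a\<in>carrier A. \<forall>b\<in>carrier A. E (tens A A a b) = cscale A (h b) a)"

definition is_form_tensor_id ::
  "('a, 'c) normed_star_algebra_scheme \<Rightarrow> ('a \<Rightarrow> complex) \<Rightarrow>
     ((nat \<Rightarrow> 'a \<times> 'a \<Rightarrow> complex) set \<Rightarrow> 'a) \<Rightarrow> bool" where
  "is_form_tensor_id A h E \<longleftrightarrow>
     linear_between (cstar_tensor A A) A E \<and> bounded_between (cstar_tensor A A) A E \<and>
     (\<forall>a\<in>carrier A. \<forall>b\<in>carrier A. E (tens A A a b) = cscale A (h a) b)"

type_synonym ao_elem = "(nat \<Rightarrow> ((nat \<times> nat) \<times> bool) list \<Rightarrow> complex) set"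

definition ao_index :: "nat \<Rightarrow> (nat \<times> nat) set" where
  "ao_index n = {1..n} \<times> {1..n}"

definition ao_relations ::
  "nat \<Rightarrow> ((((nat \<times> nat) \<times> bool) list \<Rightarrow> complex) \<times> (((nat \<times> nat) \<times> bool) list \<Rightarrow> complex)) set" where
  "ao_relations n =
     (let F = free_star_algebra (ao_index n);
          g = (\<lambda>i j. delta [((i, j), False)]);
          d = (\<lambda>i j. if i = j then \<one>\<^bsub>F\<^esub> else \<zero>\<^bsub>F\<^esub>)
      in {(g i j, adj F (g i j)) |i j. i \<in> {1..n} \<and> j \<in> {1..n}} \<union>
         {(\<Oplus>\<^bsub>F\<^esub>k\<in>{1..n}. g i k \<otimes>\<^bsub>F\<^esub> g j k, d i j) |i j. i \<in> {1..n} \<and> j \<in> {1..n}} \<union>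
         {(\<Oplus>\<^bsub>F\<^esub>k\<in>{1..n}. g k i \<otimes>\<^bsub>F\<^esub> g k j, d i j) |i j. i \<in> {1..n} \<and> j \<in> {1..n}})"

definition Ao :: "nat \<Rightarrow> ao_elem normed_star_algebra" where
  "Ao n = universal_cstar_algebra (ao_index n) (ao_relations n)"

definition ao_u :: "nat \<Rightarrow> nat \<Rightarrow> nat \<Rightarrow> ao_elem" where
  "ao_u n i j = universal_generator (ao_index n) (ao_relations n) (i, j)"

text \<open>By the universal property of \<open>Ao n\<close> there is exactly one such map on the carrier.\<close>

definition is_comultiplication ::
  "nat \<Rightarrow> (ao_elem \<Rightarrow> (nat \<Rightarrow> ao_elem \<times> ao_elem \<Rightarrow> complex) set) \<Rightarrow> bool" where
  "is_comultiplication n \<Delta> \<longleftrightarrow>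
     unital_star_hom (Ao n) (cstar_tensor (Ao n) (Ao n)) \<Delta> \<and>
     (\<forall>i\<in>{1..n}. \<forall>j\<in>{1..n}.
        \<Delta> (ao_u n i j) =
          (\<Oplus>\<^bsub>cstar_tensor (Ao n) (Ao n)\<^esub>k\<in>{1..n}. tens (Ao n) (Ao n) (ao_u n i k) (ao_u n k j)))"

definition haar_functional :: "nat \<Rightarrow> (ao_elem \<Rightarrow> complex) \<Rightarrow> bool" where
  "haar_functional n h \<longleftrightarrow>
     linear_form (Ao n) h \<and> positive_form (Ao n) h \<and> h \<one>\<^bsub>Ao n\<^esub> = 1 \<and>
     (\<exists>\<Delta> E E'. is_comultiplication n \<Delta> \<and>
        is_id_tensor_form (Ao n) h E \<and> is_form_tensor_id (Ao n) h E' \<and>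
        (\<forall>a\<in>carrier (Ao n).
           E (\<Delta> a) = cscale (Ao n) (h a) \<one>\<^bsub>Ao n\<^esub> \<and>
           E' (\<Delta> a) = cscale (Ao n) (h a) \<one>\<^bsub>Ao n\<^esub>))"

definition ao_o :: "nat \<Rightarrow> nat \<Rightarrow> ao_elem" where
  "ao_o s n = (\<Oplus>\<^bsub>Ao n\<^esub>i\<in>{1..s}. ao_u n i i)"

end

theory Submission
  imports Defs
begin

text \<open>The moments \<open>P I J\<close> of the Haar functional on products \<open>u i\<^sub>1 j\<^sub>1 \<dots> u i\<^sub>m j\<^sub>m\<close> form a
  matrix whose columns and rows are fixed vectors of the \<open>m\<close>-th tensor power of \<open>u\<close>. No Tannakian
  duality is needed to find the fixed vectors when \<open>n \<ge> m\<close>: they are fixed by every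
  finite-dimensional representation of the relations, and two kinds suffice. The representation
  \<open>u i j = \<delta> i j * g i\<close>, with \<open>g i\<close> the generators of a free product of groups of order two, acting
  on a ball of the Cayley graph, shows that a fixed vector is supported on the words that admit a
  noncrossing pairing; the real orthogonal matrices, taken as characters, then show that it
  is determined by its values on the words in which every letter occurs at most twice. Hence the
  fixed vectors are spanned by the noncrossing pairings. The orthogonality relations
  make the coefficient matrix of \<open>P\<close> the inverse of the Gram matrix of the pairings, which is
  \<open>n^(m/2)\<close> times the identity up to a relative error \<open>1/n\<close>. So the moments of \<open>o\<^sub>s\<^sub>n\<close> converge
  to the numbers of noncrossing pairings, that is, of Dyck paths, which are the moments of the
  semicircle law.

  The universal seminorm of \<open>A\<^sub>o(n)\<close> is a supremum. It is finite because the
  generators have norm at most one in every C*-seminorm that respects the relations; this is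
  proved without completeness, from approximate square roots.\<close>

section \<open>Noncrossing pairings\<close>

text \<open>The invariance of the Haar functional is used as follows. Applying
  \<open>id \<otimes> h\<close> or \<open>h \<otimes> id\<close> to the comultiplication of a
  monomial gives a linear relation between monomials in \<open>Ao n\<close> whose coefficients are
  moments. Equality in the completion means that the universal seminorm of the difference is 0, and
  this seminorm dominates the operator norm of every finite-dimensional representation of the
  relations; so the relation may be evaluated in each of them. Orthogonal matrices alone would not
  do, since their fixed tensors include the crossing pairings. Noncommuting involutions tell these
  apart: a word in the free product reduces to the identity exactly when its letters admit a
  noncrossing pairing. Cutting the Cayley graph to a ball keeps the representation
  finite-dimensional and is harmless, because a word of length \<open>m\<close> read from the centre
  never leaves the ball of radius \<open>m\<close>. Generic words, with one letter for each pair,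
  are dual to the pairings, so the coefficients of a fixed tensor are simply its values at these
  words.\<close>

definition words :: "nat \<Rightarrow> nat \<Rightarrow> nat list set" where
  "words n m = {J. set J \<subseteq> {1..n} \<and> length J = m}"

text \<open>A noncrossing pairing is encoded by its Dyck word, in which \<open>True\<close> opens a pair and
  \<open>False\<close> closes the pair opened last. The list \<open>st\<close> is the stack of the letters of the open pairs;
  \<open>nc d [] J\<close> states that \<open>J\<close> is constant on the pairs of \<open>d\<close>.\<close>

fun nc :: "bool list \<Rightarrow> nat list \<Rightarrow> nat list \<Rightarrow> bool" where
  "nc [] st J \<longleftrightarrow> st = [] \<and> J = []"
| "nc (True # d) st (j # J) \<longleftrightarrow> nc d (j # st) J"
| "nc (False # d) (t # st) (j # J) \<longleftrightarrow> j = t \<and> nc d st J"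
| "nc _ _ _ \<longleftrightarrow> False"

fun dyck :: "nat \<Rightarrow> bool list \<Rightarrow> bool" where
  "dyck h [] \<longleftrightarrow> h = 0"
| "dyck h (True # d) \<longleftrightarrow> dyck (Suc h) d"
| "dyck (Suc h) (False # d) \<longleftrightarrow> dyck h d"
| "dyck 0 (False # d) \<longleftrightarrow> False"

definition dycks :: "nat \<Rightarrow> nat \<Rightarrow> bool list set" where
  "dycks m h = {d. dyck h d \<and> length d = m}"

text \<open>Counts the paths of \<open>m\<close> steps up or down from height \<open>h\<close> to 0
  that never go below 0. The recursion is over the first step; multiplication by x in the Chebyshev
  basis obeys the same one, which is how the semicircle moments are identified.\<close>

fun paths :: "nat \<Rightarrow> nat \<Rightarrow> nat" where
  "paths 0 h = (if h = 0 then 1 else 0)"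
| "paths (Suc m) h = paths m (Suc h) + (case h of 0 \<Rightarrow> 0 | Suc h' \<Rightarrow> paths m h')"

text \<open>Every pair receives a letter of its own, so that the resulting word determines the pairing.\<close>

fun canon :: "nat \<Rightarrow> nat list \<Rightarrow> bool list \<Rightarrow> nat list" where
  "canon c st [] = []"
| "canon c st (True # d) = c # canon (Suc c) (c # st) d"
| "canon c (t # st) (False # d) = t # canon c st d"
| "canon c [] (False # d) = []"

lemma finite_words [simp]: "finite (words n m)"
  unfolding words_def using finite_lists_length_eq[of "{1..n}" m] by (simp add: conj_commute)

lemma words_0 [simp]: "words n 0 = {[]}"
  by (auto simp: words_def)

lemma words_Suc: "words n (Suc m) = (\<lambda>(j, J). j # J) ` ({1..n} \<times> words n m)"
  unfolding words_def by (auto simp: length_Suc_conv image_iff)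

lemma sum_words_Suc:
  "(\<Sum>J\<in>words n (Suc m). f J) = (\<Sum>j\<in>{1..n}. \<Sum>J\<in>words n m. f (j # J))"
proof -
  have "(\<Sum>J\<in>words n (Suc m). f J) = (\<Sum>(j, J)\<in>{1..n} \<times> words n m. f (j # J))"
    unfolding words_Suc by (subst sum.reindex) (auto simp: inj_on_def intro!: sum.cong)
  then show ?thesis by (simp add: sum.cartesian_product)
qed

lemma nc_dyck: "nc d st J \<Longrightarrow> dyck (length st) d \<and> length J = length d"
  by (induction d st J rule: nc.induct) auto

lemma nc_even: "nc d st J \<Longrightarrow> even (count_list st x + count_list J x)"
  by (induction d st J rule: nc.induct) (auto split: if_splits)

text \<open>Each open pair on the stack still has to be closed by its own letter in
  \<open>J\<close>.\<close>

lemma nc_count_le: "nc d st J \<Longrightarrow> count_list st x \<le> count_list J x"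
  by (induction d st J rule: nc.induct) (auto split: if_splits)

text \<open>If no letter occurs more than twice in the stack and the remaining word together, every
  step is forced: opening a second pair with a letter that is already on the stack would require two
  further occurrences of it.\<close>

lemma nc_unique:
  "nc d st J \<Longrightarrow> nc d' st J \<Longrightarrow> (\<And>x. count_list st x + count_list J x \<le> 2) \<Longrightarrow> d = d'"
proof (induction d st J arbitrary: d' rule: nc.induct)
  case (1 st J)
  then show ?case by (cases d') auto
next
  case (2 d st j J)
  have nf: False if "j \<in> set st"
  proof -
    have "count_list (j # st) j \<le> count_list J j"
      using nc_count_le 2 by (metis nc.simps(2))
    moreover have "count_list st j > 0"
      using that by (metis count_list_0_iff neq0_conv)
    ultimately show False using "2.prems"(3)[of j] by auto
  qed
  show ?case
  proof (cases d')
    case Nil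
    then show ?thesis using 2 by auto
  next
    case (Cons b e)
    show ?thesis
    proof (cases b)
      case True
      have "count_list (j # st) x + count_list J x \<le> 2" for x
        using "2.prems"(3)[of x] by auto
      then show ?thesis using 2 Cons True by auto
    next
      case False
      then obtain t st' where "st = t # st'" "j = t"
        using 2 Cons by (cases st) auto
      then show ?thesis using nf by auto
    qed
  qed
next
  case (3 d t st j J)
  show ?case
  proof (cases d')
    case Nil
    then show ?thesis using 3 by auto
  next
    case (Cons b e)
    show ?thesis
    proof (cases b)
      case True
      then have "nc e (j # t # st) J" using 3 Cons by auto
      then have "count_list (j # t # st) j \<le> count_list J j"
        using nc_count_le by blast
      then show ?thesis using "3.prems"(3)[of j] "3.prems"(1) by auto
    next
      case False
      have "count_list st x + count_list J x \<le> 2" for x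
        using "3.prems"(3)[of x] by (auto split: if_splits)
      then show ?thesis using 3 Cons False by auto
    qed
  qed
qed auto

text \<open>The counter \<open>c\<close> lies above every letter on the stack, so each opened pair
  gets a fresh letter. A letter of the stack has one of its two occurrences still to come, which is
  why the counts run over stack and word together.\<close>

lemma canon_props:
  assumes "dyck (length st) d" "set st \<subseteq> {..<c}" "distinct st"
  shows "nc d st (canon c st d) \<and> (\<forall>x. count_list st x + count_list (canon c st d) x \<in> {0, 2})
     \<and> set (canon c st d) \<subseteq> set st \<union> {c..<c + length d}"
  using assms
proof (induction c st d rule: canon.induct)
  case (2 c st d)
  have "set (c # st) \<subseteq> {..<Suc c}" "distinct (c # st)" "dyck (length (c # st)) d"
    using 2(2-) by (auto simp: less_Suc_eq)
  then have IH: "nc d (c # st) (canon (Suc c) (c # st) d)"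
    "\<And>x. count_list (c#st) x + count_list (canon (Suc c) (c#st) d) x \<in> {0, 2}"
    "set (canon (Suc c) (c#st) d) \<subseteq> set (c#st) \<union> {Suc c..<Suc c + length d}"
    using 2(1) by auto
  have "count_list st x + count_list (canon c st (True # d)) x \<in> {0, 2}" for x
    using IH(2)[of x] by (auto split: if_splits)
  moreover have "set (canon c st (True # d)) \<subseteq> set st \<union> {c..<c + length (True # d)}"
    using IH(3) by (auto simp: subset_iff)
  ultimately show ?case using IH(1) by simp
next
  case (3 c t st d)
  then have IH: "nc d st (canon c st d)"
    "\<And>x. count_list st x + count_list (canon c st d) x \<in> {0, 2}"
    "set (canon c st d) \<subseteq> set st \<union> {c..<c + length d}"
    by simp_all
  have *: "t \<notin> set st" "t < c" using 3(2-) by auto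
  then have "t \<notin> set (canon c st d)" using IH(3) by (auto simp: subset_iff)
  then have "count_list st t = 0" "count_list (canon c st d) t = 0" using *
    by (auto simp: count_list_0_iff)
  then have "count_list (t#st) x + count_list (canon c (t#st) (False # d)) x \<in> {0, 2}" for x
    using IH(2)[of x] by auto
  moreover have "set (canon c (t # st) (False # d)) \<subseteq> set (t # st) \<union> {c..<c + length (False # d)}"
    using IH(3) by (auto simp: subset_iff)
  ultimately show ?case using IH(1) by simp
qed auto

text \<open>The canonical word is universal for \<open>d\<close>: an opening letter is fresh, so
  \<open>f\<close> can be extended by whatever letter \<open>J\<close> carries there, and a closing
  letter repeats a value already fixed.\<close>

lemma canon_relabel:
  "nc d (map f st) J \<Longrightarrow> set st \<subseteq> {..<c} \<Longrightarrow>
    \<exists>f'. (\<forall>x<c. f' x = f x) \<and> J = map f' (canon c st d)"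
proof (induction c st d arbitrary: f J rule: canon.induct)
  case (2 c st d)
  then obtain j J' where J: "J = j # J'" "nc d (j # map f st) J'"
    by (cases J) auto
  let ?f = "f(c := j)"
  have "map f st = map ?f st" using 2(3) by (intro map_cong) auto
  then have "nc d (map ?f (c # st)) J'" using J(2) by (simp only: list.map fun_upd_same)
  moreover have "set (c # st) \<subseteq> {..<Suc c}" using 2 by force
  ultimately obtain f' where "\<forall>x<Suc c. f' x = ?f x" "J' = map f' (canon (Suc c) (c # st) d)"
    using 2 by blast
  then show ?case using J by (intro exI[of _ f']) auto
next
  case (3 c t st d)
  then obtain j J' where J: "J = j # J'" "nc d (map f st) J'" "j = f t"
    by (cases J) auto
  then obtain f' where "\<forall>x<c. f' x = f x" "J' = map f' (canon c st d)"
    using 3 by force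
  then show ?case using J 3 by (intro exI[of _ f']) auto
qed auto

lemma finite_dycks [simp]: "finite (dycks m h)"
  unfolding dycks_def using finite_lists_length_eq[of "UNIV :: bool set" m]
  by (auto elim: rev_finite_subset)

lemma dycks_Suc:
  "dycks (Suc m) h = Cons True ` dycks m (Suc h) \<union>
    (case h of 0 \<Rightarrow> {} | Suc h' \<Rightarrow> Cons False ` dycks m h')"
proof -
  have "d \<in> dycks (Suc m) h \<longleftrightarrow> d \<in> Cons True ` dycks m (Suc h) \<union>
    (case h of 0 \<Rightarrow> {} | Suc h' \<Rightarrow> Cons False ` dycks m h')" for d
    by (cases d; cases "hd d"; cases h) (auto simp: dycks_def)
  then show ?thesis by blast
qed

lemma card_dycks: "card (dycks m h) = paths m h"
proof (induction m arbitrary: h)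
  case 0
  have "dycks 0 h = (if h = 0 then {[]} else {})" by (auto simp: dycks_def)
  then show ?case by auto
next
  case (Suc m)
  have "card (dycks (Suc m) h) = card (Cons True ` dycks m (Suc h)) +
     card (case h of 0 \<Rightarrow> {} | Suc h' \<Rightarrow> Cons False ` dycks m h')"
    unfolding dycks_Suc by (rule card_Un_disjoint) (auto split: nat.splits)
  then show ?case by (auto simp: card_image Suc.IH split: nat.splits)
qed

lemma dyck_parity: "dyck h d \<Longrightarrow> even (length d + h) \<and> h \<le> length d"
  by (induction h d rule: dyck.induct) auto

lemma half_step: "even (a + Suc b) \<Longrightarrow> Suc b \<le> a \<Longrightarrow> Suc ((a - Suc b) div 2) = (Suc a - b) div 2" for a b :: nat
  by presburger

text \<open>Letters at openings are free, letters at closings are forced by the stack, and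
  \<open>(length d - length st) div 2\<close> openings remain.\<close>

lemma card_nc:
  assumes "dyck (length st) d" "set st \<subseteq> {1..n}"
  shows "card {J\<in>words n (length d). nc d st J} = n ^ ((length d - length st) div 2)"
  using assms
proof (induction d arbitrary: st)
  case Nil
  then have "{J\<in>words n (length []). nc [] st J} = {[]}" by (auto)
  then show ?case by simp
next
  case (Cons b d)
  show ?case
  proof (cases b)
    case True
    have "{J\<in>words n (length (b # d)). nc (b # d) st J} =
       (\<Union>j\<in>{1..n}. Cons j ` {J\<in>words n (length d). nc d (j # st) J})"
      using True by (auto simp: words_Suc)
    also have "card \<dots> = (\<Sum>j\<in>{1..n}. card (Cons j ` {J\<in>words n (length d). nc d (j # st) J}))"
      by (rule card_UN_disjoint) auto
    also have "\<dots> = (\<Sum>j\<in>{1..n}. n ^ ((length d - Suc (length st)) div 2))"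
      using Cons True by (intro sum.cong) (auto simp: card_image)
    also have "\<dots> = n ^ Suc ((length d - Suc (length st)) div 2)" by simp
    also have "Suc ((length d - Suc (length st)) div 2) = (length (b # d) - length st) div 2"
    proof -
      have "even (length d + Suc (length st))" "Suc (length st) \<le> length d"
        using dyck_parity Cons True by fastforce+
      then show ?thesis using half_step by simp
    qed
    finally show ?thesis .
  next
    case False
    then obtain t st' where st: "st = t # st'" using Cons by (cases st) auto
    have "{J\<in>words n (length (b # d)). nc (b # d) st J} = Cons t ` {J\<in>words n (length d). nc d st' J}"
      using False st Cons by (auto simp: words_Suc image_iff)
    then show ?thesis using Cons False st by (simp add: card_image)
  qed
qed

text \<open>Two different pairings run with equal stacks up to a position where one opens and the
  other closes. The letter there is free for the first and forced by the second. This costs the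
  factor \<open>n\<close>, and from there on the second constraint is dropped.\<close>

lemma card_nc_nc:
  assumes "dyck (length st) d" "dyck (length st) e" "length d = length e" "d \<noteq> e" "set st \<subseteq> {1..n}"
  shows "n * card {J\<in>words n (length d). nc d st J \<and> nc e st J} \<le> n ^ ((length d - length st) div 2)"
  using assms
proof (induction d arbitrary: st e)
  case Nil
  then show ?case by simp
next
  case (Cons b d)
  then obtain b' e' where e: "e = b' # e'" "length e' = length d" by (cases e) auto
  \<comment> \<open>\<open>p\<close> continues the pairing that opens, \<open>q\<close> the one that
    closes; of the latter only the condition on the first letter is kept.\<close>
  have differ: "n * card {J\<in>words n (Suc (length d)). nc (True # p) st J \<and> nc (False # q) st J}
     \<le> n ^ ((length (True # p) - length st) div 2)"
    if H: "dyck (length st) (True # p)" "dyck (length st) (False # q)" "length p = length d" "length q = length d"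
    for p q
  proof -
    obtain t st' where st: "st = t # st'" using H by (cases st) auto
    have t: "t \<in> {1..n}" using Cons st by auto
    have "{J\<in>words n (Suc (length d)). nc (True # p) st J \<and> nc (False # q) st J}
       \<subseteq> Cons t ` {J\<in>words n (length p). nc p (t # st) J}"
      using st H by (auto simp: words_Suc)
    then have "card {J\<in>words n (Suc (length d)). nc (True # p) st J \<and> nc (False # q) st J}
       \<le> card (Cons t ` {J\<in>words n (length p). nc p (t # st) J})"
      by (intro card_mono) auto
    also have "\<dots> = n ^ ((length p - length (t # st)) div 2)"
      using card_nc[of "t # st" p n] H Cons t by (simp add: card_image)
    finally have "n * card {J\<in>words n (Suc (length d)). nc (True # p) st J \<and> nc (False # q) st J} \<le>
      n ^ Suc ((length p - length (t # st)) div 2)" by simp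
    also have "Suc ((length p - length (t # st)) div 2) = (length (True # p) - length st) div 2"
    proof -
      have "even (length p + Suc (length st))" "Suc (length st) \<le> length p"
        using dyck_parity H by fastforce+
      then show ?thesis using half_step by simp
    qed
    finally show ?thesis .
  qed
  consider "b" "b'" | "\<not>b" "\<not>b'" | "b" "\<not>b'" | "\<not>b" "b'" by blast
  then show ?case
  proof cases
    case 1
    have "{J\<in>words n (length (b # d)). nc (b # d) st J \<and> nc e st J} =
       (\<Union>j\<in>{1..n}. Cons j ` {J\<in>words n (length d). nc d (j # st) J \<and> nc e' (j # st) J})"
      using 1 e by (auto simp: words_Suc)
    also have "card \<dots> = (\<Sum>j\<in>{1..n}. card (Cons j ` {J\<in>words n (length d). nc d (j # st) J \<and> nc e' (j # st) J}))"
      by (rule card_UN_disjoint) auto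
    finally have "n * card {J\<in>words n (length (b # d)). nc (b # d) st J \<and> nc e st J} =
      (\<Sum>j\<in>{1..n}. n * card {J\<in>words n (length d). nc d (j # st) J \<and> nc e' (j # st) J})"
      by (simp add: card_image sum_distrib_left)
    also have "\<dots> \<le> (\<Sum>j\<in>{1..n}. n ^ ((length d - Suc (length st)) div 2))"
    proof (intro sum_mono)
      fix j assume "j \<in> {1..n}"
      then show "n * card {J\<in>words n (length d). nc d (j # st) J \<and> nc e' (j # st) J}
        \<le> n ^ ((length d - Suc (length st)) div 2)"
        using Cons.IH[of "j # st" e'] Cons.prems 1 e by auto
    qed
    also have "\<dots> = n ^ Suc ((length d - Suc (length st)) div 2)" by simp
    also have "Suc ((length d - Suc (length st)) div 2) = (length (b # d) - length st) div 2"
    proof -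
      have "even (length d + Suc (length st))" "Suc (length st) \<le> length d"
        using dyck_parity Cons 1 by fastforce+
      then show ?thesis using half_step by simp
    qed
    finally show ?thesis .
  next
    case 2
    then obtain t st' where st: "st = t # st'" using Cons by (cases st) auto
    have "{J\<in>words n (length (b # d)). nc (b # d) st J \<and> nc e st J}
      = Cons t ` {J\<in>words n (length d). nc d st' J \<and> nc e' st' J}"
      using 2 st Cons e by (auto simp: words_Suc image_iff)
    then show ?thesis using Cons.IH[of st' e'] Cons.prems 2 st e by (auto simp add: card_image)
  next
    case 3
    then show ?thesis using differ[of d e'] Cons.prems e by auto
  next
    case 4
    have "{J \<in> words n (length (b # d)). nc (b # d) st J \<and> nc e st J} =
      {J\<in>words n (Suc (length d)). nc (True # e') st J \<and> nc (False # d) st J}"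
      using 4 e by auto
    then show ?thesis using differ[of e' d] Cons.prems e 4 by auto
  qed
qed

text \<open>Left multiplication by the generator \<open>i\<close> in a free product of groups of
  order two, on reduced words.\<close>

definition reduce :: "nat \<Rightarrow> nat list \<Rightarrow> nat list" where
  "reduce i y = (if y \<noteq> [] \<and> hd y = i then tl y else i # y)"

text \<open>The current reduced word serves as the stack: a cancellation closes the top pair, any
  other letter opens a new one.\<close>

lemma reduce_nc: "fold reduce J st = [] \<Longrightarrow> \<exists>d. nc d st J"
proof (induction J arbitrary: st)
  case Nil
  then show ?case by (intro exI[of _ "[]"]) simp
next
  case (Cons j J)
  then obtain d where d: "nc d (reduce j st) J" by auto
  show ?case
  proof (cases "st \<noteq> [] \<and> hd st = j")
    case True
    then show ?thesis using d by (intro exI[of _ "False # d"], cases st) (auto simp: reduce_def)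
  next
    case False
    then show ?thesis using d by (intro exI[of _ "True # d"]) (auto simp: reduce_def)
  qed
qed

section \<open>Invariant tensors\<close>

definition orth :: "nat \<Rightarrow> (nat \<Rightarrow> nat \<Rightarrow> real) \<Rightarrow> bool" where
  "orth n R \<longleftrightarrow> (\<forall>i\<in>{1..n}. \<forall>j\<in>{1..n}.
     (\<Sum>k=1..n. R i k * R j k) = (if i = j then 1 else 0) \<and>
     (\<Sum>k=1..n. R k i * R k j) = (if i = j then 1 else 0))"

text \<open>The value at the monomial \<open>w\<close> of the character that sends the generator
  with index \<open>(i, j)\<close> to \<open>R i j\<close>.\<close>

definition weight :: "(nat \<Rightarrow> nat \<Rightarrow> real) \<Rightarrow> (nat \<times> nat) list \<Rightarrow> real" where
  "weight R w = prod_list (map (\<lambda>(i, j). R i j) w)"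

definition invariant :: "nat \<Rightarrow> nat \<Rightarrow> (nat list \<Rightarrow> complex) \<Rightarrow> bool" where
  "invariant n m \<xi> \<longleftrightarrow> (\<forall>R. orth n R \<longrightarrow> (\<forall>I\<in>words n m.
     (\<Sum>K\<in>words n m. of_real (weight R (zip I K)) * \<xi> K) = \<xi> I))"

text \<open>The row relation \<open>u u^t = 1\<close> inside a monomial, as seen by a functional.
  Isolating it lets one computation serve both the characters and the Haar moments.\<close>

definition contracts :: "nat \<Rightarrow> ((nat \<times> nat) list \<Rightarrow> complex) \<Rightarrow> bool" where
  "contracts n \<phi> \<longleftrightarrow> (\<forall>v w. \<forall>i\<in>{1..n}. \<forall>t\<in>{1..n}.
     set v \<subseteq> {1..n} \<times> {1..n} \<longrightarrow> set w \<subseteq> {1..n} \<times> {1..n} \<longrightarrow>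
     (\<Sum>j=1..n. \<phi> (v @ (i, j) # (t, j) # w)) = (if i = t then \<phi> (v @ w) else 0))"

lemma weight_simps [simp]:
  "weight R [] = 1" "weight R ((i, j) # w) = R i j * weight R w"
  "weight R (v @ w) = weight R v * weight R w"
  by (simp_all add: weight_def)

lemma contracts_weight: "orth n R \<Longrightarrow> contracts n (\<lambda>w. of_real (weight R w))"
  unfolding contracts_def
proof (intro allI ballI impI)
  fix v w i t assume a: "orth n R" "i \<in> {1..n}" "t \<in> {1..n}"
  have *: "(\<Sum>j=1..n. complex_of_real (weight R (v @ (i, j) # (t, j) # w))) =
    of_real (weight R v * weight R w * (\<Sum>j=1..n. R i j * R t j))"
    unfolding of_real_sum[symmetric] sum_distrib_left
    by (intro arg_cong[where f = of_real] sum.cong) (auto simp: mult_ac)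
  have **: "(\<Sum>j=1..n. R i j * R t j) = (if i = t then 1 else 0)"
    using a by (auto simp: orth_def)
  show "(\<Sum>j=1..n. complex_of_real (weight R (v @ (i, j) # (t, j) # w))) =
      (if i = t then of_real (weight R (v @ w)) else 0)"
    unfolding * ** by simp
qed

lemma set_zip_words: "I \<in> words n m \<Longrightarrow> J \<in> words n m' \<Longrightarrow> set (zip I J) \<subseteq> {1..n} \<times> {1..n}"
  by (auto simp: words_def dest: set_zip_leftD set_zip_rightD)

lemma sum_if_distrib: "(\<Sum>x\<in>A. if P then f x else 0) = (if P then \<Sum>x\<in>A. f x else 0)"
  by simp

text \<open>In tensor notation this is \<open>u^m T = T u^k\<close>, where \<open>T\<close> is the
  map of the partial pairing \<open>d\<close> with \<open>k = length st\<close> open strands: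
  \<open>st\<close> holds the column letters of these strands and \<open>S\<close> their row
  letters. In the induction an opening adds a strand, which \<open>contracts\<close> then
  eliminates.\<close>

lemma nc_contract_stack:
  assumes "contracts n \<phi>" "set st \<subseteq> {1..n}" "set v \<subseteq> {1..n} \<times> {1..n}" "I \<in> words n (length d)"
  shows "(\<Sum>J\<in>words n (length d). if nc d st J then \<phi> (v @ zip I J) else 0) =
    (\<Sum>S\<in>words n (length st). if nc d S I then \<phi> (v @ zip S st) else 0)"
  using assms(2-)
proof (induction d arbitrary: st I v)
  case Nil
  have "(\<Sum>S\<in>words n (length st). if nc [] S I then \<phi> (v @ zip S st) else 0) = (if st = [] then \<phi> v else 0)"
    using Nil by (cases st) (auto simp: words_Suc intro!: sum.neutral)
  then show ?case using Nil by auto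
next
  case (Cons b d)
  obtain i I' where I: "I = i # I'" "i \<in> {1..n}" "I' \<in> words n (length d)"
    using Cons.prems by (auto simp: words_Suc)
  show ?case
  proof (cases b)
    case True
    have "(\<Sum>J\<in>words n (length (b # d)). if nc (b # d) st J then \<phi> (v @ zip I J) else 0) =
      (\<Sum>j\<in>{1..n}. \<Sum>J\<in>words n (length d). if nc d (j # st) J then \<phi> ((v @ [(i, j)]) @ zip I' J) else 0)"
      using True I by (simp add: sum_words_Suc cong: if_cong)
    also have "\<dots> = (\<Sum>j\<in>{1..n}. \<Sum>S\<in>words n (length (j # st)). if nc d S I' then \<phi> ((v @ [(i, j)]) @ zip S (j # st)) else 0)"
      using Cons.prems I by (intro sum.cong refl Cons.IH) auto
    also have "\<dots> = (\<Sum>j\<in>{1..n}. \<Sum>t\<in>{1..n}. \<Sum>S\<in>words n (length st).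
        if nc d (t # S) I' then \<phi> (v @ (i, j) # (t, j) # zip S st) else 0)"
      by (simp add: sum_words_Suc cong: if_cong)
    \<comment> \<open>The sum over the new column letter \<open>j\<close> is moved inside, where it
      becomes a contraction.\<close>
    also have "\<dots> = (\<Sum>t\<in>{1..n}. \<Sum>S\<in>words n (length st). \<Sum>j\<in>{1..n}.
        if nc d (t # S) I' then \<phi> (v @ (i, j) # (t, j) # zip S st) else 0)"
      by (subst sum.swap, intro sum.cong refl, subst sum.swap, rule refl)
    also have "\<dots> = (\<Sum>t\<in>{1..n}. \<Sum>S\<in>words n (length st).
        if i = t then if nc d (i # S) I' then \<phi> (v @ zip S st) else 0 else 0)"
    proof (intro sum.cong refl)
      fix t S assume t: "t \<in> {1..n}" "S \<in> words n (length st)"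
      then have "set (zip S st) \<subseteq> {1..n} \<times> {1..n}"
        using set_zip_words[of S n "length st" st "length st"] Cons.prems by (simp add: words_def)
      then show "(\<Sum>j\<in>{1..n}. if nc d (t # S) I' then \<phi> (v @ (i, j) # (t, j) # zip S st) else 0) =
        (if i = t then if nc d (i # S) I' then \<phi> (v @ zip S st) else 0 else 0)"
        using assms(1) t I Cons.prems unfolding sum_if_distrib contracts_def by auto
    qed
    also have "\<dots> = (\<Sum>S\<in>words n (length st). if nc d (i # S) I' then \<phi> (v @ zip S st) else 0)"
      using I by (subst sum.swap) (simp add: sum.delta)
    finally show ?thesis using I True by simp
  next
    case False
    show ?thesis
    proof (cases st)
      case Nil
      then show ?thesis using False by (simp add: sum.neutral)
    next
      case (Cons t st')
      have t: "t \<in> {1..n}" "set st' \<subseteq> {1..n}" using Cons \<open>set st \<subseteq> {1..n}\<close> by auto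
      have "(\<Sum>J\<in>words n (length (b # d)). if nc (b # d) st J then \<phi> (v @ zip I J) else 0) =
        (\<Sum>j\<in>{1..n}. \<Sum>J\<in>words n (length d). if j = t then if nc d st' J then \<phi> (v @ (i, j) # zip I' J) else 0 else 0)"
        using False I Cons by (auto simp add: sum_words_Suc intro!: sum.cong)
      also have "\<dots> = (\<Sum>J\<in>words n (length d). if nc d st' J then \<phi> ((v @ [(i, t)]) @ zip I' J) else 0)"
        using t by (subst sum.swap) (simp add: sum.delta' cong: if_cong)
      also have "\<dots> = (\<Sum>S\<in>words n (length st'). if nc d S I' then \<phi> ((v @ [(i, t)]) @ zip S st') else 0)"
        using I t Cons.prems by (intro Cons.IH) auto
      also have "\<dots> = (\<Sum>t'\<in>{1..n}. \<Sum>S\<in>words n (length st').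
           if i = t' then if nc d S I' then \<phi> (v @ (t', t) # zip S st') else 0 else 0)"
        using I by (subst sum.swap) (simp add: sum.delta cong: if_cong)
      also have "\<dots> = (\<Sum>S\<in>words n (length st). if nc (b # d) S I then \<phi> (v @ zip S st) else 0)"
        using False I Cons by (auto simp add: sum_words_Suc intro!: sum.cong)
      finally show ?thesis .
    qed
  qed
qed

text \<open>The case without open strands: the vector of a noncrossing pairing is fixed. For
  characters this gives \<open>invariant_nc\<close>, for the Haar moments the linear system for the
  Weingarten matrix.\<close>

lemma nc_contract:
  assumes "contracts n \<phi>" "d \<in> dycks m 0" "I \<in> words n m"
  shows "(\<Sum>J\<in>words n m. if nc d [] J then \<phi> (zip I J) else 0) = (if nc d [] I then \<phi> [] else 0)"
  using nc_contract_stack[of n \<phi> "[]" "[]" I d] assms by (auto simp: dycks_def cong: if_cong)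

lemma invariant_nc:
  assumes "d \<in> dycks m 0"
  shows "invariant n m (\<lambda>J. if nc d [] J then 1 else 0)"
  unfolding invariant_def
proof (intro allI impI ballI)
  fix R I assume "orth n R" "I \<in> words n m"
  then have "(\<Sum>J\<in>words n m. if nc d [] J then complex_of_real (weight R (zip I J)) else 0)
     = (if nc d [] I then 1 else 0)"
    using nc_contract[OF contracts_weight assms] by simp
  then show "(\<Sum>K\<in>words n m. complex_of_real (weight R (zip I K)) * (if nc d [] K then 1 else 0)) =
           (if nc d [] I then 1 else 0)"
    by (simp add: if_distrib cong: if_cong)
qed

lemma invariant_diff:
  assumes "invariant n m \<xi>" "finite A" "\<And>a. a \<in> A \<Longrightarrow> invariant n m (\<eta> a)"
  shows "invariant n m (\<lambda>J. \<xi> J - (\<Sum>a\<in>A. c a * \<eta> a J))"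
  unfolding invariant_def
proof (intro allI impI ballI)
  fix R I assume R: "orth n R" "I \<in> words n m"
  let ?w = "\<lambda>K. complex_of_real (weight R (zip I K))"
  have "(\<Sum>K\<in>words n m. ?w K * (\<xi> K - (\<Sum>a\<in>A. c a * \<eta> a K))) =
     (\<Sum>K\<in>words n m. ?w K * \<xi> K) - (\<Sum>K\<in>words n m. \<Sum>a\<in>A. c a * (?w K * \<eta> a K))"
    by (simp add: right_diff_distrib sum_subtractf sum_distrib_left mult_ac)
  also have "(\<Sum>K\<in>words n m. \<Sum>a\<in>A. c a * (?w K * \<eta> a K)) = (\<Sum>a\<in>A. c a * (\<Sum>K\<in>words n m. ?w K * \<eta> a K))"
    by (subst sum.swap) (simp add: sum_distrib_left)
  also have "\<dots> = (\<Sum>a\<in>A. c a * \<eta> a I)"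
    using assms R by (intro sum.cong) (auto simp: invariant_def)
  also have "(\<Sum>K\<in>words n m. ?w K * \<xi> K) = \<xi> I" using assms R by (auto simp: invariant_def)
  finally show "(\<Sum>K\<in>words n m. ?w K * (\<xi> K - (\<Sum>a\<in>A. c a * \<eta> a K))) = \<xi> I - (\<Sum>a\<in>A. c a * \<eta> a I)" .
qed

section \<open>Invariance under permutation matrices\<close>

lemma orth_perm:
  assumes "bij_betw g {1..n} {1..n}"
  shows "orth n (\<lambda>i k. if i = g k then 1 else 0)"
  unfolding orth_def
proof (intro ballI conjI)
  fix i j assume i: "i \<in> {1..n}" "j \<in> {1..n}"
  obtain k where k: "k \<in> {1..n}" "i = g k" using assms i(1) by (metis bij_betw_def imageE)
  have u: "i = g x \<longleftrightarrow> x = k" if "x \<in> {1..n}" for x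
    using assms k that by (metis bij_betw_def inj_onD)
  have "(\<Sum>x=1..n. (if i = g x then 1 else 0) * (if j = g x then 1 else 0::real)) =
    (\<Sum>x=1..n. if x = k then if i = j then 1 else 0 else 0)"
    using u k by (intro sum.cong) auto
  then show "(\<Sum>x=1..n. (if i = g x then 1 else 0) * (if j = g x then 1 else 0::real)) = (if i = j then 1 else 0)"
    using k by (simp add: sum.delta')
  have "g i \<in> {1..n}" using assms i by (auto simp: bij_betw_def)
  have v: "g i = g j \<longleftrightarrow> i = j" using assms i by (meson bij_betw_def inj_onD)
  have "(\<Sum>x=1..n. (if x = g i then 1 else 0) * (if x = g j then 1 else 0::real)) =
    (\<Sum>x=1..n. if x = g i then if i = j then 1 else 0 else 0)"
    using v by (intro sum.cong) auto
  then show "(\<Sum>x=1..n. (if x = g i then 1 else 0) * (if x = g j then 1 else 0::real)) = (if i = j then 1 else 0)"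
    using \<open>g i \<in> {1..n}\<close> by (simp add: sum.delta')
qed

lemma weight_perm:
  "length I = length K \<Longrightarrow> weight (\<lambda>i k. if i = g k then 1 else 0) (zip I K) = (if I = map g K then 1 else 0)"
  by (induction I K rule: list_induct2) auto

text \<open>In the row \<open>map g J\<close> the tensor power of a permutation matrix has a single
  nonzero entry, in the column \<open>J\<close>.\<close>

lemma invariant_perm:
  assumes "invariant n m \<xi>" "bij_betw g {1..n} {1..n}" "J \<in> words n m"
  shows "\<xi> (map g J) = \<xi> J"
proof -
  have gJ: "map g J \<in> words n m" using assms by (auto simp: words_def bij_betw_def)
  have "\<xi> (map g J) = (\<Sum>K\<in>words n m. of_real (weight (\<lambda>i k. if i = g k then 1 else 0) (zip (map g J) K)) * \<xi> K)"
    using assms(1) orth_perm[OF assms(2)] gJ unfolding invariant_def by auto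
  also have "\<dots> = (\<Sum>K\<in>words n m. if K = J then \<xi> J else 0)"
  proof (intro sum.cong refl)
    fix K assume K: "K \<in> words n m"
    have "map g J = map g K \<longleftrightarrow> K = J"
      using assms(2,3) K inj_on_map_eq_map[of g J K] inj_on_subset[of g "{1..n}" "set J \<union> set K"]
      unfolding words_def bij_betw_def by auto
    then show "of_real (weight (\<lambda>i k. if i = g k then 1 else 0) (zip (map g J) K)) * \<xi> K = (if K = J then \<xi> J else 0)"
      using K assms(3) by (subst weight_perm) (auto simp: words_def)
  qed
  also have "\<dots> = \<xi> J" using assms by simp
  finally show ?thesis .
qed

lemma extend_inj_to_bij:
  assumes "finite S" "A \<subseteq> S" "f ` A \<subseteq> S" "inj_on f A"
  obtains g where "bij_betw g S S" "\<And>x. x \<in> A \<Longrightarrow> g x = f x"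
proof -
  have "card (S - A) = card (S - f ` A)"
    using assms by (simp add: card_Diff_subset finite_subset card_image)
  then obtain h where h: "bij_betw h (S - A) (S - f ` A)"
    using assms by (metis finite_Diff finite_same_card_bij)
  let ?g = "\<lambda>x. if x \<in> A then f x else h x"
  have "bij_betw ?g A (f ` A)" using assms(4) by (simp add: bij_betw_def inj_on_def image_def)
  moreover have "bij_betw ?g (S - A) (S - f ` A)"
    using h by (subst bij_betw_cong[where g = h]) auto
  ultimately have "bij_betw ?g (A \<union> (S - A)) (f ` A \<union> (S - f ` A))"
    by (rule bij_betw_combine) auto
  moreover have "A \<union> (S - A) = S" "f ` A \<union> (S - f ` A) = S" using assms by auto
  ultimately show thesis using that[of ?g] by auto
qed

text \<open>An injection on the letters of \<open>J\<close> extends to a permutation of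
  \<open>{1..n}\<close>, so an invariant tensor sees only which positions carry equal
  letters.\<close>

lemma invariant_inj:
  assumes "invariant n m \<xi>" "inj_on f (set J)" "J \<in> words n m" "map f J \<in> words n m"
  shows "\<xi> (map f J) = \<xi> J"
proof -
  obtain g where g: "bij_betw g {1..n} {1..n}" "\<And>x. x \<in> set J \<Longrightarrow> g x = f x"
    using extend_inj_to_bij[of "{1..n}" "set J" f] assms by (auto simp: words_def)
  then have eq: "map f J = map g J" by auto
  show ?thesis unfolding eq by (rule invariant_perm[OF assms(1) g(1) assms(3)])
qed

text \<open>A rotation in the plane of \<open>a\<close> and \<open>c\<close>; any angle whose sine and cosine are nonzero and of distinct moduli would do.\<close>

definition rot :: "nat \<Rightarrow> nat \<Rightarrow> nat \<Rightarrow> nat \<Rightarrow> real" where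
  "rot a c i j = (if i = a \<and> j = a then 3/5 else if i = a \<and> j = c then - 4/5 else
     if i = c \<and> j = a then 4/5 else if i = c \<and> j = c then 3/5 else if i = j then 1 else 0)"

lemma rot_nonzero: "rot a c i k \<noteq> 0 \<Longrightarrow> k = i \<or> (i \<in> {a, c} \<and> k \<in> {a, c})"
  by (cases "i = a"; cases "i = c"; cases "k = a"; cases "k = c") (simp_all add: rot_def split: if_splits)

lemma orth_rot:
  assumes "a \<in> {1..n}" "c \<in> {1..n}" "a \<noteq> c"
  shows "orth n (rot a c)"
  unfolding orth_def
proof (intro ballI)
  fix i j assume ij: "i \<in> {1..n}" "j \<in> {1..n}"
  have 1: "(\<Sum>k=1..n. rot a c i k * rot a c j k) = (\<Sum>k\<in>{a, c, i}. rot a c i k * rot a c j k)"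
    using assms ij by (intro sum.mono_neutral_right) (auto simp: rot_def)
  have 2: "(\<Sum>k=1..n. rot a c k i * rot a c k j) = (\<Sum>k\<in>{a, c, i}. rot a c k i * rot a c k j)"
    using assms ij by (intro sum.mono_neutral_right) (auto simp: rot_def)
  show "(\<Sum>k=1..n. rot a c i k * rot a c j k) = (if i = j then 1 else 0) \<and>
     (\<Sum>k=1..n. rot a c k i * rot a c k j) = (if i = j then 1 else 0)"
    unfolding 1 2 using assms(3)
    by (cases "i = a"; cases "i = c"; cases "j = a"; cases "j = c") (auto simp: rot_def insert_absorb)
qed

lemma weight_rot_diag:
  "c \<notin> set y \<Longrightarrow> weight (rot a c) (zip y y) = (3/5) ^ count_list y a"
proof (induction y)
  case (Cons i y)
  then have "rot a c i i = (if i = a then 3/5 else 1)" by (simp add: rot_def)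
  then show ?case using Cons by simp
qed simp

lemma weight_rot_move:
  "c \<notin> set y \<Longrightarrow> a \<noteq> c \<Longrightarrow> weight (rot a c) (zip y (map (id(a := c)) y)) = (- 4/5) ^ count_list y a"
proof (induction y)
  case (Cons i y)
  then have r: "rot a c i ((id(a := c)) i) = (if i = a then - 4/5 else 1)" by (auto simp add: rot_def)
  have IH: "weight (rot a c) (zip y (map (id(a := c)) y)) = (- 4/5) ^ count_list y a"
    by (rule Cons.IH) (use Cons.prems in auto)
  show ?case unfolding list.map zip_Cons_Cons weight_simps r IH by simp
qed simp

lemma weight_nonzero:
  "length I = length K \<Longrightarrow> weight R (zip I K) \<noteq> 0 \<Longrightarrow> list_all2 (\<lambda>i k. R i k \<noteq> 0) I K"
  by (induction I K rule: list_induct2) simp_all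

text \<open>For odd \<open>l\<close> the sum is \<open>12/25 * ((3/5)^(l-1) - (4/5)^(l-1))\<close>.
  It vanishes at \<open>l = 1\<close>, so a letter occurring just twice escapes the argument, as it
  must: the pairings do not vanish on such words.\<close>

lemma rot_power_neq:
  assumes "odd l" "l \<ge> 3"
  shows "(4/5) * (3/5) ^ l + (3/5) * (- 4/5) ^ l \<noteq> (0::real)"
proof -
  obtain k where k: "l = Suc k" using assms by (cases l) auto
  have "(3/5::real) ^ k < (4/5) ^ k" using assms k by (intro power_strict_mono) auto
  moreover have "(- 4/5 :: real) ^ l = - ((4/5) ^ l)" using assms(1) by (simp add: power_minus_odd)
  ultimately show ?thesis using k by simp
qed

text \<open>The rotation mixes only \<open>a\<close> and \<open>c\<close>, so a row word and a
  column word of nonzero weight agree once these two letters are merged.\<close>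

lemma list_all2_fold_eq:
  "list_all2 (\<lambda>i k. k = i \<or> (i \<in> {a, c} \<and> k \<in> {a, c})) I K \<Longrightarrow> map (id(c := a)) K = map (id(c := a)) I"
proof (induction I K rule: list_all2_induct)
  case (Cons i I k K)
  then have "(id(c := a)) k = (id(c := a)) i" by (auto simp: fun_upd_apply)
  then show ?case using Cons.IH by (simp only: list.map)
qed simp

text \<open>Undoes the merger: over the places of \<open>a\<close> in \<open>J\<close>, the word
  \<open>K\<close> uses only \<open>a\<close>, only \<open>c\<close>, or both, and in the last case
  it has more letters than \<open>J\<close>.\<close>

lemma map_fold_cases:
  assumes "map (id(c := a)) K = J" "c \<notin> set J"
  shows "K = J \<or> K = map (id(a := c)) J \<or> insert c (set J) \<subseteq> set K"
proof (cases "c \<in> set K")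
  case False
  then have "map (id(c := a)) K = K" by (intro map_idI) auto
  then show ?thesis using assms by simp
next
  case c: True
  show ?thesis
  proof (cases "a \<in> set K")
    case True
    then show ?thesis using c assms(1) by (auto split: if_splits)
  next
    case False
    then have "map (id(a := c)) (map (id(c := a)) K) = K"
      unfolding map_map by (intro map_idI) auto
    then show ?thesis using assms by simp
  qed
qed

text \<open>Downward induction on the number of letters of \<open>J\<close>. If \<open>a\<close> occurs at least four times in \<open>J\<close> and \<open>c\<close>
  does not occur, evaluate the invariance under a rotation in the plane of \<open>a\<close> and \<open>c\<close> at the word \<open>J\<close> with one \<open>a\<close>
  replaced by \<open>c\<close>: the terms with more letters than \<open>J\<close> vanish, and two multiples of \<open>\<eta> J\<close> remain.\<close>

lemma invariant_zero:
  assumes inv: "invariant n m \<eta>" and nm: "m \<le> n"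
    and no: "\<And>J. J \<in> words n m \<Longrightarrow> \<nexists>d. nc d [] J \<Longrightarrow> \<eta> J = 0"
    and gen: "\<And>J. J \<in> words n m \<Longrightarrow> \<forall>x. count_list J x \<le> 2 \<Longrightarrow> \<eta> J = 0"
  shows "J \<in> words n m \<Longrightarrow> \<eta> J = 0"
proof (induction J rule: measure_induct_rule[of "\<lambda>J. n - card (set J)"])
  case (less J)
  show ?case
  proof (cases "(\<nexists>d. nc d [] J) \<or> (\<forall>x. count_list J x \<le> 2)")
    case True
    then show ?thesis using no gen less by blast
  next
    case False
    then obtain d a where d: "nc d [] J" and a: "count_list J a > 2" by (auto simp: not_le)
    have "even (count_list J a)" using nc_even[OF d, of a] by simp
    have aJ: "a \<in> set J" using a by (metis count_list_0_iff not_less_zero)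
    then obtain x y where J: "J = x @ a # y" "a \<notin> set x" by (metis split_list_first)
    \<comment> \<open>The count in \<open>J\<close> is even and exceeds 2, hence is at least 4;
      \<open>y\<close> lacks only the first occurrence.\<close>
    have l: "odd (count_list y a)" "count_list y a \<ge> 3"
      using \<open>even (count_list J a)\<close> a J by (auto simp: count_list_0_iff) presburger
    have Jw: "set J \<subseteq> {1..n}" "length J = m" using less by (auto simp: words_def)
    \<comment> \<open>A repeated letter leaves fewer than \<open>m \<le> n\<close> letters in use,
      so a spare letter \<open>c\<close> exists.\<close>
    have "\<not> distinct J" using a distinct_count_atmost_1 [of J] aJ by (metis J(1) J(2) Un_iff count_list_0_iff distinct.simps(2) distinct_append l(2) not_numeral_le_zero)
    then have "card (set J) < m" using Jw by (metis card_distinct card_length le_neq_implies_less)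
    then have "card (set J) < card {1..n}" using nm by simp
    then obtain c where c: "c \<in> {1..n}" "c \<notin> set J"
      by (metis List.finite_set card_mono not_le subsetI)
    have ac: "a \<noteq> c" "a \<in> {1..n}" using c aJ Jw by auto
    have IH: "\<eta> K = 0" if "K \<in> words n m" "insert c (set J) \<subseteq> set K" for K
    proof (rule less.IH)
      have "card (set J) < card (set K)"
        using that c by (intro psubset_card_mono) auto
      moreover have "card (set K) \<le> n" using that(1) card_mono[of "{1..n}" "set K"] by (auto simp: words_def)
      ultimately show "n - card (set K) < n - card (set J)" by linarith
    qed fact
    let ?J' = "x @ c # y" and ?Jc = "map (id(a := c)) J"
    have J': "?J' \<in> words n m" using J Jw c by (auto simp: words_def)
    have "a \<in> set y" using l by (metis count_list_0_iff not_numeral_le_zero)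
    then have "insert c (set J) \<subseteq> set ?J'" unfolding J(1) by auto
    then have "\<eta> ?J' = 0" by (rule IH[OF J'])
    have Jc: "?Jc \<in> words n m" using Jw c by (auto simp: words_def)
    have neq: "?Jc \<noteq> J" using ac(1) unfolding J(1) by simp
    \<comment> \<open>As \<open>c\<close> is new, renaming \<open>a\<close> to \<open>c\<close> is
      injective on the letters of \<open>J\<close>.\<close>
    have "\<eta> ?Jc = \<eta> J"
      using c by (intro invariant_inj[OF inv _ less.prems Jc]) (auto simp: inj_on_def)
    have w1: "weight (rot a c) (zip ?J' J) = 4/5 * (3/5) ^ count_list y a"
    proof -
      have "weight (rot a c) (zip x x) = 1" using J c by (subst weight_rot_diag) (auto simp: count_list_0_iff)
      moreover have "weight (rot a c) (zip y y) = (3/5) ^ count_list y a" using J c by (intro weight_rot_diag) auto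
      ultimately show ?thesis using J(1) ac by (simp add: rot_def)
    qed
    have w2: "weight (rot a c) (zip ?J' ?Jc) = 3/5 * (- 4/5) ^ count_list y a"
    proof -
      have "map (id(a := c)) x = x" using J by (intro map_idI) auto
      moreover have "weight (rot a c) (zip x x) = 1" using J c by (subst weight_rot_diag) (auto simp: count_list_0_iff)
      moreover have "weight (rot a c) (zip y (map (id(a := c)) y)) = (- 4/5) ^ count_list y a" using J c ac by (intro weight_rot_move) auto
      ultimately show ?thesis using J(1) ac by (simp add: rot_def)
    qed
    have "0 = (\<Sum>K\<in>words n m. of_real (weight (rot a c) (zip ?J' K)) * \<eta> K)"
      using inv orth_rot[OF ac(2) c(1) ac(1)] J' \<open>\<eta> ?J' = 0\<close> unfolding invariant_def by simp
    also have "\<dots> = (\<Sum>K\<in>{J, ?Jc}. of_real (weight (rot a c) (zip ?J' K)) * \<eta> K)"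
    proof (intro sum.mono_neutral_right ballI)
      fix K assume K: "K \<in> words n m - {J, ?Jc}"
      show "of_real (weight (rot a c) (zip ?J' K)) * \<eta> K = 0"
      proof (cases "weight (rot a c) (zip ?J' K) = 0")
        case False
        then have "list_all2 (\<lambda>i k. rot a c i k \<noteq> 0) ?J' K"
          using K J' by (intro weight_nonzero) (auto simp: words_def)
        then have "list_all2 (\<lambda>i k. k = i \<or> (i \<in> {a, c} \<and> k \<in> {a, c})) ?J' K"
          by (rule list_all2_mono) (rule rot_nonzero)
        then have "map (id(c := a)) K = map (id(c := a)) ?J'" by (rule list_all2_fold_eq)
        also have "\<dots> = J" using c(2) ac unfolding J(1) by (auto intro!: map_idI)
        finally have "insert c (set J) \<subseteq> set K" using map_fold_cases[of c a K J] K c by blast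
        then show ?thesis using IH[of K] K by simp
      qed auto
    qed (use Jc less.prems in auto)
    also have "\<dots> = of_real (weight (rot a c) (zip ?J' J) + weight (rot a c) (zip ?J' ?Jc)) * \<eta> J"
      using neq \<open>\<eta> ?Jc = \<eta> J\<close> by (simp add: distrib_right)
    finally have "complex_of_real (weight (rot a c) (zip ?J' J) + weight (rot a c) (zip ?J' ?Jc)) * \<eta> J = 0"
      by simp
    moreover have "complex_of_real (4/5 * (3/5) ^ count_list y a + 3/5 * (- 4/5) ^ count_list y a) \<noteq> 0"
      using rot_power_neq[OF l] unfolding of_real_eq_0_iff .
    ultimately show ?thesis unfolding w1 w2 by (simp only: mult_eq_0_iff simp_thms)
  qed
qed

section \<open>Generic words and the expansion in noncrossing pairings\<close>

definition generic :: "bool list \<Rightarrow> nat list" where "generic = canon 1 []"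

lemma generic_words:
  assumes "d \<in> dycks m 0" "m \<le> n"
  shows "generic d \<in> words n m" "count_list (generic d) x \<in> {0, 2}" "nc d [] (generic d)"
  using canon_props[of "[]" d 1] assms nc_dyck[of d "[]" "canon 1 [] d"] by (auto simp: words_def dycks_def generic_def)

text \<open>Makes the generic words dual to the pairings: at \<open>generic d\<close> only the
  indicator of \<open>d\<close> itself is nonzero, so the coefficients of a combination of pairings
  are its values there.\<close>

lemma nc_generic:
  assumes "d \<in> dycks m 0" "nc e [] (generic d)"
  shows "e = d"
proof -
  have "count_list [] x + count_list (generic d) x \<le> 2" for x
    using generic_words(2)[OF assms(1) order.refl, of x] by auto
  then show ?thesis using nc_unique[OF assms(2) generic_words(3)[OF assms(1) order.refl]] by blast
qed

text \<open>Each letter of \<open>generic d\<close> occurs twice, so two of them sent to the same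
  letter would give it four occurrences in \<open>J\<close>.\<close>

lemma generic_relabel:
  assumes "d \<in> dycks m 0" "nc d [] J" "\<forall>x. count_list J x \<le> 2"
  obtains f where "J = map f (generic d)" "inj_on f (set (generic d))"
proof -
  obtain f where f: "J = map f (generic d)"
    using canon_relabel[of d id "[]" J 1] assms by (auto simp: generic_def)
  have "inj_on f (set (generic d))"
  proof (rule inj_onI, rule ccontr)
    fix a b assume ab: "a \<in> set (generic d)" "b \<in> set (generic d)" "f a = f b" "a \<noteq> b"
    have "count_list (generic d) a = 2" "count_list (generic d) b = 2"
      using generic_words(2)[OF assms(1) order.refl, of a] generic_words(2)[OF assms(1) order.refl, of b] ab(1,2)
      by (auto simp: count_list_0_iff)
    moreover have "count_list G a + count_list G b \<le> count_list (map f G) (f a)" for G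
      using ab by (induction G) auto
    from this[of "generic d"] have "count_list (generic d) a + count_list (generic d) b \<le> count_list J (f a)"
      using f by simp
    moreover have "count_list J (f a) \<le> 2" using assms(3) by blast
    ultimately show False by linarith
  qed
  then show thesis using f that by blast
qed

text \<open>Subtracting the combination with coefficients read at the generic words leaves an
  invariant that vanishes wherever letters occur at most twice: such a word has no pairing at all,
  or exactly one, and is then an injective relabelling of a generic word.
  \<open>invariant_zero\<close> extends this to all words.\<close>

theorem invariant_expansion:
  assumes inv: "invariant n m \<xi>" and nm: "m \<le> n"
    and no: "\<And>J. J \<in> words n m \<Longrightarrow> \<nexists>d. nc d [] J \<Longrightarrow> \<xi> J = 0"
    and J: "J \<in> words n m"
  shows "\<xi> J = (\<Sum>d\<in>dycks m 0. \<xi> (generic d) * (if nc d [] J then 1 else 0))"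
proof -
  let ?\<eta> = "\<lambda>J. \<xi> J - (\<Sum>d\<in>dycks m 0. \<xi> (generic d) * (if nc d [] J then 1 else 0))"
  have "?\<eta> J = 0"
  proof (rule invariant_zero[OF _ nm _ _ J])
    show "invariant n m ?\<eta>" using inv by (intro invariant_diff invariant_nc) auto
    show z: "?\<eta> J = 0" if "J \<in> words n m" "\<nexists>d. nc d [] J" for J
      using no that by (auto intro!: sum.neutral)
    show "?\<eta> J = 0" if J: "J \<in> words n m" and c: "\<forall>x. count_list J x \<le> 2" for J
    proof (cases "\<exists>d. nc d [] J")
      case True
      then obtain d where d: "nc d [] J" by blast
      then have dm: "d \<in> dycks m 0" using nc_dyck[OF d] J by (auto simp: dycks_def words_def)
      have u: "nc e [] J \<longleftrightarrow> e = d" for e using nc_unique[OF d, of e] d c by auto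
      obtain f where f: "J = map f (generic d)" "inj_on f (set (generic d))"
        using generic_relabel[OF dm d c] .
      then have "\<xi> J = \<xi> (generic d)"
        using invariant_inj[OF inv f(2)] generic_words(1)[OF dm nm] J by simp
      then show ?thesis using dm unfolding u by (simp add: if_distrib cong: if_cong)
    next
      case False
      then show ?thesis using z J by blast
    qed
  qed
  then show ?thesis by simp
qed

section \<open>Asymptotics of the Weingarten matrix\<close>

lemma card_nc_diag: "d \<in> dycks m 0 \<Longrightarrow> card {J\<in>words n m. nc d [] J} = n ^ (m div 2)"
  using card_nc[of "[]" d n] by (auto simp: dycks_def)

lemma card_nc_offdiag:
  "d \<in> dycks m 0 \<Longrightarrow> e \<in> dycks m 0 \<Longrightarrow> d \<noteq> e \<Longrightarrow>
    n * card {J\<in>words n m. nc d [] J \<and> nc e [] J} \<le> n ^ (m div 2)"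
  using card_nc_nc[of "[]" d e n] by (auto simp: dycks_def)

text \<open>\<open>V\<close> is a row of the inverse of \<open>1 + R\<close>. Its l1-norm
  \<open>S\<close> satisfies \<open>S \<le> 1 + N * S / n \<le> 1 + S / 2\<close>, hence
  \<open>S \<le> 2\<close>; fed back into the equation, this bounds each entry.\<close>

lemma near_identity_inverse:
  fixes V :: "'a \<Rightarrow> complex" and R :: "'a \<Rightarrow> 'a \<Rightarrow> complex" and n :: real
  assumes fin: "finite D" and D: "card D \<le> N" and N: "2 * real N \<le> n" "n > 0"
    and r: "\<And>e f. e \<in> D \<Longrightarrow> f \<in> D \<Longrightarrow> cmod (R e f) \<le> 1 / n"
    and V: "\<And>f. f \<in> D \<Longrightarrow> V f + (\<Sum>e\<in>D. V e * R e f) = (if f = d then 1 else 0)"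
    and f: "f \<in> D"
  shows "cmod (V f - (if f = d then 1 else 0)) \<le> 2 / n"
proof -
  let ?S = "\<Sum>e\<in>D. cmod (V e)"
  have 1: "cmod (V f - (if f = d then 1 else 0)) \<le> ?S / n" if "f \<in> D" for f
  proof -
    have "V f - (if f = d then 1 else 0) = - (\<Sum>e\<in>D. V e * R e f)"
      using V[OF that] by (simp add: algebra_simps)
    then have "cmod (V f - (if f = d then 1 else 0)) = cmod (\<Sum>e\<in>D. V e * R e f)"
      by (simp only: norm_minus_cancel)
    also have "\<dots> \<le> (\<Sum>e\<in>D. cmod (V e) * (1 / n))"
      using r that by (intro sum_norm_le) (simp only: norm_mult, intro mult_left_mono, auto)
    finally show ?thesis by (simp add: sum_divide_distrib)
  qed
  have "?S \<le> (\<Sum>f\<in>D. (if f = d then 1 else 0) + ?S / n)"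
  proof (intro sum_mono)
    fix f assume "f \<in> D"
    have "cmod (V f) \<le> cmod (V f - (if f = d then 1 else 0)) + cmod (if f = d then 1 else 0)"
      by (metis add.commute norm_triangle_sub)
    then show "cmod (V f) \<le> (if f = d then 1 else 0) + ?S / n" using 1[OF \<open>f \<in> D\<close>] by (auto split: if_splits)
  qed
  also have "\<dots> = (\<Sum>f\<in>D. if f = d then 1 else 0) + real (card D) * (?S / n)" by (simp add: sum.distrib)
  also have "\<dots> \<le> 1 + real N * (?S / n)"
  proof (intro add_mono mult_right_mono)
    show "(\<Sum>f\<in>D. if f = d then 1 else 0) \<le> (1::real)" using fin by (simp add: sum.delta')
    show "0 \<le> ?S / n" using N by (auto intro!: divide_nonneg_pos sum_nonneg)
  qed (use D in auto)
  also have "real N * (?S / n) \<le> ?S / 2"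
  proof -
    have "(2 * real N) * ?S \<le> n * ?S" using N by (intro mult_right_mono) (auto intro: sum_nonneg)
    then show ?thesis using N by (simp add: field_simps)
  qed
  finally have "?S \<le> 2" by simp
  then have "?S / n \<le> 2 / n" using N by (intro divide_right_mono) auto
  then show ?thesis using 1[OF f] by linarith
qed

text \<open>The properties of the Haar moments that determine their asymptotics, with
  \<open>\<phi> n w\<close> in the role of the moment of the monomial \<open>w\<close>.\<close>

context
  fixes s :: nat and \<phi> :: "nat \<Rightarrow> (nat \<times> nat) list \<Rightarrow> complex"
  assumes s: "s \<ge> 1"
    and unit: "\<And>n. n \<ge> s \<Longrightarrow> \<phi> n [] = 1"
    and contr: "\<And>n. n \<ge> s \<Longrightarrow> contracts n (\<phi> n)"
    and left_inv: "\<And>n m J. n \<ge> s \<Longrightarrow> J \<in> words n m \<Longrightarrow> invariant n m (\<lambda>I. \<phi> n (zip I J))"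
    and right_inv: "\<And>n m I. n \<ge> s \<Longrightarrow> I \<in> words n m \<Longrightarrow> invariant n m (\<lambda>J. \<phi> n (zip I J))"
    and left_no: "\<And>n m I J. n \<ge> s \<Longrightarrow> I \<in> words n m \<Longrightarrow> J \<in> words n m \<Longrightarrow> \<nexists>d. nc d [] I \<Longrightarrow> \<phi> n (zip I J) = 0"
    and right_no: "\<And>n m I J. n \<ge> s \<Longrightarrow> I \<in> words n m \<Longrightarrow> J \<in> words n m \<Longrightarrow> \<nexists>d. nc d [] J \<Longrightarrow> \<phi> n (zip I J) = 0"
begin

text \<open>The coefficients of the moments with respect to pairings of the row word and of the
  column word. By duality of the generic words they are themselves moments.\<close>

definition weingarten :: "nat \<Rightarrow> bool list \<Rightarrow> bool list \<Rightarrow> complex" where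
  "weingarten n d e = \<phi> n (zip (generic d) (generic e))"

lemma weingarten_formula:
  assumes n: "n \<ge> s" "n \<ge> m" and IJ: "I \<in> words n m" "J \<in> words n m"
  shows "\<phi> n (zip I J) = (\<Sum>d\<in>dycks m 0. \<Sum>e\<in>dycks m 0.
    weingarten n d e * (if nc d [] I \<and> nc e [] J then 1 else 0))"
proof -
  have "\<phi> n (zip I J) = (\<Sum>d\<in>dycks m 0. \<phi> n (zip (generic d) J) * (if nc d [] I then 1 else 0))"
    by (rule invariant_expansion[OF left_inv[OF n(1) IJ(2)] n(2) left_no[OF n(1) _ IJ(2)] IJ(1)])
  also have "\<dots> = (\<Sum>d\<in>dycks m 0. (\<Sum>e\<in>dycks m 0. weingarten n d e * (if nc e [] J then 1 else 0)) * (if nc d [] I then 1 else 0))"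
  proof (intro sum.cong refl arg_cong2[where f = "(*)"])
    fix d assume "d \<in> dycks m 0"
    then have g: "generic d \<in> words n m" using generic_words(1) n by blast
    show "\<phi> n (zip (generic d) J) = (\<Sum>e\<in>dycks m 0. weingarten n d e * (if nc e [] J then 1 else 0))"
      unfolding weingarten_def
      by (rule invariant_expansion[OF right_inv[OF n(1) g] n(2) right_no[OF n(1) g] IJ(2)])
  qed
  finally show ?thesis by (simp add: sum_distrib_right if_distrib if_distribR cong: if_cong) (auto intro!: sum.cong)
qed

definition gram :: "nat \<Rightarrow> nat \<Rightarrow> bool list \<Rightarrow> bool list \<Rightarrow> nat" where
  "gram n m d e = card {J\<in>words n m. nc d [] J \<and> nc e [] J}"

lemma gram_sum: "(\<Sum>J\<in>words n m. if nc d [] J \<and> nc e [] J then 1 else 0) = (of_nat (gram n m d e) :: complex)"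
  unfolding gram_def by (simp add: sum.If_cases Int_def)

text \<open>The moments with row word \<open>generic d\<close> are contracted against the pairing
  \<open>f\<close>. By \<open>nc_contract\<close> the result is the indicator of \<open>f\<close> at
  \<open>generic d\<close>, that is, of \<open>f = d\<close>; expanding in the column word instead
  gives an entry of Weingarten times Gram.\<close>

lemma weingarten_gram:
  assumes n: "n \<ge> s" "n \<ge> m" and d: "d \<in> dycks m 0" and f: "f \<in> dycks m 0"
  shows "(\<Sum>e\<in>dycks m 0. weingarten n d e * of_nat (gram n m e f)) = (if f = d then 1 else 0)"
proof -
  have g: "generic d \<in> words n m" using generic_words(1) n d by blast
  have "(if f = d then 1 else 0) = (if nc f [] (generic d) then \<phi> n [] else 0)"
    using nc_generic[OF d, of f] generic_words(3)[OF d order.refl] unit[OF n(1)] by auto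
  also have "\<dots> = (\<Sum>J\<in>words n m. if nc f [] J then \<phi> n (zip (generic d) J) else 0)"
    using nc_contract[OF contr f g] n by simp
  also have "\<dots> = (\<Sum>J\<in>words n m. \<Sum>e\<in>dycks m 0. weingarten n d e * (if nc e [] J \<and> nc f [] J then 1 else 0))"
  proof (intro sum.cong refl)
    fix J assume J: "J \<in> words n m"
    have "\<phi> n (zip (generic d) J) = (\<Sum>e\<in>dycks m 0. weingarten n d e * (if nc e [] J then 1 else 0))"
      unfolding weingarten_def
      by (rule invariant_expansion[OF right_inv[OF n(1) g] n(2) right_no[OF n(1) g] J])
    then show "(if nc f [] J then \<phi> n (zip (generic d) J) else 0) =
       (\<Sum>e\<in>dycks m 0. weingarten n d e * (if nc e [] J \<and> nc f [] J then 1 else 0))"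
      by auto
  qed
  also have "\<dots> = (\<Sum>e\<in>dycks m 0. weingarten n d e * of_nat (gram n m e f))"
    by (subst sum.swap) (simp only: sum_distrib_left[symmetric] gram_sum)
  finally show ?thesis by simp
qed

text \<open>After division by \<open>n^(m div 2)\<close> the Gram matrix has diagonal 1 and its
  other entries are at most \<open>1/n\<close>, so \<open>near_identity_inverse\<close> applies to
  the rescaled Weingarten matrix.\<close>

lemma weingarten_bound:
  assumes n: "n \<ge> s" "n \<ge> m" "2 * card (dycks m 0) \<le> n" and d: "d \<in> dycks m 0" and f: "f \<in> dycks m 0"
  shows "cmod (of_nat n ^ (m div 2) * weingarten n d f - (if f = d then 1 else 0)) \<le> 2 / n"
proof (rule near_identity_inverse[where D = "dycks m 0" and N = "card (dycks m 0)" and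
     R = "\<lambda>e f. if e = f then 0 else of_nat (gram n m e f) / of_nat n ^ (m div 2)"])
  have n0: "n > 0" using n s by simp
  show "cmod (if e = f then 0 else of_nat (gram n m e f) / of_nat n ^ (m div 2)) \<le> 1 / real n"
    if "e \<in> dycks m 0" "f \<in> dycks m 0" for e f
  proof (cases "e = f")
    case False
    have "real n * real (gram n m e f) \<le> real n ^ (m div 2)"
      using card_nc_offdiag[OF that False, of n] unfolding gram_def by (metis of_nat_le_iff of_nat_mult of_nat_power)
    then show ?thesis using False n0 by (simp add: norm_divide norm_power field_simps)
  qed simp
  show "of_nat n ^ (m div 2) * weingarten n d f + (\<Sum>e\<in>dycks m 0. of_nat n ^ (m div 2) * weingarten n d e *
     (if e = f then 0 else of_nat (gram n m e f) / of_nat n ^ (m div 2))) = (if f = d then 1 else 0)"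
    if f: "f \<in> dycks m 0" for f
  proof -
    have gff: "gram n m f f = n ^ (m div 2)" using card_nc_diag[OF f, of n] by (simp add: gram_def)
    have "(if f = d then 1 else 0) = (\<Sum>e\<in>dycks m 0. weingarten n d e * of_nat (gram n m e f))"
      using weingarten_gram[OF n(1,2) d f] by simp
    also have "\<dots> = weingarten n d f * of_nat (gram n m f f) + (\<Sum>e\<in>dycks m 0 - {f}. weingarten n d e * of_nat (gram n m e f))"
      using f by (intro sum.remove) auto
    also have "(\<Sum>e\<in>dycks m 0 - {f}. weingarten n d e * of_nat (gram n m e f)) =
      (\<Sum>e\<in>dycks m 0. of_nat n ^ (m div 2) * weingarten n d e *
     (if e = f then 0 else of_nat (gram n m e f) / of_nat n ^ (m div 2)))"
      using n0 by (intro sum.mono_neutral_cong_left) auto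
    finally show ?thesis by (simp add: gff mult.commute)
  qed
qed (use n s f in auto)

text \<open>Summing the Weingarten formula over words in the letters \<open>1..s\<close> turns the
  indicators into the Gram matrix for \<open>s\<close>. In the limit only the diagonal survives, and
  each pairing contributes \<open>gram s m d d / s^(m div 2) = 1\<close>.\<close>

theorem moments_limit:
  "(\<lambda>n. of_real (sqrt (real n / real s)) ^ m * (\<Sum>I\<in>words s m. \<phi> n (zip I I))) \<longlonglongrightarrow> of_nat (paths m 0)"
proof -
  let ?D = "dycks m 0" and ?k = "m div 2"
  have lim: "(\<lambda>n. \<Sum>d\<in>?D. \<Sum>e\<in>?D. (of_nat n ^ ?k * weingarten n d e) * (of_nat (gram s m d e) / of_nat s ^ ?k))
    \<longlonglongrightarrow> (\<Sum>d\<in>?D. \<Sum>e\<in>?D. (if e = d then 1 else 0) * (of_nat (gram s m d e) / of_nat s ^ ?k))"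
  proof (intro tendsto_sum tendsto_mult tendsto_const)
    fix d e assume de: "d \<in> ?D" "e \<in> ?D"
    have "(\<lambda>n. of_nat n ^ ?k * weingarten n d e - (if e = d then 1 else 0)) \<longlonglongrightarrow> 0"
    proof (rule Lim_null_comparison)
      show "\<forall>\<^sub>F n in sequentially. norm (of_nat n ^ ?k * weingarten n d e - (if e = d then 1 else 0)) \<le> 2 / real n"
        using eventually_ge_at_top[of s] eventually_ge_at_top[of m] eventually_ge_at_top[of "2 * card ?D"]
        by eventually_elim (rule weingarten_bound[OF _ _ _ de])
      show "(\<lambda>n. 2 / real n) \<longlonglongrightarrow> 0" by (rule lim_const_over_n)
    qed
    then show "(\<lambda>n. of_nat n ^ ?k * weingarten n d e) \<longlonglongrightarrow> (if e = d then 1 else 0)"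
      by (rule LIM_zero_cancel)
  qed
  have diag: "(\<Sum>d\<in>?D. \<Sum>e\<in>?D. (if e = d then 1 else 0) * (of_nat (gram s m d e) / of_nat s ^ ?k)) = (of_nat (paths m 0) :: complex)"
  proof -
    have "(\<Sum>e\<in>?D. (if e = d then 1 else 0) * (of_nat (gram s m d e) / of_nat s ^ ?k)) = (1 :: complex)" if "d \<in> ?D" for d
    proof -
      have "(\<Sum>e\<in>?D. (if e = d then 1 else 0) * (of_nat (gram s m d e) / of_nat s ^ ?k)) =
         (\<Sum>e\<in>?D. if e = d then of_nat (gram s m d d) / of_nat s ^ ?k else (0::complex))"
        by (intro sum.cong) auto
      also have "\<dots> = of_nat (gram s m d d) / of_nat s ^ ?k" using that by simp
      also have "\<dots> = 1" using s card_nc_diag[OF that, of s] by (simp add: gram_def)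
      finally show ?thesis .
    qed
    then show ?thesis by (simp add: card_dycks)
  qed
  have ev: "\<forall>\<^sub>F n in sequentially. (\<Sum>d\<in>?D. \<Sum>e\<in>?D. (of_nat n ^ ?k * weingarten n d e) * (of_nat (gram s m d e) / of_nat s ^ ?k))
     = of_real (sqrt (real n / real s)) ^ m * (\<Sum>I\<in>words s m. \<phi> n (zip I I))"
    using eventually_ge_at_top[of s] eventually_ge_at_top[of m]
  proof eventually_elim
    case (elim n)
    have sub: "words s m \<subseteq> words n m" using elim by (auto simp: words_def)
    have "(\<Sum>I\<in>words s m. \<phi> n (zip I I)) = (\<Sum>I\<in>words s m. \<Sum>d\<in>?D. \<Sum>e\<in>?D. weingarten n d e * (if nc d [] I \<and> nc e [] I then 1 else 0))"
      using sub by (intro sum.cong refl weingarten_formula elim) auto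
    also have "\<dots> = (\<Sum>d\<in>?D. \<Sum>I\<in>words s m. \<Sum>e\<in>?D. weingarten n d e * (if nc d [] I \<and> nc e [] I then 1 else 0))"
      by (rule sum.swap)
    also have "\<dots> = (\<Sum>d\<in>?D. \<Sum>e\<in>?D. \<Sum>I\<in>words s m. weingarten n d e * (if nc d [] I \<and> nc e [] I then 1 else 0))"
      by (intro sum.cong refl sum.swap)
    also have "\<dots> = (\<Sum>d\<in>?D. \<Sum>e\<in>?D. weingarten n d e * of_nat (gram s m d e))"
      by (simp only: sum_distrib_left[symmetric] gram_sum)
    finally have *: "(\<Sum>I\<in>words s m. \<phi> n (zip I I)) = (\<Sum>d\<in>?D. \<Sum>e\<in>?D. weingarten n d e * of_nat (gram s m d e))" .
    show ?case
    \<comment> \<open>Without pairings, as for odd \<open>m\<close>, both sides are 0; otherwise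
      \<open>m\<close> is even and \<open>m div 2\<close> is the true exponent.\<close>
    proof (cases "?D = {}")
      case True
      then show ?thesis using * by simp
    next
      case False
      then obtain d where "d \<in> ?D" by blast
      then have "even m" using dyck_parity[of 0 d] by (auto simp: dycks_def)
      then have "sqrt (real n / real s) ^ m = (sqrt (real n / real s) ^ 2) ^ ?k"
        by (metis dvd_mult_div_cancel power_mult)
      also have "\<dots> = real n ^ ?k / real s ^ ?k" by (simp add: power_divide)
      finally have "complex_of_real (sqrt (real n / real s)) ^ m = of_nat n ^ ?k / of_nat s ^ ?k"
        by (metis of_real_divide of_real_of_nat_eq of_real_power)
      then show ?thesis unfolding * by (simp add: sum_distrib_left sum_divide_distrib mult_ac)
    qed
  qed
  show ?thesis using Lim_transform_eventually[OF lim ev] unfolding diag .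
qed

end

section \<open>Moments of the semicircle law\<close>

text \<open>The Chebyshev polynomials of the second kind \<open>U_h(x/2)\<close>, which are
  orthogonal for the semicircle law.\<close>

fun cheb :: "nat \<Rightarrow> real \<Rightarrow> real" where
  "cheb 0 x = 1"
| "cheb (Suc 0) x = x"
| "cheb (Suc (Suc h)) x = x * cheb (Suc h) x - cheb h x"

lemma continuous_on_cheb [continuous_intros]: "continuous_on A (cheb h)"
  by (induction h rule: induct_nat_012) (auto intro!: continuous_intros)

text \<open>This is \<open>U_h(cos t) sin t = sin((h+1) t)\<close>. The sign comes from the
  substitution \<open>x = - 2 cos t\<close>, chosen because it is increasing on
  \<open>[0, pi]\<close>.\<close>

lemma cheb_sin: "cheb h (- 2 * cos t) * sin t = (- 1) ^ h * sin (real (Suc h) * t)"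
proof (induction h rule: induct_nat_012)
  case 1
  then show ?case using sin_double[of t] by simp
next
  case (ge2 h)
  have "sin (real (Suc (Suc (Suc h))) * t) + sin (real (Suc h) * t) = 2 * cos t * sin (real (Suc (Suc h)) * t)"
    using sin_add[of "real (Suc (Suc h)) * t" t] sin_diff[of "real (Suc (Suc h)) * t" t]
    by (simp add: algebra_simps)
  then have *: "sin (real (Suc (Suc (Suc h))) * t) = 2 * cos t * sin (real (Suc (Suc h)) * t) - sin (real (Suc h) * t)"
    by linarith
  have "cheb (Suc (Suc h)) (- 2 * cos t) * sin t =
    - 2 * cos t * (cheb (Suc h) (- 2 * cos t) * sin t) - cheb h (- 2 * cos t) * sin t"
    by (simp add: algebra_simps)
  also have "\<dots> = (- 1) ^ Suc (Suc h) * sin (real (Suc (Suc (Suc h))) * t)"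
    unfolding ge2 * by (simp add: algebra_simps)
  finally show ?case .
qed simp

text \<open>The factor 4 anticipates the substitution: one 2 from the derivative
  \<open>2 sin t\<close>, another from the square root, which becomes
  \<open>2 sin t\<close>.\<close>

lemma integral_sin_sin:
  "((\<lambda>t. 4 * sin (real (Suc h) * t) * sin t) has_integral (if h = 0 then 2 * pi else 0)) {0..pi}"
proof (cases "h = 0")
  case True
  have "((\<lambda>t. 4 * sin (real (Suc h) * t) * sin t) has_integral (2 * pi - sin (2 * pi)) - (2 * 0 - sin (2 * 0))) {0..pi}"
  proof (rule fundamental_theorem_of_calculus)
    fix t
    have "((\<lambda>t. 2 * t - sin (2 * t)) has_real_derivative 4 * sin (real (Suc h) * t) * sin t) (at t within {0..pi})"
      using True cos_double_sin[of t] by (auto intro!: derivative_eq_intros simp: power2_eq_square)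
    then show "((\<lambda>t. 2 * t - sin (2 * t)) has_vector_derivative 4 * sin (real (Suc h) * t) * sin t) (at t within {0..pi})"
      by (simp add: has_real_derivative_iff_has_vector_derivative)
  qed simp
  then show ?thesis using True by simp
next
  case False
  \<comment> \<open>Antiderivative from
    \<open>2 sin((h+1) t) sin t = cos(h t) - cos((h+2) t)\<close>; dividing by \<open>h\<close> is
    what singles out the case \<open>h = 0\<close>.\<close>
  let ?F = "\<lambda>t. 2 * (sin (real h * t) / real h - sin (real (h + 2) * t) / real (h + 2))"
  have "((\<lambda>t. 4 * sin (real (Suc h) * t) * sin t) has_integral ?F pi - ?F 0) {0..pi}"
  proof (rule fundamental_theorem_of_calculus)
    fix t
    have "cos (real h * t) - cos (real (h + 2) * t) = 2 * sin (real (Suc h) * t) * sin t"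
      using cos_add[of "real (Suc h) * t" t] cos_diff[of "real (Suc h) * t" t] by (simp add: algebra_simps)
    moreover have d: "((\<lambda>t. sin (a * t) / a) has_real_derivative cos (a * t)) (at t within {0..pi})"
      if "a \<noteq> 0" for a
      using that by (auto intro!: derivative_eq_intros)
    have "(?F has_real_derivative 2 * (cos (real h * t) - cos (real (h + 2) * t))) (at t within {0..pi})"
      using False by (intro DERIV_cmult DERIV_diff d) auto
    ultimately have "(?F has_real_derivative 4 * sin (real (Suc h) * t) * sin t) (at t within {0..pi})"
      by (simp only: mult.assoc[symmetric]) simp
    then show "(?F has_vector_derivative 4 * sin (real (Suc h) * t) * sin t) (at t within {0..pi})"
      by (simp add: has_real_derivative_iff_has_vector_derivative)
  qed simp
  moreover have "?F pi - ?F 0 = 0"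
    using sin_npi[of h] sin_npi[of "h + 2"] by (simp del: of_nat_add)
  ultimately show ?thesis using False by simp
qed

lemma integral_cheb: "integral {-2..2} (\<lambda>x. cheb h x * sqrt (4 - x\<^sup>2)) = (if h = 0 then 2 * pi else 0)"
proof -
  let ?f = "\<lambda>x. cheb h x * sqrt (4 - x\<^sup>2)"
  have cont: "continuous_on {-2..2} ?f" by (intro continuous_intros)
  have "((\<lambda>t. (2 * sin t) *\<^sub>R ?f (- 2 * cos t)) has_integral integral {- 2 * cos 0..- 2 * cos pi} ?f) {0..pi}"
  proof (rule has_integral_substitution[where c = "-2" and d = 2])
    show "(\<lambda>t. - 2 * cos t) ` {0..pi} \<subseteq> {- 2..2}"
    proof (rule image_subsetI)
      fix t :: real
      show "- 2 * cos t \<in> {- 2..2}" using cos_ge_minus_one[of t] cos_le_one[of t]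
        unfolding atLeastAtMost_iff by linarith
    qed
    show "((\<lambda>t. - 2 * cos t) has_field_derivative 2 * sin t) (at t within {0..pi})" for t :: real
      by (auto intro!: derivative_eq_intros)
  qed (use cont in auto)
  then have "((\<lambda>t. (2 * sin t) *\<^sub>R ?f (- 2 * cos t)) has_integral integral {-2..2} ?f) {0..pi}" by simp
  moreover have "((\<lambda>t. (2 * sin t) *\<^sub>R ?f (- 2 * cos t)) has_integral (- 1) ^ h * (if h = 0 then 2 * pi else 0)) {0..pi}"
  proof (rule has_integral_eq[OF _ has_integral_mult_right[OF integral_sin_sin]])
    fix t assume t: "t \<in> {0..pi}"
    have "4 - (- 2 * cos t)\<^sup>2 = (2 * sin t)\<^sup>2" by (simp add: power_mult_distrib sin_squared_eq)
    then have "sqrt (4 - (- 2 * cos t)\<^sup>2) = 2 * sin t" using t sin_ge_zero[of t] by (simp add: real_sqrt_unique)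
    then have "(2 * sin t) *\<^sub>R ?f (- 2 * cos t) = 4 * sin t * (cheb h (- 2 * cos t) * sin t)" by simp
    then show "(- 1) ^ h * (4 * sin (real (Suc h) * t) * sin t) = (2 * sin t) *\<^sub>R ?f (- 2 * cos t)"
      unfolding cheb_sin by (simp only: mult_ac)
  qed
  ultimately have "integral {-2..2} ?f = (- 1) ^ h * (if h = 0 then 2 * pi else 0)"
    by (rule has_integral_unique)
  then show ?thesis by simp
qed

text \<open>The relation \<open>x * cheb h = cheb (h+1) + cheb (h-1)\<close>, without the last term
  at \<open>h = 0\<close>, is the recursion of \<open>paths\<close>; the base case is orthogonality
  to \<open>cheb 0\<close>.\<close>

lemma integral_moment_cheb:
  "integral {-2..2} (\<lambda>x. x ^ m * cheb h x * sqrt (4 - x\<^sup>2)) = 2 * pi * real (paths m h)"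
proof (induction m arbitrary: h)
  case 0
  then show ?case using integral_cheb[of h] by simp
next
  case (Suc m)
  have int: "(\<lambda>x. x ^ m * cheb h x * sqrt (4 - x\<^sup>2)) integrable_on {-2..2}" for h
    by (intro integrable_continuous_real continuous_intros)
  show ?case
  proof (cases h)
    case 0
    have "(\<lambda>x. x ^ Suc m * cheb h x * sqrt (4 - x\<^sup>2)) = (\<lambda>x. x ^ m * cheb (Suc 0) x * sqrt (4 - x\<^sup>2))"
      using 0 by auto
    then show ?thesis using Suc.IH[of "Suc 0"] 0 by simp
  next
    case (Suc h')
    have "(\<lambda>x. x ^ Suc m * cheb h x * sqrt (4 - x\<^sup>2)) =
      (\<lambda>x. x ^ m * cheb (Suc (Suc h')) x * sqrt (4 - x\<^sup>2) + x ^ m * cheb h' x * sqrt (4 - x\<^sup>2))"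
      using Suc by (auto simp: algebra_simps)
    then have "integral {-2..2} (\<lambda>x. x ^ Suc m * cheb h x * sqrt (4 - x\<^sup>2)) =
       2 * pi * real (paths m (Suc (Suc h'))) + 2 * pi * real (paths m h')"
      using Suc.IH[of "Suc (Suc h')"] Suc.IH[of h'] integral_add[OF int[of "Suc (Suc h')"] int[of h']] by simp
    then show ?thesis using Suc by (simp add: algebra_simps)
  qed
qed

lemma semicircle_moment:
  "1 / (2 * pi) * integral {-2..2} (\<lambda>x::real. x ^ m * sqrt (4 - x\<^sup>2)) = real (paths m 0)"
  using integral_moment_cheb[of m 0] by simp

section \<open>Monoid algebras\<close>

locale complex_algebra = ring X for X :: "('a, 'b) star_algebra_scheme" (structure) +
  assumes cscale_closed [simp, intro]: "x \<in> carrier X \<Longrightarrow> cscale X c x \<in> carrier X"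
    and cscale_add: "x \<in> carrier X \<Longrightarrow> y \<in> carrier X \<Longrightarrow>
      cscale X c (x \<oplus> y) = cscale X c x \<oplus> cscale X c y"
    and add_cscale: "x \<in> carrier X \<Longrightarrow> cscale X (c + d) x = cscale X c x \<oplus> cscale X d x"
    and cscale_cscale: "x \<in> carrier X \<Longrightarrow> cscale X c (cscale X d x) = cscale X (c * d) x"
    and cscale_one: "x \<in> carrier X \<Longrightarrow> cscale X 1 x = x"
    and mult_cscale_left: "x \<in> carrier X \<Longrightarrow> y \<in> carrier X \<Longrightarrow> cscale X c x \<otimes> y = cscale X c (x \<otimes> y)"
    and mult_cscale_right: "x \<in> carrier X \<Longrightarrow> y \<in> carrier X \<Longrightarrow> x \<otimes> cscale X c y = cscale X c (x \<otimes> y)"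
begin

lemma cscale_0: "x \<in> carrier X \<Longrightarrow> cscale X 0 x = \<zero>"
  using add_cscale[of x 0 0] by (metis add.r_cancel_one cscale_closed add_0)

lemma cscale_minus_one: "x \<in> carrier X \<Longrightarrow> cscale X (- 1) x = \<ominus> x"
  using add_cscale[of x "- 1" 1] cscale_0[of x] cscale_one[of x] cscale_closed[of x "- 1"]
  by (metis add.inv_comm add.inv_unique' add.left_inverse minus_equality)

text \<open>Translates the subtraction used in the definitions into ring subtraction, on which the
  \<open>algebra\<close> method works.\<close>

lemma diff_eq: "x \<in> carrier X \<Longrightarrow> y \<in> carrier X \<Longrightarrow> diff X x y = x \<ominus> y"
  by (simp add: diff_def a_minus_def cscale_minus_one)

lemma cscale_zero: "cscale X c \<zero> = \<zero>"
  using cscale_cscale[of \<zero> c 0] cscale_0[of \<zero>] by simp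

lemma cscale_minus: "x \<in> carrier X \<Longrightarrow> cscale X c (\<ominus> x) = \<ominus> cscale X c x"
  by (simp add: cscale_minus_one[symmetric] cscale_cscale)

lemma cscale_diff:
  "x \<in> carrier X \<Longrightarrow> y \<in> carrier X \<Longrightarrow> cscale X c (x \<ominus> y) = cscale X c x \<ominus> cscale X c y"
  by (simp add: a_minus_def cscale_add cscale_minus)

end

text \<open>Elements of a monoid algebra are compared through these functionals, which turn the
  convolution into an iterated sum.\<close>

definition lin_ext :: "('m \<Rightarrow> complex) \<Rightarrow> ('m \<Rightarrow> complex) \<Rightarrow> complex" where
  "lin_ext u f = (\<Sum>w | f w \<noteq> 0. f w * u w)"

lemma lin_ext_superset:
  assumes "finite W" "{w. f w \<noteq> 0} \<subseteq> W"
  shows "lin_ext u f = (\<Sum>w\<in>W. f w * u w)"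
  unfolding lin_ext_def using assms by (intro sum.mono_neutral_left) auto

lemma lin_ext_delta [simp]: "lin_ext u (delta w) = u w"
  by (subst lin_ext_superset[of "{w}"]) (auto simp: delta_def split: if_splits)

lemma lin_ext_add:
  assumes "finite {w. f w \<noteq> 0}" "finite {w. g w \<noteq> 0}"
  shows "lin_ext u (\<lambda>w. f w + g w) = lin_ext u f + lin_ext u g"
proof -
  let ?W = "{w. f w \<noteq> 0} \<union> {w. g w \<noteq> 0}"
  have "lin_ext u (\<lambda>w. f w + g w) = (\<Sum>w\<in>?W. (f w + g w) * u w)"
    using assms by (intro lin_ext_superset) auto
  moreover have "lin_ext u f = (\<Sum>w\<in>?W. f w * u w)" "lin_ext u g = (\<Sum>w\<in>?W. g w * u w)"
    using assms by (auto intro!: lin_ext_superset)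
  ultimately show ?thesis by (simp add: distrib_right sum.distrib)
qed

lemma lin_ext_scale: "lin_ext u (\<lambda>w. c * f w) = c * lin_ext u f"
proof (cases "c = 0")
  case True
  then show ?thesis by (simp add: lin_ext_def)
next
  case False
  then show ?thesis by (simp add: lin_ext_def sum_distrib_left mult.assoc)
qed

lemma lin_ext_cong: "(\<And>w. f w \<noteq> 0 \<Longrightarrow> u w = u' w) \<Longrightarrow> lin_ext u f = lin_ext u' f"
  unfolding lin_ext_def by (intro sum.cong) auto

lemma lin_ext_add_right: "lin_ext (\<lambda>w. u w + \<psi> w) f = lin_ext u f + lin_ext \<psi> f"
  by (simp add: lin_ext_def distrib_left sum.distrib)

lemma lin_ext_scale_right: "lin_ext (\<lambda>w. c * u w) f = c * lin_ext u f"
  by (simp add: lin_ext_def sum_distrib_left mult_ac)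

lemma lin_ext_sum_right: "lin_ext (\<lambda>w. \<Sum>a\<in>A. u a w) f = (\<Sum>a\<in>A. lin_ext (u a) f)"
  unfolding lin_ext_def by (simp add: sum_distrib_left) (rule sum.swap)

lemma lin_ext_swap: "lin_ext (\<lambda>x. lin_ext (u x) g) f = lin_ext (\<lambda>y. lin_ext (\<lambda>x. u x y) f) g"
  unfolding lin_ext_def by (simp add: sum_distrib_left mult_ac) (rule sum.swap)

lemma lin_ext_indicator:
  assumes "finite {w. f w \<noteq> 0}"
  shows "lin_ext (\<lambda>w. if w = z then 1 else 0) f = f z"
  using assms unfolding lin_ext_def by (simp add: if_distrib cong: if_cong)

lemma lin_ext_eqI:
  assumes "finite {w. f w \<noteq> 0}" "finite {w. g w \<noteq> 0}" "\<And>u. lin_ext u f = lin_ext u g"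
  shows "f = g"
proof
  fix z
  show "f z = g z"
    using lin_ext_indicator[OF assms(1), of z] lin_ext_indicator[OF assms(2), of z] assms(3) by simp
qed

locale monoid_algebra = G?: monoid G for G :: "('m, 'b) monoid_scheme" +
  fixes st :: "'m \<Rightarrow> 'm"
begin

abbreviation M where "M \<equiv> monoid_star_algebra G st"

lemma carrier_iff: "f \<in> carrier M \<longleftrightarrow> finite {z. f z \<noteq> 0} \<and> {z. f z \<noteq> 0} \<subseteq> carrier G"
  by (simp add: monoid_star_algebra_def)

lemma carrier_finite: "f \<in> carrier M \<Longrightarrow> finite {z. f z \<noteq> 0}"
  by (simp add: carrier_iff)

lemma carrier_eqI:
  "f \<in> carrier M \<Longrightarrow> g \<in> carrier M \<Longrightarrow> (\<And>u. lin_ext u f = lin_ext u g) \<Longrightarrow> f = g"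
  by (rule lin_ext_eqI) (auto simp: carrier_iff)

lemma add_M: "f \<oplus>\<^bsub>M\<^esub> g = (\<lambda>z. f z + g z)"
  and zero_M: "\<zero>\<^bsub>M\<^esub> = (\<lambda>z. 0)"
  and one_M: "\<one>\<^bsub>M\<^esub> = delta \<one>\<^bsub>G\<^esub>"
  and cscale_M: "cscale M c f = (\<lambda>z. c * f z)"
  by (simp_all add: monoid_star_algebra_def)

lemma delta_closed [simp, intro]: "w \<in> carrier G \<Longrightarrow> delta w \<in> carrier M"
  by (auto simp: carrier_iff delta_def split: if_splits)

lemma add_closed: "f \<in> carrier M \<Longrightarrow> g \<in> carrier M \<Longrightarrow> f \<oplus>\<^bsub>M\<^esub> g \<in> carrier M"
proof -
  assume "f \<in> carrier M" "g \<in> carrier M"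
  moreover have "{z. f z + g z \<noteq> 0} \<subseteq> {z. f z \<noteq> 0} \<union> {z. g z \<noteq> 0}" by auto
  ultimately show ?thesis unfolding carrier_iff add_M by (blast intro: finite_subset)
qed

lemma cscale_closed: "f \<in> carrier M \<Longrightarrow> cscale M c f \<in> carrier M"
proof -
  assume "f \<in> carrier M"
  moreover have "{z. c * f z \<noteq> 0} \<subseteq> {z. f z \<noteq> 0}" by auto
  ultimately show ?thesis unfolding carrier_iff cscale_M by (blast intro: finite_subset)
qed

lemma mult_M_eq:
  "(f \<otimes>\<^bsub>M\<^esub> g) z = (\<Sum>(x, y)\<in>{p \<in> {x. f x \<noteq> 0} \<times> {y. g y \<noteq> 0}. fst p \<otimes>\<^bsub>G\<^esub> snd p = z}. f x * g y)"
  unfolding monoid_star_algebra_def by (auto intro!: sum.cong)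

lemma mult_support:
  "{z. (f \<otimes>\<^bsub>M\<^esub> g) z \<noteq> 0} \<subseteq> (\<lambda>p. fst p \<otimes>\<^bsub>G\<^esub> snd p) ` ({x. f x \<noteq> 0} \<times> {y. g y \<noteq> 0})"
proof
  fix z assume "z \<in> {z. (f \<otimes>\<^bsub>M\<^esub> g) z \<noteq> 0}"
  then have "{p \<in> {x. f x \<noteq> 0} \<times> {y. g y \<noteq> 0}. fst p \<otimes>\<^bsub>G\<^esub> snd p = z} \<noteq> {}"
    unfolding mult_M_eq by (metis (mono_tags, lifting) mem_Collect_eq sum.empty)
  then show "z \<in> (\<lambda>p. fst p \<otimes>\<^bsub>G\<^esub> snd p) ` ({x. f x \<noteq> 0} \<times> {y. g y \<noteq> 0})" by blast
qed

lemma mult_closed: "f \<in> carrier M \<Longrightarrow> g \<in> carrier M \<Longrightarrow> f \<otimes>\<^bsub>M\<^esub> g \<in> carrier M"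
proof -
  assume fg: "f \<in> carrier M" "g \<in> carrier M"
  then have "(\<lambda>p. fst p \<otimes>\<^bsub>G\<^esub> snd p) ` ({x. f x \<noteq> 0} \<times> {y. g y \<noteq> 0}) \<subseteq> carrier G"
    by (force simp: carrier_iff)
  then show ?thesis unfolding carrier_iff using mult_support[of f g] fg
    by (auto simp: carrier_iff intro: finite_subset[OF mult_support])
qed

text \<open>Pairs of support elements are grouped by their product. Seen through the functionals,
  associativity of the convolution becomes associativity in the monoid.\<close>

lemma lin_ext_mult:
  assumes "f \<in> carrier M" "g \<in> carrier M"
  shows "lin_ext u (f \<otimes>\<^bsub>M\<^esub> g) = lin_ext (\<lambda>x. lin_ext (\<lambda>y. u (x \<otimes>\<^bsub>G\<^esub> y)) g) f"
proof -
  let ?S = "{x. f x \<noteq> 0} \<times> {y. g y \<noteq> 0}" and ?m = "\<lambda>p. fst p \<otimes>\<^bsub>G\<^esub> snd p"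
  have fin: "finite ?S" using assms by (simp add: carrier_iff)
  have "lin_ext u (f \<otimes>\<^bsub>M\<^esub> g) = (\<Sum>z\<in>?m ` ?S. (f \<otimes>\<^bsub>M\<^esub> g) z * u z)"
    using fin by (intro lin_ext_superset mult_support) auto
  also have "\<dots> = (\<Sum>z\<in>?m ` ?S. \<Sum>p\<in>{p \<in> ?S. ?m p = z}. f (fst p) * g (snd p) * u (?m p))"
    unfolding mult_M_eq by (auto simp: sum_distrib_right intro!: sum.cong)
  also have "\<dots> = (\<Sum>p\<in>?S. f (fst p) * g (snd p) * u (?m p))"
    using fin by (intro sum.group) auto
  also have "\<dots> = (\<Sum>x | f x \<noteq> 0. \<Sum>y | g y \<noteq> 0. f x * g y * u (x \<otimes>\<^bsub>G\<^esub> y))"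
    by (simp add: sum.cartesian_product case_prod_beta)
  finally show ?thesis by (simp add: lin_ext_def sum_distrib_left mult.assoc)
qed

lemma lin_ext_M:
  assumes "f \<in> carrier M" "g \<in> carrier M"
  shows "lin_ext u (f \<oplus>\<^bsub>M\<^esub> g) = lin_ext u f + lin_ext u g" "lin_ext u \<zero>\<^bsub>M\<^esub> = 0"
    "lin_ext u (cscale M c f) = c * lin_ext u f" "lin_ext u \<one>\<^bsub>M\<^esub> = u \<one>\<^bsub>G\<^esub>"
  using assms by (simp_all add: add_M zero_M cscale_M one_M carrier_finite lin_ext_add lin_ext_scale)
    (simp add: lin_ext_def)

lemma zero_closed: "\<zero>\<^bsub>M\<^esub> \<in> carrier M"
  by (simp add: carrier_iff zero_M)

lemma one_closed: "\<one>\<^bsub>M\<^esub> \<in> carrier M"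
  by (simp add: one_M)

lemma in_carrier_G: "f \<in> carrier M \<Longrightarrow> f x \<noteq> 0 \<Longrightarrow> x \<in> carrier G"
  by (auto simp: carrier_iff)

lemma complex_algebra_M: "complex_algebra M"
proof -
  note closed = add_closed mult_closed cscale_closed zero_closed one_closed
  have "abelian_group M"
  proof (rule abelian_groupI)
    fix f assume f: "f \<in> carrier M"
    have "cscale M (- 1) f \<oplus>\<^bsub>M\<^esub> f = \<zero>\<^bsub>M\<^esub>" by (simp add: add_M cscale_M zero_M)
    then show "\<exists>g\<in>carrier M. g \<oplus>\<^bsub>M\<^esub> f = \<zero>\<^bsub>M\<^esub>" using closed f by blast
  qed (auto simp: closed, auto simp: add_M zero_M add_ac)
  moreover have "monoid M"
  proof (rule monoidI)
    fix f g h assume fgh: "f \<in> carrier M" "g \<in> carrier M" "h \<in> carrier M"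
    show "f \<otimes>\<^bsub>M\<^esub> g \<otimes>\<^bsub>M\<^esub> h = f \<otimes>\<^bsub>M\<^esub> (g \<otimes>\<^bsub>M\<^esub> h)"
    proof (rule carrier_eqI)
      fix u
      show "lin_ext u (f \<otimes>\<^bsub>M\<^esub> g \<otimes>\<^bsub>M\<^esub> h) = lin_ext u (f \<otimes>\<^bsub>M\<^esub> (g \<otimes>\<^bsub>M\<^esub> h))"
        using fgh closed by (auto simp: lin_ext_mult in_carrier_G G.m_assoc intro!: lin_ext_cong)
    qed (use fgh closed in auto)
  next
    fix f assume f: "f \<in> carrier M"
    show "\<one>\<^bsub>M\<^esub> \<otimes>\<^bsub>M\<^esub> f = f"
      using f closed by (intro carrier_eqI) (auto simp: lin_ext_mult one_M in_carrier_G intro!: lin_ext_cong)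
    show "f \<otimes>\<^bsub>M\<^esub> \<one>\<^bsub>M\<^esub> = f"
      using f closed by (intro carrier_eqI) (auto simp: lin_ext_mult one_M in_carrier_G intro!: lin_ext_cong)
  qed (auto simp: closed)
  ultimately have "ring M"
  proof (rule ringI)
    fix f g h assume fgh: "f \<in> carrier M" "g \<in> carrier M" "h \<in> carrier M"
    show "(f \<oplus>\<^bsub>M\<^esub> g) \<otimes>\<^bsub>M\<^esub> h = f \<otimes>\<^bsub>M\<^esub> h \<oplus>\<^bsub>M\<^esub> g \<otimes>\<^bsub>M\<^esub> h"
      using fgh closed by (intro carrier_eqI) (auto simp: lin_ext_mult lin_ext_M)
    show "h \<otimes>\<^bsub>M\<^esub> (f \<oplus>\<^bsub>M\<^esub> g) = h \<otimes>\<^bsub>M\<^esub> f \<oplus>\<^bsub>M\<^esub> h \<otimes>\<^bsub>M\<^esub> g"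
      using fgh closed by (intro carrier_eqI) (auto simp: lin_ext_mult lin_ext_M lin_ext_add_right)
  qed
  then show ?thesis
  proof (rule complex_algebra.intro, unfold_locales)
    fix f g c assume fg: "f \<in> carrier M" "g \<in> carrier M"
    show "cscale M c f \<otimes>\<^bsub>M\<^esub> g = cscale M c (f \<otimes>\<^bsub>M\<^esub> g)"
      using fg closed by (intro carrier_eqI) (auto simp: lin_ext_mult lin_ext_M)
    show "f \<otimes>\<^bsub>M\<^esub> cscale M c g = cscale M c (f \<otimes>\<^bsub>M\<^esub> g)"
      using fg closed by (intro carrier_eqI) (auto simp: lin_ext_mult lin_ext_M lin_ext_scale_right)
  qed (auto simp: closed, auto simp: add_M cscale_M algebra_simps)
qed

lemma delta_mult:
  assumes "x \<in> carrier G" "y \<in> carrier G"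
  shows "delta x \<otimes>\<^bsub>M\<^esub> delta y = delta (x \<otimes>\<^bsub>G\<^esub> y)"
  using assms by (intro carrier_eqI mult_closed) (auto simp: lin_ext_mult)

end

section \<open>Completions\<close>

locale seminormed_algebra = complex_algebra X for X :: "('a, 'b) star_algebra_scheme" (structure) +
  fixes p :: "'a \<Rightarrow> real"
  assumes p_nonneg [simp]: "x \<in> carrier X \<Longrightarrow> 0 \<le> p x"
    and p_add: "x \<in> carrier X \<Longrightarrow> y \<in> carrier X \<Longrightarrow> p (x \<oplus> y) \<le> p x + p y"
    and p_cscale: "x \<in> carrier X \<Longrightarrow> p (cscale X c x) = cmod c * p x"
    and p_mult: "x \<in> carrier X \<Longrightarrow> y \<in> carrier X \<Longrightarrow> p (x \<otimes> y) \<le> p x * p y"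
begin

lemma p_zero [simp]: "p \<zero> = 0"
  using p_cscale[of \<zero> 0] by (simp add: cscale_zero)

lemma p_minus: "x \<in> carrier X \<Longrightarrow> p (\<ominus> x) = p x"
  using p_cscale[of x "- 1"] by (simp add: cscale_minus_one)

lemma p_diff_commute: "x \<in> carrier X \<Longrightarrow> y \<in> carrier X \<Longrightarrow> p (x \<ominus> y) = p (y \<ominus> x)"
proof -
  assume xy: "x \<in> carrier X" "y \<in> carrier X"
  then have "\<ominus> (y \<ominus> x) = x \<ominus> y" by algebra
  then show ?thesis using p_minus[of "y \<ominus> x"] xy by simp
qed

lemma p_diff_triangle:
  "x \<in> carrier X \<Longrightarrow> y \<in> carrier X \<Longrightarrow> z \<in> carrier X \<Longrightarrow> p (x \<ominus> z) \<le> p (x \<ominus> y) + p (y \<ominus> z)"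
proof -
  assume xyz: "x \<in> carrier X" "y \<in> carrier X" "z \<in> carrier X"
  then have "x \<ominus> z = (x \<ominus> y) \<oplus> (y \<ominus> z)" by algebra
  then show ?thesis using p_add[of "x \<ominus> y" "y \<ominus> z"] xyz by simp
qed

lemma p_le_diff: "x \<in> carrier X \<Longrightarrow> y \<in> carrier X \<Longrightarrow> p x \<le> p y + p (x \<ominus> y)"
proof -
  assume xy: "x \<in> carrier X" "y \<in> carrier X"
  then have "x = y \<oplus> (x \<ominus> y)" by algebra
  then show ?thesis using p_add[of y "x \<ominus> y"] xy by simp
qed

lemma p_add_diff:
  assumes "x \<in> carrier X" "y \<in> carrier X" "x' \<in> carrier X" "y' \<in> carrier X"
  shows "p (x \<oplus> y \<ominus> (x' \<oplus> y')) \<le> p (x \<ominus> x') + p (y \<ominus> y')"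
proof -
  have "x \<oplus> y \<ominus> (x' \<oplus> y') = (x \<ominus> x') \<oplus> (y \<ominus> y')" using assms by algebra
  then show ?thesis using p_add[of "x \<ominus> x'" "y \<ominus> y'"] assms by simp
qed

lemma p_mult_diff:
  assumes "x \<in> carrier X" "y \<in> carrier X" "x' \<in> carrier X" "y' \<in> carrier X"
  shows "p (x \<otimes> y \<ominus> x' \<otimes> y') \<le> p x * p (y \<ominus> y') + p (x \<ominus> x') * p y'"
proof -
  have "x \<otimes> y \<ominus> x' \<otimes> y' = x \<otimes> (y \<ominus> y') \<oplus> (x \<ominus> x') \<otimes> y'" using assms by algebra
  then have "p (x \<otimes> y \<ominus> x' \<otimes> y') \<le> p (x \<otimes> (y \<ominus> y')) + p ((x \<ominus> x') \<otimes> y')"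
    using p_add[of "x \<otimes> (y \<ominus> y')" "(x \<ominus> x') \<otimes> y'"] assms by simp
  then show ?thesis using p_mult[of x "y \<ominus> y'"] p_mult[of "x \<ominus> x'" y'] assms by simp
qed

lemma p_cscale_diff:
  "x \<in> carrier X \<Longrightarrow> y \<in> carrier X \<Longrightarrow> p (cscale X c x \<ominus> cscale X c y) = cmod c * p (x \<ominus> y)"
  by (simp add: cscale_diff[symmetric] p_cscale)

section \<open>Cauchy sequences modulo null sequences\<close>

abbreviation C where "C \<equiv> cauchy_seqs X p"
abbreviation R where "R \<equiv> null_rel X p"
abbreviation Q where "Q \<equiv> cstar_completion X p"
abbreviation cls where "cls a \<equiv> R `` {a}"

lemma C_carrier: "a \<in> C \<Longrightarrow> a k \<in> carrier X"
  by (simp add: cauchy_seqs_def)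

lemma C_iff: "a \<in> C \<longleftrightarrow> (\<forall>k. a k \<in> carrier X) \<and> (\<forall>e>0. \<exists>N. \<forall>j\<ge>N. \<forall>k\<ge>N. p (a j \<ominus> a k) < e)"
  unfolding cauchy_seqs_def by (auto simp: diff_eq)

lemma C_cauchy: "a \<in> C \<Longrightarrow> e > 0 \<Longrightarrow> \<exists>N. \<forall>j\<ge>N. \<forall>k\<ge>N. p (a j \<ominus> a k) < e"
  by (simp add: C_iff)

lemma R_iff: "(a, b) \<in> R \<longleftrightarrow> a \<in> C \<and> b \<in> C \<and> (\<lambda>k. p (a k \<ominus> b k)) \<longlonglongrightarrow> 0"
  unfolding null_rel_def by (auto simp: diff_eq C_carrier)

lemma const_C [simp]: "x \<in> carrier X \<Longrightarrow> (\<lambda>_. x) \<in> C"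
  by (simp add: C_iff a_minus_def r_neg)

lemma C_bounded:
  assumes "a \<in> C"
  obtains K where "K > 0" "\<And>k. p (a k) \<le> K"
proof -
  obtain N where N: "\<forall>j\<ge>N. \<forall>k\<ge>N. p (a j \<ominus> a k) < 1" using C_cauchy[OF assms, of 1] by auto
  let ?K = "(\<Sum>k\<le>N. p (a k)) + 1"
  have le: "p (a k) \<le> (\<Sum>k\<le>N. p (a k))" if "k \<le> N" for k
    using that C_carrier[OF assms] by (intro member_le_sum) auto
  have "p (a k) \<le> ?K" for k
  proof (cases "k \<le> N")
    case False
    then have "p (a k \<ominus> a N) < 1" using N by simp
    then show ?thesis using p_le_diff[of "a k" "a N"] C_carrier[OF assms] le[of N] by fastforce
  qed (use le in force)
  moreover have "(\<Sum>k\<le>N. p (a k)) \<ge> 0" using C_carrier[OF assms] by (intro sum_nonneg) auto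
  ultimately show thesis using that[of ?K] by simp
qed

lemma add_C: assumes "a \<in> C" "b \<in> C" shows "(\<lambda>k. a k \<oplus> b k) \<in> C"
  unfolding C_iff
proof (intro conjI allI impI)
  fix e :: real assume "e > 0"
  then obtain N1 N2 where N: "\<forall>j\<ge>N1. \<forall>k\<ge>N1. p (a j \<ominus> a k) < e / 2" "\<forall>j\<ge>N2. \<forall>k\<ge>N2. p (b j \<ominus> b k) < e / 2"
    using C_cauchy[OF assms(1), of "e/2"] C_cauchy[OF assms(2), of "e/2"] by auto
  have "p (a j \<oplus> b j \<ominus> (a k \<oplus> b k)) < e" if "j \<ge> max N1 N2" "k \<ge> max N1 N2" for j k
  proof -
    have "p (a j \<ominus> a k) < e / 2" "p (b j \<ominus> b k) < e / 2" using N that by auto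
    then show ?thesis
      using p_add_diff[of "a j" "b j" "a k" "b k"] C_carrier[OF assms(1)] C_carrier[OF assms(2)] by fastforce
  qed
  then show "\<exists>N. \<forall>j\<ge>N. \<forall>k\<ge>N. p (a j \<oplus> b j \<ominus> (a k \<oplus> b k)) < e" by blast
qed (use assms C_carrier in auto)

lemma cscale_C: assumes "a \<in> C" shows "(\<lambda>k. cscale X c (a k)) \<in> C"
  unfolding C_iff
proof (intro conjI allI impI)
  fix e :: real assume "e > 0"
  then obtain N where N: "\<forall>j\<ge>N. \<forall>k\<ge>N. p (a j \<ominus> a k) < e / (cmod c + 1)"
    using C_cauchy[OF assms, of "e / (cmod c + 1)"] by (auto simp: add_nonneg_pos)
  have "p (cscale X c (a j) \<ominus> cscale X c (a k)) < e" if "j \<ge> N" "k \<ge> N" for j k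
  proof -
    have pos: "cmod c + 1 > 0" by (simp add: add_nonneg_pos)
    have "cmod c * p (a j \<ominus> a k) \<le> (cmod c + 1) * p (a j \<ominus> a k)"
      using C_carrier[OF assms] by (intro mult_right_mono) auto
    also have "\<dots> < e" using N that pos by (simp add: pos_less_divide_eq mult.commute)
    finally show ?thesis using C_carrier[OF assms] by (simp add: p_cscale_diff)
  qed
  then show "\<exists>N. \<forall>j\<ge>N. \<forall>k\<ge>N. p (cscale X c (a j) \<ominus> cscale X c (a k)) < e" by blast
qed (use assms C_carrier in auto)

lemma mult_C: assumes "a \<in> C" "b \<in> C" shows "(\<lambda>k. a k \<otimes> b k) \<in> C"
  unfolding C_iff
proof (intro conjI allI impI)
  fix e :: real assume "e > 0"
  obtain K L where K: "K > 0" "\<And>k. p (a k) \<le> K" and L: "L > 0" "\<And>k. p (b k) \<le> L"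
    using C_bounded assms by metis
  obtain N1 N2 where N: "\<forall>j\<ge>N1. \<forall>k\<ge>N1. p (a j \<ominus> a k) < e / 2 / L" "\<forall>j\<ge>N2. \<forall>k\<ge>N2. p (b j \<ominus> b k) < e / 2 / K"
    using C_cauchy[OF assms(1), of "e / 2 / L"] C_cauchy[OF assms(2), of "e / 2 / K"] K L \<open>e > 0\<close> by auto
  have "p (a j \<otimes> b j \<ominus> a k \<otimes> b k) < e" if "j \<ge> max N1 N2" "k \<ge> max N1 N2" for j k
  proof -
    have cj: "a j \<in> carrier X" "b j \<in> carrier X" "a k \<in> carrier X" "b k \<in> carrier X"
      using C_carrier assms by auto
    have 1: "p (a j) * p (b j \<ominus> b k) \<le> K * p (b j \<ominus> b k)" using K cj by (intro mult_right_mono) auto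
    have "p (b j \<ominus> b k) < e / 2 / K" "p (a j \<ominus> a k) < e / 2 / L" using N that by auto
    then have 2: "K * p (b j \<ominus> b k) < e / 2" and 4: "p (a j \<ominus> a k) * L < e / 2"
      unfolding pos_less_divide_eq[OF K(1)] pos_less_divide_eq[OF L(1)] by (simp_all add: mult.commute)
    have 3: "p (a j \<ominus> a k) * p (b k) \<le> p (a j \<ominus> a k) * L" using L cj by (intro mult_left_mono) auto

    show ?thesis using p_mult_diff[OF cj] 1 2 3 4 by linarith
  qed
  then show "\<exists>N. \<forall>j\<ge>N. \<forall>k\<ge>N. p (a j \<otimes> b j \<ominus> a k \<otimes> b k) < e" by blast
qed (use assms C_carrier in auto)

lemma equiv_R: "equiv C R"
proof (rule equivI)
  show "R \<subseteq> C \<times> C" by (auto simp: R_iff)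
  show "refl_on C R" by (auto simp: refl_on_def R_iff a_minus_def r_neg C_carrier)
  show "sym R" by (auto simp: sym_def R_iff C_carrier p_diff_commute)
  show "trans R"
  proof (rule transI)
    fix a b c assume ab: "(a, b) \<in> R" and bc: "(b, c) \<in> R"
    have "(\<lambda>k. p (a k \<ominus> b k) + p (b k \<ominus> c k)) \<longlonglongrightarrow> 0 + 0"
      using ab bc by (intro tendsto_add) (auto simp: R_iff)
    then have "(\<lambda>k. p (a k \<ominus> c k)) \<longlonglongrightarrow> 0"
      using ab bc by (intro Lim_null_comparison[of "\<lambda>k. p (a k \<ominus> c k)"]) (auto simp: R_iff C_carrier p_diff_triangle)
    then show "(a, c) \<in> R" using ab bc by (simp add: R_iff)
  qed
qed

lemma cls_eq_iff: "a \<in> C \<Longrightarrow> b \<in> C \<Longrightarrow> cls a = cls b \<longleftrightarrow> (a, b) \<in> R"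
  using eq_equiv_class_iff[OF equiv_R] by blast

lemma null_intro:
  assumes "a \<in> C" "b \<in> C" "\<And>k. p (a k \<ominus> b k) \<le> f k" "f \<longlonglongrightarrow> 0"
  shows "(a, b) \<in> R"
  using assms Lim_null_comparison[of "\<lambda>k. p (a k \<ominus> b k)" f] by (auto simp: R_iff C_carrier)

lemma R_C: "(a, b) \<in> R \<Longrightarrow> a \<in> C \<and> b \<in> C \<and> (\<lambda>k. p (a k \<ominus> b k)) \<longlonglongrightarrow> 0"
  by (simp add: R_iff)

lemma add_respects: "(\<lambda>a b. cls (\<lambda>k. a k \<oplus> b k)) respects2 R"
proof (rule congruent2I')
  fix a a' b b' assume H: "(a, a') \<in> R" "(b, b') \<in> R"
  note H1 = R_C[OF H(1)] and H2 = R_C[OF H(2)]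
  have "((\<lambda>k. a k \<oplus> b k), (\<lambda>k. a' k \<oplus> b' k)) \<in> R"
  proof (rule null_intro)
    show "p (a k \<oplus> b k \<ominus> (a' k \<oplus> b' k)) \<le> p (a k \<ominus> a' k) + p (b k \<ominus> b' k)" for k
      using H1 H2 by (intro p_add_diff) (auto simp: C_carrier)
    show "(\<lambda>k. p (a k \<ominus> a' k) + p (b k \<ominus> b' k)) \<longlonglongrightarrow> 0"
      using tendsto_add[of "\<lambda>k. p (a k \<ominus> a' k)" 0 _ "\<lambda>k. p (b k \<ominus> b' k)" 0] H1 H2 by simp
  qed (use H1 H2 in \<open>auto intro: add_C\<close>)
  then show "cls (\<lambda>k. a k \<oplus> b k) = cls (\<lambda>k. a' k \<oplus> b' k)"
    using equiv_class_eq[OF equiv_R] by blast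
qed

text \<open>Cauchy sequences are bounded, so in \<open>p_mult_diff\<close> each null factor is
  multiplied by a bounded one.\<close>

lemma mult_respects: "(\<lambda>a b. cls (\<lambda>k. a k \<otimes> b k)) respects2 R"
proof (rule congruent2I')
  fix a a' b b' assume H: "(a, a') \<in> R" "(b, b') \<in> R"
  note H1 = R_C[OF H(1)] and H2 = R_C[OF H(2)]
  obtain K L where K: "\<And>k. p (a k) \<le> K" and L: "\<And>k. p (b' k) \<le> L"
    using C_bounded H1 H2 by metis
  have "((\<lambda>k. a k \<otimes> b k), (\<lambda>k. a' k \<otimes> b' k)) \<in> R"
  proof (rule null_intro)
    fix k
    have cj: "a k \<in> carrier X" "b k \<in> carrier X" "a' k \<in> carrier X" "b' k \<in> carrier X"
      using H1 H2 C_carrier by auto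
    have "p (a k) * p (b k \<ominus> b' k) \<le> K * p (b k \<ominus> b' k)" using K cj by (intro mult_right_mono) auto
    moreover have "p (a k \<ominus> a' k) * p (b' k) \<le> p (a k \<ominus> a' k) * L" using L cj by (intro mult_left_mono) auto
    ultimately show "p (a k \<otimes> b k \<ominus> a' k \<otimes> b' k) \<le> K * p (b k \<ominus> b' k) + p (a k \<ominus> a' k) * L"
      using p_mult_diff[OF cj] by linarith
  next
    have "(\<lambda>k. K * p (b k \<ominus> b' k) + p (a k \<ominus> a' k) * L) \<longlonglongrightarrow> K * 0 + 0 * L"
      using H1 H2 by (intro tendsto_intros) auto
    then show "(\<lambda>k. K * p (b k \<ominus> b' k) + p (a k \<ominus> a' k) * L) \<longlonglongrightarrow> 0" by simp
  qed (use H1 H2 in \<open>auto intro: mult_C\<close>)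
  then show "cls (\<lambda>k. a k \<otimes> b k) = cls (\<lambda>k. a' k \<otimes> b' k)"
    using equiv_class_eq[OF equiv_R] by blast
qed

lemma cscale_respects: "(\<lambda>a. cls (\<lambda>k. cscale X c (a k))) respects R"
proof (rule congruentI)
  fix a a' assume H: "(a, a') \<in> R"
  note H1 = R_C[OF H]
  have "((\<lambda>k. cscale X c (a k)), (\<lambda>k. cscale X c (a' k))) \<in> R"
  proof (rule null_intro)
    show "p (cscale X c (a k) \<ominus> cscale X c (a' k)) \<le> cmod c * p (a k \<ominus> a' k)" for k
      using H1 by (simp add: p_cscale_diff C_carrier)
    show "(\<lambda>k. cmod c * p (a k \<ominus> a' k)) \<longlonglongrightarrow> 0"
      using H1 by (intro tendsto_mult_right_zero) auto
  qed (use H1 in \<open>auto intro: cscale_C\<close>)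
  then show "cls (\<lambda>k. cscale X c (a k)) = cls (\<lambda>k. cscale X c (a' k))"
    using equiv_class_eq[OF equiv_R] by blast
qed

lemma carrier_Q: "carrier Q = C // R"
  by (simp add: cstar_completion_def)

lemma cls_closed [simp]: "a \<in> C \<Longrightarrow> cls a \<in> carrier Q"
  unfolding carrier_Q by (rule quotientI)

lemma carrier_Q_cases:
  assumes "S \<in> carrier Q"
  obtains a where "a \<in> C" "S = cls a"
  using assms unfolding carrier_Q by (auto elim: quotientE)

lemma add_Q: "a \<in> C \<Longrightarrow> b \<in> C \<Longrightarrow> cls a \<oplus>\<^bsub>Q\<^esub> cls b = cls (\<lambda>k. a k \<oplus> b k)"
  using UN_equiv_class2[OF equiv_R equiv_R add_respects] by (simp add: cstar_completion_def)

lemma mult_Q: "a \<in> C \<Longrightarrow> b \<in> C \<Longrightarrow> cls a \<otimes>\<^bsub>Q\<^esub> cls b = cls (\<lambda>k. a k \<otimes> b k)"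
  using UN_equiv_class2[OF equiv_R equiv_R mult_respects] by (simp add: cstar_completion_def)

lemma cscale_Q: "a \<in> C \<Longrightarrow> cscale Q c (cls a) = cls (\<lambda>k. cscale X c (a k))"
  using UN_equiv_class[OF equiv_R cscale_respects] by (simp add: cstar_completion_def)

lemma one_Q: "\<one>\<^bsub>Q\<^esub> = cls (\<lambda>_. \<one>)" and zero_Q: "\<zero>\<^bsub>Q\<^esub> = cls (\<lambda>_. \<zero>)"
  by (simp_all add: cstar_completion_def embed_def)

lemmas Q_ops = add_Q mult_Q cscale_Q one_Q zero_Q
lemmas C_ops = add_C mult_C cscale_C

lemma complex_algebra_Q: "complex_algebra Q"
proof -
  have "abelian_group Q"
  proof (rule abelian_groupI)
    fix S assume "S \<in> carrier Q"
    then obtain a where a: "a \<in> C" "S = cls a" by (rule carrier_Q_cases)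
    have "cls (\<lambda>k. cscale X (- 1) (a k)) \<oplus>\<^bsub>Q\<^esub> S = \<zero>\<^bsub>Q\<^esub>"
      using a by (simp add: Q_ops C_ops) (simp add: cscale_minus_one C_carrier l_neg)
    then show "\<exists>T\<in>carrier Q. T \<oplus>\<^bsub>Q\<^esub> S = \<zero>\<^bsub>Q\<^esub>"
      using cls_closed[OF cscale_C[OF a(1)]] by (rule bexI)
  next
    fix S T assume "S \<in> carrier Q" "T \<in> carrier Q"
    then obtain a b where ab: "a \<in> C" "S = cls a" "b \<in> C" "T = cls b" by (elim carrier_Q_cases)
    then show "S \<oplus>\<^bsub>Q\<^esub> T \<in> carrier Q" by (simp add: Q_ops C_ops)
    show "S \<oplus>\<^bsub>Q\<^esub> T = T \<oplus>\<^bsub>Q\<^esub> S" using ab by (simp add: Q_ops a_comm C_carrier)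
    show "\<zero>\<^bsub>Q\<^esub> \<oplus>\<^bsub>Q\<^esub> S = S" using ab by (simp add: Q_ops C_carrier)
    fix U assume "U \<in> carrier Q"
    then obtain c where "c \<in> C" "U = cls c" by (elim carrier_Q_cases)
    then show "S \<oplus>\<^bsub>Q\<^esub> T \<oplus>\<^bsub>Q\<^esub> U = S \<oplus>\<^bsub>Q\<^esub> (T \<oplus>\<^bsub>Q\<^esub> U)"
      using ab by (simp add: Q_ops C_ops a_assoc C_carrier)
  qed (simp add: zero_Q)
  moreover have "monoid Q"
  proof (rule monoidI)
    fix S T assume "S \<in> carrier Q" "T \<in> carrier Q"
    then obtain a b where ab: "a \<in> C" "S = cls a" "b \<in> C" "T = cls b" by (elim carrier_Q_cases)
    then show "S \<otimes>\<^bsub>Q\<^esub> T \<in> carrier Q" by (simp add: Q_ops C_ops)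
    show "\<one>\<^bsub>Q\<^esub> \<otimes>\<^bsub>Q\<^esub> S = S" "S \<otimes>\<^bsub>Q\<^esub> \<one>\<^bsub>Q\<^esub> = S" using ab by (simp_all add: Q_ops C_carrier)
    fix U assume "U \<in> carrier Q"
    then obtain c where "c \<in> C" "U = cls c" by (elim carrier_Q_cases)
    then show "S \<otimes>\<^bsub>Q\<^esub> T \<otimes>\<^bsub>Q\<^esub> U = S \<otimes>\<^bsub>Q\<^esub> (T \<otimes>\<^bsub>Q\<^esub> U)"
      using ab by (simp add: Q_ops C_ops m_assoc C_carrier)
  qed (simp add: one_Q)
  ultimately have "ring Q"
  proof (rule ringI)
    fix S T U assume "S \<in> carrier Q" "T \<in> carrier Q" "U \<in> carrier Q"
    then obtain a b c where abc: "a \<in> C" "S = cls a" "b \<in> C" "T = cls b" "c \<in> C" "U = cls c"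
      by (elim carrier_Q_cases)
    then show "(S \<oplus>\<^bsub>Q\<^esub> T) \<otimes>\<^bsub>Q\<^esub> U = S \<otimes>\<^bsub>Q\<^esub> U \<oplus>\<^bsub>Q\<^esub> T \<otimes>\<^bsub>Q\<^esub> U"
      by (simp add: Q_ops C_ops l_distr C_carrier)
    show "U \<otimes>\<^bsub>Q\<^esub> (S \<oplus>\<^bsub>Q\<^esub> T) = U \<otimes>\<^bsub>Q\<^esub> S \<oplus>\<^bsub>Q\<^esub> U \<otimes>\<^bsub>Q\<^esub> T"
      using abc by (simp add: Q_ops C_ops r_distr C_carrier)
  qed
  then show ?thesis
  proof (rule complex_algebra.intro, unfold_locales)
    fix S c assume "S \<in> carrier Q"
    then obtain a where a: "a \<in> C" "S = cls a" by (elim carrier_Q_cases)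
    then show "cscale Q c S \<in> carrier Q" "cscale Q 1 S = S"
      by (simp_all add: Q_ops C_ops cscale_one C_carrier)
    show "cscale Q (c + d) S = cscale Q c S \<oplus>\<^bsub>Q\<^esub> cscale Q d S"
      "cscale Q c (cscale Q d S) = cscale Q (c * d) S" for d
      using a by (simp_all add: Q_ops C_ops add_cscale cscale_cscale C_carrier)
    fix T assume "T \<in> carrier Q"
    then obtain b where b: "b \<in> C" "T = cls b" by (elim carrier_Q_cases)
    show "cscale Q c (S \<oplus>\<^bsub>Q\<^esub> T) = cscale Q c S \<oplus>\<^bsub>Q\<^esub> cscale Q c T"
      "cscale Q c S \<otimes>\<^bsub>Q\<^esub> T = cscale Q c (S \<otimes>\<^bsub>Q\<^esub> T)"
      "S \<otimes>\<^bsub>Q\<^esub> cscale Q c T = cscale Q c (S \<otimes>\<^bsub>Q\<^esub> T)"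
      using a b by (simp_all add: Q_ops C_ops cscale_add mult_cscale_left mult_cscale_right C_carrier)
  qed
qed

section \<open>The canonical map into the completion\<close>

abbreviation emb where "emb \<equiv> embed X p"

lemma embed_closed [simp]: "x \<in> carrier X \<Longrightarrow> emb x \<in> carrier Q"
  by (simp add: embed_def)

lemma embed_add: "x \<in> carrier X \<Longrightarrow> y \<in> carrier X \<Longrightarrow> emb (x \<oplus> y) = emb x \<oplus>\<^bsub>Q\<^esub> emb y"
  and embed_mult: "x \<in> carrier X \<Longrightarrow> y \<in> carrier X \<Longrightarrow> emb (x \<otimes> y) = emb x \<otimes>\<^bsub>Q\<^esub> emb y"
  and embed_cscale: "x \<in> carrier X \<Longrightarrow> emb (cscale X c x) = cscale Q c (emb x)"
  and embed_one: "emb \<one> = \<one>\<^bsub>Q\<^esub>" and embed_zero: "emb \<zero> = \<zero>\<^bsub>Q\<^esub>"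
  by (simp_all add: embed_def Q_ops)

text \<open>Used in both directions: relations of seminorm 0 become equations in the completion, and
  equations there become null differences that a representation can test.\<close>

lemma embed_eq_iff: "x \<in> carrier X \<Longrightarrow> y \<in> carrier X \<Longrightarrow> emb x = emb y \<longleftrightarrow> p (x \<ominus> y) = 0"
  by (simp add: embed_def cls_eq_iff R_iff LIMSEQ_const_iff)

lemma embed_finsum:
  assumes "finite A" "\<And>a. a \<in> A \<Longrightarrow> f a \<in> carrier X"
  shows "emb (\<Oplus>a\<in>A. f a) = (\<Oplus>\<^bsub>Q\<^esub>a\<in>A. emb (f a))"
proof -
  interpret Q: complex_algebra Q by (rule complex_algebra_Q)
  show ?thesis using assms
    by (induction A rule: finite_induct) (auto simp: embed_zero embed_add Pi_def)
qed

end

section \<open>Bounds in pre-C*-algebras\<close>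

locale star_algebra = complex_algebra X for X :: "('a, 'b) star_algebra_scheme" (structure) +
  assumes adj_closed [simp, intro]: "x \<in> carrier X \<Longrightarrow> adj X x \<in> carrier X"
    and adj_add: "x \<in> carrier X \<Longrightarrow> y \<in> carrier X \<Longrightarrow> adj X (x \<oplus> y) = adj X x \<oplus> adj X y"
    and adj_cscale: "x \<in> carrier X \<Longrightarrow> adj X (cscale X c x) = cscale X (cnj c) (adj X x)"
    and adj_mult: "x \<in> carrier X \<Longrightarrow> y \<in> carrier X \<Longrightarrow> adj X (x \<otimes> y) = adj X y \<otimes> adj X x"
    and adj_adj: "x \<in> carrier X \<Longrightarrow> adj X (adj X x) = x"
begin

lemma cscale_uminus: "x \<in> carrier X \<Longrightarrow> cscale X (- c) x = \<ominus> cscale X c x"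
  using cscale_cscale[of x "- 1" c] by (simp add: cscale_minus_one)

lemma adj_one: "adj X \<one> = \<one>"
  using adj_mult[of "adj X \<one>" \<one>] adj_adj[of \<one>] by simp

lemma adj_zero: "adj X \<zero> = \<zero>"
  using adj_cscale[of \<zero> 0] by (simp add: cscale_0)

lemma adj_minus: "x \<in> carrier X \<Longrightarrow> adj X (\<ominus> x) = \<ominus> adj X x"
  using adj_cscale[of x "- 1"] by (simp add: cscale_minus_one)

lemma adj_diff: "x \<in> carrier X \<Longrightarrow> y \<in> carrier X \<Longrightarrow> adj X (x \<ominus> y) = adj X x \<ominus> adj X y"
  by (simp add: a_minus_def adj_add adj_minus)

end

locale cstar_seminormed = star_algebra X + seminormed_algebra X p
  for X :: "('a, 'b) star_algebra_scheme" (structure) and p :: "'a \<Rightarrow> real" +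
  assumes p_cstar: "x \<in> carrier X \<Longrightarrow> p (adj X x \<otimes> x) = (p x)\<^sup>2"
begin

lemma p_adj: "x \<in> carrier X \<Longrightarrow> p (adj X x) = p x"
proof -
  have le: "p x \<le> p (adj X x)" if x: "x \<in> carrier X" for x
  proof (cases "p x = 0")
    case False
    then have "p x > 0" using p_nonneg[OF x] by linarith
    moreover have "p x * p x \<le> p (adj X x) * p x"
      using p_cstar[OF x] p_mult[of "adj X x" x] x by (simp add: power2_eq_square)
    ultimately show ?thesis by simp
  qed (use x in simp)
  assume "x \<in> carrier X"
  then show ?thesis using le[of x] le[of "adj X x"] by (simp add: adj_adj)
qed

lemma p_one: "p \<one> \<le> 1"
proof -
  have "p \<one> = (p \<one>)\<^sup>2" using p_cstar[of \<one>] by (simp add: adj_one)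
  then have "p \<one> = 0 \<or> p \<one> = 1" by (simp add: power2_eq_square)
  then show ?thesis by auto
qed

lemma p_scalar: "p (cscale X c \<one>) \<le> cmod c"
  using p_one by (simp add: p_cscale mult_left_le)

text \<open>For \<open>v = a + i w\<close> the product of the adjoint of \<open>v\<close> with
  \<open>v\<close> is \<open>a^2 + w^2\<close>, the cross terms cancelling because \<open>a\<close>
  and \<open>w\<close> commute. As \<open>a\<close> is the real part of \<open>v\<close>,
  \<open>p a \<le> p v\<close>. This takes the place of the order argument
  \<open>a^2 \<le> a^2 + w^2\<close>.\<close>

lemma commuting_squares:
  assumes a: "a \<in> carrier X" "adj X a = a" and w: "w \<in> carrier X" "adj X w = w" and aw: "a \<otimes> w = w \<otimes> a"
  shows "(p a)\<^sup>2 \<le> p (a \<otimes> a \<oplus> w \<otimes> w)"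
proof -
  let ?iw = "cscale X \<i> w"
  let ?v = "a \<oplus> ?iw"
  have iw: "?iw \<in> carrier X" using w by simp
  have v: "?v \<in> carrier X" "adj X ?v = a \<ominus> ?iw"
    using a w by (simp_all add: adj_add adj_cscale a_minus_def cscale_minus_one[symmetric] cscale_cscale)
  have m: "a \<otimes> ?iw = cscale X \<i> (a \<otimes> w)" "?iw \<otimes> a = cscale X \<i> (a \<otimes> w)" "?iw \<otimes> ?iw = \<ominus> (w \<otimes> w)"
    using a w aw by (simp_all add: mult_cscale_left mult_cscale_right cscale_cscale cscale_minus_one)
  have "adj X ?v \<otimes> ?v = a \<otimes> a \<oplus> a \<otimes> ?iw \<ominus> ?iw \<otimes> a \<ominus> ?iw \<otimes> ?iw"
    unfolding v using a iw by algebra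
  also have "\<dots> = a \<otimes> a \<oplus> w \<otimes> w"
  proof -
    have "cscale X \<i> (a \<otimes> w) \<in> carrier X" "w \<otimes> w \<in> carrier X" "a \<otimes> a \<in> carrier X" using a w by auto
    then show ?thesis unfolding m by algebra
  qed
  finally have 1: "p (a \<otimes> a \<oplus> w \<otimes> w) = (p ?v)\<^sup>2" using p_cstar[OF v(1)] by simp
  have "cscale X 2 a = ?v \<oplus> adj X ?v"
  proof -
    have "cscale X (1 + 1) a = a \<oplus> a" unfolding add_cscale[OF a(1)] using a by (simp add: cscale_one)
    moreover have "?v \<oplus> (a \<ominus> ?iw) = a \<oplus> a" using a iw by algebra
    ultimately show ?thesis unfolding v by simp
  qed
  then have "2 * p a \<le> p ?v + p (adj X ?v)"
    using p_add[of ?v "adj X ?v"] v p_cscale[of a 2] a minus_closed[OF a(1) iw] by simp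
  then have "p a \<le> p ?v" using p_adj[OF v(1)] by simp
  then show ?thesis unfolding 1 using a by (intro power_mono) auto
qed

text \<open>The iteration \<open>z \<mapsto> (y + z\<^sup>2)/2\<close> is a contraction; at its fixed point
  \<open>(1 - z)\<^sup>2 = 1 - y\<close>.\<close>

lemma approximate_sqrt:
  assumes y: "y \<in> carrier X" "adj X y = y" "p y < 1" and e: "e > 0"
  obtains w where "w \<in> carrier X" "adj X w = w" "\<And>a. a \<in> carrier X \<Longrightarrow> a \<otimes> y = y \<otimes> a \<Longrightarrow> a \<otimes> w = w \<otimes> a"
    "p (w \<otimes> w \<ominus> (\<one> \<ominus> y)) < e"
proof -
  define z where "z = rec_nat \<zero> (\<lambda>_ t. cscale X (1/2) (y \<oplus> t \<otimes> t))"
  have z0: "z 0 = \<zero>" and zS: "z (Suc k) = cscale X (1/2) (y \<oplus> z k \<otimes> z k)" for k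
    by (simp_all add: z_def)
  let ?r = "p y"
  have z: "z k \<in> carrier X" "adj X (z k) = z k" for k
    using y by (induction k) (auto simp: z0 zS adj_zero adj_cscale adj_add adj_mult)
  have zr: "p (z k) \<le> ?r" for k
  proof (induction k)
    case (Suc k)
    have "p (z (Suc k)) \<le> 1/2 * (p y + p (z k) * p (z k))"
      using z[of k] y p_add[of y "z k \<otimes> z k"] p_mult[of "z k" "z k"] by (simp add: zS p_cscale norm_divide)
    also have "p (z k) * p (z k) \<le> ?r * 1"
      using Suc z y by (intro mult_mono) auto
    finally show ?case by simp
  qed (use y in \<open>simp add: z0\<close>)
  have comm: "a \<otimes> z k = z k \<otimes> a" if a: "a \<in> carrier X" "a \<otimes> y = y \<otimes> a" for a k
  proof (induction k)
    case (Suc k)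
    have "a \<otimes> (z k \<otimes> z k) = z k \<otimes> z k \<otimes> a" using Suc a z[of k] by (metis m_assoc)
    then show ?case using a y z[of k] by (simp add: zS mult_cscale_left mult_cscale_right l_distr r_distr)
  qed (use a in \<open>simp add: z0\<close>)
  have zz: "z j \<otimes> z k = z k \<otimes> z j" for j k
    using comm[OF z(1)] comm[OF y(1) refl] by simp
  have dec: "p (z (Suc k) \<ominus> z k) \<le> ?r ^ k" for k
  proof (induction k)
    case 0
    then show ?case using zr[of "Suc 0"] y z[of "Suc 0"] by (simp add: z0 a_minus_def)
  next
    case (Suc k)
    let ?x = "z (Suc k)" and ?x' = "z k"
    have c: "?x \<in> carrier X" "?x' \<in> carrier X" using z by auto
    have "z (Suc (Suc k)) \<ominus> z (Suc k) = cscale X (1/2) ((y \<oplus> ?x \<otimes> ?x) \<ominus> (y \<oplus> ?x' \<otimes> ?x'))"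
      unfolding zS[of "Suc k"] using y c zS[of k] by (simp add: cscale_diff)
    also have "(y \<oplus> ?x \<otimes> ?x) \<ominus> (y \<oplus> ?x' \<otimes> ?x') = ?x \<otimes> ?x \<ominus> ?x' \<otimes> ?x'"
      using y c by algebra
    \<comment> \<open>A difference of squares; the commutator left over vanishes because all
      iterates commute.\<close>
    also have "?x \<otimes> ?x \<ominus> ?x' \<otimes> ?x' = (?x \<oplus> ?x') \<otimes> (?x \<ominus> ?x') \<oplus> (?x \<otimes> ?x' \<ominus> ?x' \<otimes> ?x)"
      using c by algebra
    also have "\<dots> = (?x \<oplus> ?x') \<otimes> (?x \<ominus> ?x')"
      using c zz[of "Suc k" k] by (simp add: a_minus_def r_neg)
    finally have "p (z (Suc (Suc k)) \<ominus> z (Suc k)) = 1/2 * p ((?x \<oplus> ?x') \<otimes> (?x \<ominus> ?x'))"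
      using c by (simp add: p_cscale norm_divide)
    also have "\<dots> \<le> 1/2 * (p (?x \<oplus> ?x') * p (?x \<ominus> ?x'))"
      using p_mult[of "?x \<oplus> ?x'" "?x \<ominus> ?x'"] c by simp
    also have "\<dots> \<le> 1/2 * ((2 * ?r) * ?r ^ k)"
      using c Suc p_add[OF c] zr[of k] zr[of "Suc k"] y by (intro mult_left_mono mult_mono) auto
    finally show ?case by simp
  qed
  \<comment> \<open>The square of \<open>1 - z k\<close> misses \<open>1 - y\<close> by
    \<open>2 (z (Suc k) - z k)\<close>, whose seminorm is at most
    \<open>2 * p y ^ k\<close>.\<close>
  obtain k where k: "?r ^ k < e / 2"
    using y e real_arch_pow_inv[of "e/2" ?r] by auto
  let ?w = "\<one> \<ominus> z k"
  have "?w \<otimes> ?w \<ominus> (\<one> \<ominus> y) = (y \<oplus> z k \<otimes> z k) \<ominus> (z k \<oplus> z k \<otimes> \<one>)"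
    using z(1)[of k] y(1) by algebra
  also have "\<dots> = (y \<oplus> z k \<otimes> z k) \<ominus> (z k \<oplus> z k)" using z(1) by simp
  also have "\<dots> = cscale X 2 (z (Suc k) \<ominus> z k)"
  proof -
    have "cscale X (1 + 1) (z k) = z k \<oplus> z k" unfolding add_cscale[OF z(1)] using z by (simp add: cscale_one)
    then show ?thesis using z[of k] y by (simp add: zS cscale_diff cscale_cscale cscale_one)
  qed
  finally have "p (?w \<otimes> ?w \<ominus> (\<one> \<ominus> y)) < e"
    using dec[of k] k z(1)[of k] z(1)[of "Suc k"] by (simp add: p_cscale)
  moreover have "a \<otimes> ?w = ?w \<otimes> a" if a: "a \<in> carrier X" "a \<otimes> y = y \<otimes> a" for a
  proof -
    have "a \<otimes> ?w = a \<ominus> a \<otimes> z k" "?w \<otimes> a = a \<ominus> z k \<otimes> a"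
      using z(1)[of k] a(1) by (simp_all add: a_minus_def r_distr l_distr r_minus l_minus)
    then show ?thesis using comm[OF a] by simp
  qed
  ultimately show thesis using that[of ?w] z[of k] by (simp add: adj_diff adj_one)
qed

text \<open>In an ordered setting this follows from \<open>0 \<le> b^2 \<le> T\<close>. Here let
  \<open>y = b^2 / T\<close> and let \<open>w\<close> be an approximate square root of
  \<open>1 - y\<close>: then \<open>w^2 + y\<close> is nearly 1 and, by
  \<open>commuting_squares\<close>, dominates \<open>w^2\<close>, which is nearly
  \<open>1 - y\<close>.\<close>

lemma scalar_minus_square_le:
  assumes b: "b \<in> carrier X" "adj X b = b" and T: "(p b)\<^sup>2 < T"
  shows "p (cscale X (of_real T) \<one> \<ominus> b \<otimes> b) \<le> T"
proof -
  have T0: "T > 0" using T by (meson le_less_trans zero_le_power2)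
  define y where "y = cscale X (of_real (1 / T)) (b \<otimes> b)"
  define b' where "b' = cscale X (of_real (1 / sqrt T)) b"
  have bb: "p (b \<otimes> b) = (p b)\<^sup>2" using p_cstar[of b] b by simp
  have y: "y \<in> carrier X" "adj X y = y" "p y < 1"
    using b T T0 bb by (simp_all add: y_def adj_cscale adj_mult p_cscale norm_divide)
  have b': "b' \<in> carrier X" "adj X b' = b'" "b' \<otimes> b' = y"
  proof -
    have "complex_of_real (1 / sqrt T) * complex_of_real (1 / sqrt T) = complex_of_real (1 / T)"
      using T0 by (simp flip: of_real_mult)
    then show "b' \<otimes> b' = y" using b by (simp add: b'_def y_def mult_cscale_left mult_cscale_right cscale_cscale)
  qed (use b in \<open>simp_all add: b'_def adj_cscale\<close>)
  have b'y: "b' \<otimes> y = y \<otimes> b'" using b'(1) unfolding b'(3)[symmetric] by (simp add: m_assoc)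
  have "p (\<one> \<ominus> y) \<le> 1"
  proof (rule field_le_epsilon)
    fix e :: real assume "e > 0"
    then obtain w where w: "w \<in> carrier X" "adj X w = w" "b' \<otimes> w = w \<otimes> b'"
      and we: "p (w \<otimes> w \<ominus> (\<one> \<ominus> y)) < e / 2"
      using approximate_sqrt[OF y, of "e/2"] b' b'y by (metis half_gt_zero)
    have ww: "w \<otimes> w \<in> carrier X" using w by simp
    have "p (w \<otimes> w \<oplus> y) \<le> p (w \<otimes> w \<ominus> (\<one> \<ominus> y)) + p \<one>"
    proof -
      have "w \<otimes> w \<oplus> y = (w \<otimes> w \<ominus> (\<one> \<ominus> y)) \<oplus> \<one>" using ww y(1) by algebra
      then show ?thesis using p_add[of "w \<otimes> w \<ominus> (\<one> \<ominus> y)" \<one>] ww y(1) by simp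
    qed
    then have "(p w)\<^sup>2 \<le> e / 2 + 1"
      using commuting_squares[OF w(1,2) b'(1,2)] w(3) we p_one unfolding b'(3) by simp
    moreover have "p (w \<otimes> w) \<le> (p w)\<^sup>2" using p_cstar[of w] w by simp
    moreover have "p (\<one> \<ominus> y) \<le> p (w \<otimes> w) + p ((\<one> \<ominus> y) \<ominus> w \<otimes> w)" using ww y by (intro p_le_diff) auto
    moreover have "p ((\<one> \<ominus> y) \<ominus> w \<otimes> w) < e / 2" using we p_diff_commute[of "\<one> \<ominus> y" "w \<otimes> w"] ww y by simp
    ultimately show "p (\<one> \<ominus> y) \<le> 1 + e" by linarith
  qed
  moreover have "cscale X (of_real T) \<one> \<ominus> b \<otimes> b = cscale X (of_real T) (\<one> \<ominus> y)"
    using b T0 y by (simp add: cscale_diff y_def cscale_cscale cscale_one)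
  ultimately show ?thesis using y T0 by (simp add: p_cscale)
qed

lemma scalar_minus_squares_le:
  fixes T :: real
  assumes "finite A" "\<And>k. k \<in> A \<Longrightarrow> b k \<in> carrier X \<and> adj X (b k) = b k \<and> (p (b k))\<^sup>2 < T"
  shows "p (cscale X (of_real (card A * T)) \<one> \<ominus> (\<Oplus>k\<in>A. b k \<otimes> b k)) \<le> card A * T"
  using assms
proof (induction A rule: finite_induct)
  case empty
  then show ?case by (simp add: cscale_0 a_minus_def)
next
  case (insert k A)
  let ?s = "\<Oplus>k\<in>A. b k \<otimes> b k"
  let ?N = "cscale X (of_real (card A * T)) \<one>" and ?T = "cscale X (of_real T) \<one>"
  have c: "?s \<in> carrier X" "b k \<otimes> b k \<in> carrier X" "?N \<in> carrier X" "?T \<in> carrier X"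
    using insert.prems by (auto intro!: finsum_closed)
  have s: "(\<Oplus>k\<in>insert k A. b k \<otimes> b k) = b k \<otimes> b k \<oplus> ?s"
    using insert by (intro finsum_insert) auto
  have N: "cscale X (of_real (card (insert k A) * T)) \<one> = ?T \<oplus> ?N"
    using insert by (simp add: add_cscale[symmetric] distrib_right)
  have "p (?T \<oplus> ?N \<ominus> (b k \<otimes> b k \<oplus> ?s)) \<le> p (?T \<ominus> b k \<otimes> b k) + p (?N \<ominus> ?s)"
    using c by (intro p_add_diff)
  moreover have "p (?T \<ominus> b k \<otimes> b k) \<le> T" using insert by (intro scalar_minus_square_le) auto
  moreover have "p (?N \<ominus> ?s) \<le> card A * T" using insert by simp
  ultimately have "p (?T \<oplus> ?N \<ominus> (b k \<otimes> b k \<oplus> ?s)) \<le> T + card A * T" by linarith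
  then show ?case unfolding s N using insert by (simp add: distrib_right)
qed

text \<open>Let \<open>a = b k\<close>. As \<open>1 - a\<^sup>2\<close> is a sum of squares, the norm of \<open>(N - 1) + a\<^sup>2\<close> is at most \<open>N\<close> for some \<open>N\<close>,
  so \<open>1 - a\<^sup>2 = N - ((N - 1) + a\<^sup>2)\<close> has an approximate square root \<open>w\<close> commuting with \<open>a\<close>, and \<open>a\<^sup>2 + w\<^sup>2\<close> is nearly \<open>1\<close>.\<close>

lemma self_adjoint_bound:
  assumes fin: "finite A" and b: "\<And>k. k \<in> A \<Longrightarrow> b k \<in> carrier X \<and> adj X (b k) = b k"
    and null: "p ((\<Oplus>k\<in>A. b k \<otimes> b k) \<ominus> \<one>) = 0" and k: "k \<in> A"
  shows "p (b k) \<le> 1"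
proof -
  \<comment> \<open>The summand 1 makes \<open>T\<close> strictly larger than every
    \<open>(p (b k))^2\<close>, as \<open>scalar_minus_squares_le\<close> demands.\<close>
  define T where "T = (\<Sum>k\<in>A. (p (b k))\<^sup>2) + 1"
  have T: "(p (b j))\<^sup>2 < T" if "j \<in> A" for j
  proof -
    have "(p (b j))\<^sup>2 \<le> (\<Sum>k\<in>A. (p (b k))\<^sup>2)" using that fin by (intro member_le_sum) auto
    then show ?thesis by (simp add: T_def)
  qed
  have "T > 0" using T[OF k] by (meson le_less_trans zero_le_power2)
  define N where "N = real (card (A - {k})) * T"
  have N0: "N \<ge> 0" using \<open>T > 0\<close> by (simp add: N_def)
  let ?a = "b k"
  have a: "?a \<in> carrier X" "adj X ?a = ?a" using b k by auto
  have aa: "?a \<otimes> ?a \<in> carrier X" using a by simp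
  define c where "c = (\<Oplus>k\<in>A - {k}. b k \<otimes> b k)"
  have c: "c \<in> carrier X" using b by (auto simp: c_def intro!: finsum_closed)
  have sum: "(\<Oplus>k\<in>A. b k \<otimes> b k) = ?a \<otimes> ?a \<oplus> c"
  proof -
    have "(\<Oplus>k\<in>insert k (A - {k}). b k \<otimes> b k) = ?a \<otimes> ?a \<oplus> c"
      unfolding c_def using b fin k by (intro finsum_insert) auto
    then show ?thesis using k by (simp add: insert_absorb)
  qed
  have cN: "p (cscale X (of_real N) \<one> \<ominus> c) \<le> N"
    using scalar_minus_squares_le[of "A - {k}" b T] b T fin by (auto simp: N_def c_def)
  \<comment> \<open>Up to a null element \<open>Y\<close> is \<open>N - c\<close>, which
    \<open>cN\<close> bounds by \<open>N\<close>.\<close>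
  define Y where "Y = cscale X (of_real (N - 1)) \<one> \<oplus> ?a \<otimes> ?a"
  have Y: "Y \<in> carrier X" "adj X Y = Y"
    using a by (simp_all add: Y_def adj_add adj_cscale adj_one adj_mult)
  have pY: "p Y \<le> N"
  proof -
    have Nc: "cscale X (of_real N) \<one> \<in> carrier X" by simp
    have "cscale X (of_real (N - 1)) \<one> = cscale X (of_real N) \<one> \<ominus> \<one>"
      using add_cscale[of \<one> "of_real N" "- 1"] by (simp add: cscale_minus_one a_minus_def)
    then have "Y = (cscale X (of_real N) \<one> \<ominus> c) \<oplus> (?a \<otimes> ?a \<oplus> c \<ominus> \<one>)"
      unfolding Y_def using Nc c aa by algebra
    then show ?thesis using p_add[of "cscale X (of_real N) \<one> \<ominus> c" "?a \<otimes> ?a \<oplus> c \<ominus> \<one>"] c aa cN null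
      unfolding sum by simp
  qed
  have "(p ?a)\<^sup>2 \<le> 1"
  proof (rule field_le_epsilon)
    fix \<epsilon> :: real assume \<epsilon>: "\<epsilon> > 0"
    \<comment> \<open>\<open>R\<close> exceeds \<open>N\<close>, so that \<open>y = Y / R\<close>
      has seminorm below 1 and \<open>approximate_sqrt\<close> applies.\<close>
    define R where "R = N + \<epsilon> / 2"
    have R: "R > 0" using N0 \<epsilon> by (simp add: R_def)
    define y where "y = cscale X (of_real (1 / R)) Y"
    define a' where "a' = cscale X (of_real (1 / sqrt R)) ?a"
    have y: "y \<in> carrier X" "adj X y = y" "p y < 1"
      using Y pY R \<epsilon> by (simp_all add: y_def adj_cscale p_cscale norm_divide) (simp add: R_def)
    have a': "a' \<in> carrier X" "adj X a' = a'" using a by (simp_all add: a'_def adj_cscale)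
    have a'a': "a' \<otimes> a' = cscale X (of_real (1 / R)) (?a \<otimes> ?a)"
    proof -
      have "complex_of_real (1 / sqrt R) * complex_of_real (1 / sqrt R) = complex_of_real (1 / R)"
        using R by (simp flip: of_real_mult)
      then show ?thesis using a by (simp add: a'_def mult_cscale_left mult_cscale_right cscale_cscale)
    qed
    have "?a \<otimes> Y = Y \<otimes> ?a"
      using a by (simp add: Y_def r_distr l_distr mult_cscale_left mult_cscale_right m_assoc)
    then have comm: "a' \<otimes> y = y \<otimes> a'"
      using a Y by (simp add: a'_def y_def mult_cscale_left mult_cscale_right cscale_cscale mult.commute)
    obtain w where w: "w \<in> carrier X" "adj X w = w" "a' \<otimes> w = w \<otimes> a'"
      and we: "p (w \<otimes> w \<ominus> (\<one> \<ominus> y)) < \<epsilon> / 2 / R"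
      using approximate_sqrt[OF y, of "\<epsilon> / 2 / R"] a' comm \<epsilon> R by (metis divide_pos_pos half_gt_zero)
    have ww: "w \<otimes> w \<in> carrier X" using w by simp
    define q where "q = a' \<otimes> a'"
    have q: "q \<in> carrier X" using a' by (simp add: q_def)
    \<comment> \<open>The terms in \<open>b k\<close> cancel: \<open>q\<close> is
      \<open>(b k)^2 / R\<close> and \<open>y\<close> is \<open>(N - 1 + (b k)^2) / R\<close>, which
      leaves the scalar \<open>(R - N + 1) / R\<close>.\<close>
    have scal: "\<one> \<ominus> y \<oplus> q = cscale X (of_real ((1 + \<epsilon> / 2) / R)) \<one>"
    proof -
      have "y = cscale X (of_real ((N - 1) / R)) \<one> \<oplus> q"
        using aa by (simp add: y_def Y_def cscale_add cscale_cscale q_def a'a')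
      moreover define d where "d = cscale X (of_real ((N - 1) / R)) \<one>"
      moreover have "d \<in> carrier X" by (simp add: d_def)
      ultimately have "\<one> \<ominus> y \<oplus> q = \<one> \<ominus> d" using q by (simp only:) algebra
      also have "\<dots> = cscale X (1 + - of_real ((N - 1) / R)) \<one>"
        unfolding add_cscale[OF one_closed] by (simp only: cscale_one[OF one_closed] cscale_uminus[OF one_closed] d_def a_minus_def)
      also have "1 + - of_real ((N - 1) / R) = complex_of_real ((1 + \<epsilon> / 2) / R)"
      proof -
        have "1 + - ((N - 1) / R) = (1 + \<epsilon> / 2) / R" using R by (simp add: R_def field_simps)
        then show ?thesis by (metis of_real_1 of_real_add of_real_minus)
      qed
      finally show ?thesis .
    qed
    have "q \<oplus> w \<otimes> w = (w \<otimes> w \<ominus> (\<one> \<ominus> y)) \<oplus> (\<one> \<ominus> y \<oplus> q)"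
      using q ww y(1) by algebra
    then have "p (q \<oplus> w \<otimes> w) \<le> p (w \<otimes> w \<ominus> (\<one> \<ominus> y)) + p (\<one> \<ominus> y \<oplus> q)"
      using p_add[of "w \<otimes> w \<ominus> (\<one> \<ominus> y)" "\<one> \<ominus> y \<oplus> q"] q ww y(1) by simp
    also have "\<dots> \<le> \<epsilon> / 2 / R + (1 + \<epsilon> / 2) / R"
    proof -
      have "0 \<le> (1 + \<epsilon> / 2) / R" using \<epsilon> R by simp
      then have "cmod (of_real ((1 + \<epsilon> / 2) / R)) = (1 + \<epsilon> / 2) / R" by (simp only: norm_of_real abs_of_nonneg)
      then show ?thesis unfolding scal using we p_scalar[of "of_real ((1 + \<epsilon> / 2) / R)"] by linarith
    qed
    finally have "(p a')\<^sup>2 \<le> \<epsilon> / 2 / R + (1 + \<epsilon> / 2) / R"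
      using commuting_squares[OF a' w(1,2,3)] by (simp add: q_def)
    also have "\<dots> = (1 + \<epsilon>) / R" by (simp add: add_divide_distrib)
    also have "p a' = p ?a / sqrt R" using a R by (simp add: a'_def p_cscale norm_divide)
    finally show "(p ?a)\<^sup>2 \<le> 1 + \<epsilon>" using R by (simp add: power_divide divide_le_cancel)
  qed
  then show ?thesis using a by (simp add: power_le_one_iff abs_square_le_1)
qed

lemma null_finsum:
  assumes "finite A" "\<And>k. k \<in> A \<Longrightarrow> f k \<in> carrier X \<and> g k \<in> carrier X \<and> p (f k \<ominus> g k) = 0"
  shows "p ((\<Oplus>k\<in>A. f k) \<ominus> (\<Oplus>k\<in>A. g k)) = 0"
  using assms
proof (induction A rule: finite_induct)
  case empty
  then show ?case by (simp add: a_minus_def)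
next
  case (insert k A)
  then have c: "f k \<in> carrier X" "g k \<in> carrier X" "(\<Oplus>k\<in>A. f k) \<in> carrier X" "(\<Oplus>k\<in>A. g k) \<in> carrier X"
    by (auto intro!: finsum_closed)
  have "(\<Oplus>k\<in>insert k A. f k) = f k \<oplus> (\<Oplus>k\<in>A. f k)" "(\<Oplus>k\<in>insert k A. g k) = g k \<oplus> (\<Oplus>k\<in>A. g k)"
    using insert by (auto intro!: finsum_insert)
  moreover have "p (f k \<oplus> (\<Oplus>k\<in>A. f k) \<ominus> (g k \<oplus> (\<Oplus>k\<in>A. g k))) \<le> 0"
    using p_add_diff[OF c(1,3,2,4)] insert by simp
  ultimately show ?case using p_nonneg c by (simp add: antisym)
qed

text \<open>Under the seminorm the generators are self-adjoint only up to null elements. Their real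
  parts differ from them by null elements and satisfy the hypotheses of
  \<open>self_adjoint_bound\<close>.\<close>

lemma generator_bound:
  assumes fin: "finite A" and b: "\<And>k. k \<in> A \<Longrightarrow> b k \<in> carrier X \<and> p (b k \<ominus> adj X (b k)) = 0"
    and null: "p ((\<Oplus>k\<in>A. b k \<otimes> b k) \<ominus> \<one>) = 0" and k: "k \<in> A"
  shows "p (b k) \<le> 1"
proof -
  define a where "a k = cscale X (1/2) (b k \<oplus> adj X (b k))" for k
  have a: "a k \<in> carrier X \<and> adj X (a k) = a k" if "k \<in> A" for k
    using b[OF that] by (auto simp: a_def adj_cscale adj_add adj_adj a_comm)
  have ab: "p (b k \<ominus> a k) = 0" if "k \<in> A" for k
  proof -
    have c: "b k \<in> carrier X" "adj X (b k) \<in> carrier X" using b[OF that] by auto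
    have "cscale X (1/2) (b k) \<oplus> cscale X (1/2) (b k) = b k"
      using c add_cscale[of "b k" "1/2" "1/2"] by (simp add: cscale_one)
    moreover define h h' where "h = cscale X (1/2) (b k)" and "h' = cscale X (1/2) (adj X (b k))"
    moreover have "h \<in> carrier X" "h' \<in> carrier X" using c by (auto simp: h_def h'_def)
    ultimately have "b k \<ominus> a k = h \<oplus> h \<ominus> (h \<oplus> h')" using c by (simp add: a_def cscale_add)
    also have "\<dots> = h \<ominus> h'" using \<open>h \<in> carrier X\<close> \<open>h' \<in> carrier X\<close> by algebra
    also have "\<dots> = cscale X (1/2) (b k \<ominus> adj X (b k))" using c by (simp add: h_def h'_def cscale_diff)
    finally show ?thesis using b[OF that] c by (simp add: p_cscale)
  qed
  have "p ((\<Oplus>k\<in>A. a k \<otimes> a k) \<ominus> (\<Oplus>k\<in>A. b k \<otimes> b k)) = 0"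
  proof (rule null_finsum[OF fin])
    fix k assume k: "k \<in> A"
    have "p (a k \<otimes> a k \<ominus> b k \<otimes> b k) \<le> p (a k) * p (a k \<ominus> b k) + p (a k \<ominus> b k) * p (b k)"
      using a[OF k] b[OF k] by (intro p_mult_diff) auto
    also have "\<dots> = 0" using ab[OF k] a[OF k] b[OF k] p_diff_commute[of "a k" "b k"] by simp
    finally show "a k \<otimes> a k \<in> carrier X \<and> b k \<otimes> b k \<in> carrier X \<and> p (a k \<otimes> a k \<ominus> b k \<otimes> b k) = 0"
      using a[OF k] b[OF k] by (simp add: antisym)
  qed
  moreover have "(\<Oplus>k\<in>A. a k \<otimes> a k) \<in> carrier X" "(\<Oplus>k\<in>A. b k \<otimes> b k) \<in> carrier X"
    using a b by (auto intro!: finsum_closed)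
  ultimately have "p ((\<Oplus>k\<in>A. a k \<otimes> a k) \<ominus> \<one>) = 0"
    using p_diff_triangle[of "\<Oplus>k\<in>A. a k \<otimes> a k" "\<Oplus>k\<in>A. b k \<otimes> b k" \<one>] null by (simp add: antisym)
  then have "p (a k) \<le> 1" using a fin k by (intro self_adjoint_bound) auto
  then show ?thesis using p_le_diff[of "b k" "a k"] ab[OF k] a[OF k] b[OF k] by simp
qed

end

section \<open>Suprema of seminorms and operator norms\<close>

locale involutive_monoid_algebra = monoid_algebra G st for G :: "('m, 'b) monoid_scheme" and st +
  assumes st_closed [simp, intro]: "x \<in> carrier G \<Longrightarrow> st x \<in> carrier G"
    and st_mult: "x \<in> carrier G \<Longrightarrow> y \<in> carrier G \<Longrightarrow> st (x \<otimes>\<^bsub>G\<^esub> y) = st y \<otimes>\<^bsub>G\<^esub> st x"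
    and st_st: "x \<in> carrier G \<Longrightarrow> st (st x) = x"
begin

lemma adj_M: "adj M f z = (if z \<in> carrier G then cnj (f (st z)) else 0)"
  by (simp add: monoid_star_algebra_def)

lemma adj_support:
  assumes "f \<in> carrier M"
  shows "{z. adj M f z \<noteq> 0} = st ` {z. f z \<noteq> 0}"
proof
  show "{z. adj M f z \<noteq> 0} \<subseteq> st ` {z. f z \<noteq> 0}"
  proof
    fix z assume "z \<in> {z. adj M f z \<noteq> 0}"
    then have "z \<in> carrier G" "f (st z) \<noteq> 0" by (auto simp: adj_M split: if_splits)
    then show "z \<in> st ` {z. f z \<noteq> 0}" using st_st[of z] by (metis (mono_tags) image_eqI mem_Collect_eq)
  qed
  show "st ` {z. f z \<noteq> 0} \<subseteq> {z. adj M f z \<noteq> 0}"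
    using in_carrier_G[OF assms] by (auto simp: adj_M st_st)
qed

lemma adj_closed: "f \<in> carrier M \<Longrightarrow> adj M f \<in> carrier M"
  using adj_support[of f] in_carrier_G[of f] by (auto simp: carrier_iff)

lemma lin_ext_adj:
  assumes f: "f \<in> carrier M"
  shows "lin_ext u (adj M f) = cnj (lin_ext (\<lambda>w. cnj (u (st w))) f)"
proof -
  have inj: "inj_on st {z. f z \<noteq> 0}"
    using in_carrier_G[OF f] by (metis (mono_tags, lifting) inj_onI mem_Collect_eq st_st)
  have "lin_ext u (adj M f) = (\<Sum>z\<in>st ` {z. f z \<noteq> 0}. adj M f z * u z)"
    unfolding lin_ext_def adj_support[OF f] ..
  also have "\<dots> = (\<Sum>w | f w \<noteq> 0. adj M f (st w) * u (st w))"
    using inj by (simp add: sum.reindex)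
  also have "\<dots> = (\<Sum>w | f w \<noteq> 0. cnj (f w) * u (st w))"
    using in_carrier_G[OF f] by (intro sum.cong) (auto simp: adj_M st_st)
  finally show ?thesis by (simp add: lin_ext_def)
qed

lemma adj_delta: "w \<in> carrier G \<Longrightarrow> adj M (delta w) = delta (st w)"
  by (intro carrier_eqI adj_closed) (auto simp: lin_ext_adj)

lemma star_algebra_M: "star_algebra M"
proof -
  interpret complex_algebra M by (rule complex_algebra_M)
  show ?thesis
  proof
    fix f assume f: "f \<in> carrier M"
    show "adj M f \<in> carrier M" by (rule adj_closed[OF f])
    show "adj M (adj M f) = f"
      using f by (intro carrier_eqI adj_closed) (auto simp: lin_ext_adj adj_closed st_st in_carrier_G intro!: lin_ext_cong)
    show "adj M (cscale M c f) = cscale M (cnj c) (adj M f)" for c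
      using f by (intro carrier_eqI adj_closed) (auto simp: lin_ext_adj adj_closed lin_ext_M)
    fix g assume g: "g \<in> carrier M"
    show "adj M (f \<oplus>\<^bsub>M\<^esub> g) = adj M f \<oplus>\<^bsub>M\<^esub> adj M g"
      using f g by (intro carrier_eqI adj_closed) (auto simp: lin_ext_adj adj_closed lin_ext_M)
    show "adj M (f \<otimes>\<^bsub>M\<^esub> g) = adj M g \<otimes>\<^bsub>M\<^esub> adj M f"
    proof (rule carrier_eqI)
      fix u
      have "lin_ext u (adj M g \<otimes>\<^bsub>M\<^esub> adj M f) =
          cnj (lin_ext (\<lambda>y. lin_ext (\<lambda>x. cnj (u (st y \<otimes>\<^bsub>G\<^esub> st x))) f) g)"
        using f g by (simp add: lin_ext_mult lin_ext_adj adj_closed)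
      also have "\<dots> = cnj (lin_ext (\<lambda>x. lin_ext (\<lambda>y. cnj (u (st y \<otimes>\<^bsub>G\<^esub> st x))) g) f)"
        by (subst lin_ext_swap) simp
      also have "\<dots> = lin_ext u (adj M (f \<otimes>\<^bsub>M\<^esub> g))"
        using f g by (auto simp: lin_ext_mult lin_ext_adj st_mult in_carrier_G intro!: lin_ext_cong)
      finally show "lin_ext u (adj M (f \<otimes>\<^bsub>M\<^esub> g)) = lin_ext u (adj M g \<otimes>\<^bsub>M\<^esub> adj M f)" ..
    qed (use f g adj_closed in auto)
  qed
qed

end

context monoid_algebra
begin

lemma lin_ext_cscale: "lin_ext u (cscale M c f) = c * lin_ext u f"
  by (simp add: cscale_M lin_ext_scale)

lemma lin_ext_finsum:
  assumes "finite A" "\<And>k. k \<in> A \<Longrightarrow> f k \<in> carrier M"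
  shows "lin_ext u (\<Oplus>\<^bsub>M\<^esub>k\<in>A. f k) = (\<Sum>k\<in>A. lin_ext u (f k))"
proof -
  interpret complex_algebra M by (rule complex_algebra_M)
  show ?thesis using assms
  proof (induction A rule: finite_induct)
    case empty
    then show ?case by (simp add: zero_M lin_ext_def)
  next
    case (insert k A)
    then have "(\<Oplus>\<^bsub>M\<^esub>k\<in>insert k A. f k) = f k \<oplus>\<^bsub>M\<^esub> (\<Oplus>\<^bsub>M\<^esub>k\<in>A. f k)" by (intro finsum_insert) auto
    moreover have "(\<Oplus>\<^bsub>M\<^esub>k\<in>A. f k) \<in> carrier M" using insert by (intro finsum_closed) auto
    ultimately show ?case using insert by (simp add: lin_ext_M)
  qed
qed

text \<open>An indexed sum and not a function given by its support, because \<open>w\<close> need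
  not be injective: different words may have the same image in \<open>Ao n\<close>.\<close>

definition comb :: "'k set \<Rightarrow> ('k \<Rightarrow> complex) \<Rightarrow> ('k \<Rightarrow> 'm) \<Rightarrow> 'm \<Rightarrow> complex" where
  "comb A c w = (\<Oplus>\<^bsub>M\<^esub>k\<in>A. cscale M (c k) (delta (w k)))"

lemma comb_closed: "(\<And>k. k \<in> A \<Longrightarrow> w k \<in> carrier G) \<Longrightarrow> comb A c w \<in> carrier M"
proof -
  interpret complex_algebra M by (rule complex_algebra_M)
  show "(\<And>k. k \<in> A \<Longrightarrow> w k \<in> carrier G) \<Longrightarrow> comb A c w \<in> carrier M"
    unfolding comb_def by (intro finsum_closed) auto
qed

lemma lin_ext_comb:
  "finite A \<Longrightarrow> (\<And>k. k \<in> A \<Longrightarrow> w k \<in> carrier G) \<Longrightarrow> lin_ext u (comb A c w) = (\<Sum>k\<in>A. c k * u (w k))"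
  unfolding comb_def by (subst lin_ext_finsum) (auto simp: lin_ext_cscale cscale_closed)

text \<open>The triangle inequality over the support. The bound does not mention \<open>p\<close>,
  so it holds for a whole family of seminorms and makes their supremum finite.\<close>

lemma seminorm_le_sum:
  assumes "seminormed_algebra M p" "\<And>w. w \<in> carrier G \<Longrightarrow> p (delta w) \<le> B w" and f: "f \<in> carrier M"
  shows "p f \<le> (\<Sum>w | f w \<noteq> 0. cmod (f w) * B w)"
proof -
  interpret seminormed_algebra M p by fact
  have le: "p (comb A f (\<lambda>w. w)) \<le> (\<Sum>w\<in>A. cmod (f w) * B w)" if "finite A" "A \<subseteq> carrier G" for A
    using that
  proof (induction A rule: finite_induct)
    case (insert w A)
    have c: "comb A f (\<lambda>w. w) \<in> carrier M" "cscale M (f w) (delta w) \<in> carrier M"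
      using insert by (auto intro!: comb_closed)
    have "comb (insert w A) f (\<lambda>w. w) = cscale M (f w) (delta w) \<oplus>\<^bsub>M\<^esub> comb A f (\<lambda>w. w)"
      unfolding comb_def using insert by (subst finsum_insert) auto
    then have "p (comb (insert w A) f (\<lambda>w. w)) \<le> p (cscale M (f w) (delta w)) + p (comb A f (\<lambda>w. w))"
      using p_add[OF c(2,1)] by simp
    also have "p (cscale M (f w) (delta w)) \<le> cmod (f w) * B w"
      using insert assms(2)[of w] by (simp add: p_cscale mult_left_mono)
    finally show ?case using insert by simp
  qed (simp add: comb_def)
  have A: "finite {w. f w \<noteq> 0}" "{w. f w \<noteq> 0} \<subseteq> carrier G" using f by (auto simp: carrier_iff)
  have "f = comb {w. f w \<noteq> 0} f (\<lambda>w. w)"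
  proof (rule carrier_eqI[OF f comb_closed])
    show "lin_ext u f = lin_ext u (comb {w. f w \<noteq> 0} f (\<lambda>w. w))" for u
      using A by (subst lin_ext_comb) (auto simp: lin_ext_def)
  qed (use A in auto)
  then show ?thesis using le[OF A] by simp
qed

end

section \<open>Suprema of C*-seminorms\<close>

lemma cstar_seminormI:
  assumes "complex_algebra X" "cstar_seminorm X p"
  shows "seminormed_algebra X p"
proof -
  interpret complex_algebra X by fact
  show ?thesis using assms(2) by unfold_locales (auto simp: cstar_seminorm_def)
qed

text \<open>A real \<open>SUP\<close> is meaningful only for a nonempty bounded family, hence
  \<open>ne\<close> and \<open>bd\<close>. Homogeneity is the one equation among the axioms; it
  comes from the inequality \<open>sc\<close>, applied to \<open>c\<close> and to
  \<open>1 / c\<close>.\<close>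

lemma seminormed_sup:
  assumes X: "complex_algebra X" and ne: "P \<noteq> {}" and P: "\<And>p. p \<in> P \<Longrightarrow> cstar_seminorm X p"
    and bd: "\<And>x. x \<in> carrier X \<Longrightarrow> bdd_above ((\<lambda>p. p x) ` P)"
  shows "seminormed_algebra X (sup_seminorm P)"
proof -
  interpret complex_algebra X by fact
  have S: "seminormed_algebra X p" if "p \<in> P" for p using cstar_seminormI[OF X P[OF that]] .
  have up: "p x \<le> sup_seminorm P x" if "p \<in> P" "x \<in> carrier X" for p x
    unfolding sup_seminorm_def using bd that by (intro cSUP_upper) auto
  have least: "sup_seminorm P x \<le> K" if "\<And>p. p \<in> P \<Longrightarrow> p x \<le> K" for x K
    unfolding sup_seminorm_def using ne that by (intro cSUP_least) auto
  have nn: "0 \<le> sup_seminorm P x" if x: "x \<in> carrier X" for x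
  proof -
    obtain p where p: "p \<in> P" using ne by blast
    then show ?thesis using up[OF p x] seminormed_algebra.p_nonneg[OF S[OF p] x] by linarith
  qed
  have sc: "sup_seminorm P (cscale X c x) \<le> cmod c * sup_seminorm P x" if x: "x \<in> carrier X" for c x
  proof (rule least)
    fix p assume p: "p \<in> P"
    show "p (cscale X c x) \<le> cmod c * sup_seminorm P x"
      unfolding seminormed_algebra.p_cscale[OF S[OF p] x] using up[OF p x] by (intro mult_left_mono) auto
  qed
  show ?thesis
  proof unfold_locales
    fix x y assume xy: "x \<in> carrier X" "y \<in> carrier X"
    show "0 \<le> sup_seminorm P x" by (rule nn[OF xy(1)])
    show "sup_seminorm P (x \<oplus>\<^bsub>X\<^esub> y) \<le> sup_seminorm P x + sup_seminorm P y"
    proof (rule least)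
      fix p assume p: "p \<in> P"
      show "p (x \<oplus>\<^bsub>X\<^esub> y) \<le> sup_seminorm P x + sup_seminorm P y"
        using seminormed_algebra.p_add[OF S[OF p] xy] up[OF p xy(1)] up[OF p xy(2)] by linarith
    qed
    show "sup_seminorm P (x \<otimes>\<^bsub>X\<^esub> y) \<le> sup_seminorm P x * sup_seminorm P y"
    proof (rule least)
      fix p assume p: "p \<in> P"
      have "p x * p y \<le> sup_seminorm P x * sup_seminorm P y"
        using up[OF p] xy nn seminormed_algebra.p_nonneg[OF S[OF p]] by (intro mult_mono) auto
      then show "p (x \<otimes>\<^bsub>X\<^esub> y) \<le> sup_seminorm P x * sup_seminorm P y"
        using seminormed_algebra.p_mult[OF S[OF p] xy] by linarith
    qed
  next
    fix x c assume x: "x \<in> carrier X"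
    show "sup_seminorm P (cscale X c x) = cmod c * sup_seminorm P x"
    proof (cases "c = 0")
      case True
      have "sup_seminorm P (cscale X 0 x) \<le> 0" using sc[OF x, of 0] by simp
      moreover have "0 \<le> sup_seminorm P (cscale X 0 x)" using x by (intro nn) auto
      ultimately show ?thesis unfolding True by simp
    next
      case False
      have "sup_seminorm P (cscale X (1 / c) (cscale X c x)) \<le> cmod (1 / c) * sup_seminorm P (cscale X c x)"
        using x by (intro sc) auto
      then have "sup_seminorm P x \<le> sup_seminorm P (cscale X c x) / cmod c"
        using x False by (simp add: cscale_cscale cscale_one norm_divide)
      then have "cmod c * sup_seminorm P x \<le> sup_seminorm P (cscale X c x)"
        using False by (simp add: pos_le_divide_eq mult.commute)
      then show ?thesis using sc[OF x, of c] by simp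
    qed
  qed
qed

section \<open>Operator norms of matrices over a finite index set\<close>

definition vnorm :: "'x set \<Rightarrow> ('x \<Rightarrow> complex) \<Rightarrow> real" where
  "vnorm Y v = L2_set (\<lambda>x. cmod (v x)) Y"

definition mapply :: "'x set \<Rightarrow> ('x \<Rightarrow> 'x \<Rightarrow> complex) \<Rightarrow> ('x \<Rightarrow> complex) \<Rightarrow> 'x \<Rightarrow> complex" where
  "mapply Y A v x = (\<Sum>y\<in>Y. A x y * v y)"

definition opnorm :: "'x set \<Rightarrow> ('x \<Rightarrow> 'x \<Rightarrow> complex) \<Rightarrow> real" where
  "opnorm Y A = (SUP v\<in>{v. vnorm Y v \<le> 1}. vnorm Y (mapply Y A v))"

context
  fixes Y :: "'x set"
  assumes Y: "finite Y"
begin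

lemma vnorm_nonneg: "0 \<le> vnorm Y v"
  by (simp add: vnorm_def L2_set_nonneg)

lemma vnorm_cong: "(\<And>x. x \<in> Y \<Longrightarrow> v x = w x) \<Longrightarrow> vnorm Y v = vnorm Y w"
  unfolding vnorm_def by (intro L2_set_cong) auto

lemma vnorm_add: "vnorm Y (\<lambda>x. v x + w x) \<le> vnorm Y v + vnorm Y w"
proof -
  have "vnorm Y (\<lambda>x. v x + w x) \<le> L2_set (\<lambda>x. cmod (v x) + cmod (w x)) Y"
    unfolding vnorm_def by (intro L2_set_mono) (auto simp: norm_triangle_ineq)
  also have "\<dots> \<le> vnorm Y v + vnorm Y w" unfolding vnorm_def by (rule L2_set_triangle_ineq)
  finally show ?thesis .
qed

lemma vnorm_scale: "vnorm Y (\<lambda>x. c * v x) = cmod c * vnorm Y v"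
  unfolding vnorm_def norm_mult by (rule L2_set_right_distrib[symmetric]) simp

lemma component_le_vnorm: "x \<in> Y \<Longrightarrow> cmod (v x) \<le> vnorm Y v"
  unfolding vnorm_def using Y member_le_L2_set by fastforce

lemma vnorm_le_sum: "vnorm Y v \<le> (\<Sum>x\<in>Y. cmod (v x))"
  unfolding vnorm_def by (rule L2_set_le_sum) auto

lemma vnorm_square: "(vnorm Y v)\<^sup>2 = (\<Sum>x\<in>Y. (cmod (v x))\<^sup>2)"
  unfolding vnorm_def L2_set_def by (simp add: sum_nonneg)

text \<open>A crude bound by the sum of all entries, enough for the finiteness of the supremum in
  \<open>opnorm\<close> and for vectors of norm 0.\<close>

lemma mapply_bound: "vnorm Y (mapply Y A v) \<le> (\<Sum>x\<in>Y. \<Sum>y\<in>Y. cmod (A x y)) * vnorm Y v"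
proof -
  have "cmod (mapply Y A v x) \<le> (\<Sum>y\<in>Y. cmod (A x y)) * vnorm Y v" for x
  proof -
    have "cmod (mapply Y A v x) \<le> (\<Sum>y\<in>Y. cmod (A x y) * cmod (v y))"
      unfolding mapply_def by (rule order.trans[OF norm_sum]) (simp add: norm_mult)
    also have "\<dots> \<le> (\<Sum>y\<in>Y. cmod (A x y) * vnorm Y v)"
      by (intro sum_mono mult_left_mono component_le_vnorm) auto
    finally show ?thesis by (simp add: sum_distrib_right)
  qed
  then have "(\<Sum>x\<in>Y. cmod (mapply Y A v x)) \<le> (\<Sum>x\<in>Y. (\<Sum>y\<in>Y. cmod (A x y)) * vnorm Y v)"
    by (intro sum_mono)
  then show ?thesis using vnorm_le_sum[of "mapply Y A v"] by (simp add: sum_distrib_right)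
qed

lemma mapply_scale: "mapply Y A (\<lambda>x. c * v x) = (\<lambda>x. c * mapply Y A v x)"
  by (simp add: mapply_def sum_distrib_left mult_ac fun_eq_iff)

lemma opnorm_bdd: "bdd_above ((\<lambda>v. vnorm Y (mapply Y A v)) ` {v. vnorm Y v \<le> 1})"
proof (rule bdd_aboveI2)
  fix v assume "v \<in> {v. vnorm Y v \<le> 1}"
  then have "(\<Sum>x\<in>Y. \<Sum>y\<in>Y. cmod (A x y)) * vnorm Y v \<le> (\<Sum>x\<in>Y. \<Sum>y\<in>Y. cmod (A x y)) * 1"
    by (intro mult_left_mono) (auto intro!: sum_nonneg)
  then show "vnorm Y (mapply Y A v) \<le> (\<Sum>x\<in>Y. \<Sum>y\<in>Y. cmod (A x y))"
    using mapply_bound[of A v] by simp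
qed

lemma opnorm_apply: "vnorm Y (mapply Y A v) \<le> opnorm Y A * vnorm Y v"
proof (cases "vnorm Y v = 0")
  case True
  then show ?thesis using mapply_bound[of A v] by simp
next
  case False
  define c where "c = vnorm Y v"
  have c: "c > 0" using False vnorm_nonneg[of v] by (simp add: c_def)
  let ?v = "\<lambda>x. of_real (1 / c) * v x"
  have "vnorm Y ?v = 1" unfolding vnorm_scale using c by (simp add: c_def[symmetric] norm_divide)
  then have "vnorm Y (mapply Y A ?v) \<le> opnorm Y A"
    unfolding opnorm_def using opnorm_bdd by (intro cSUP_upper) auto
  then have "1 / c * vnorm Y (mapply Y A v) \<le> opnorm Y A"
    unfolding mapply_scale vnorm_scale using c by (simp add: norm_divide)
  then show ?thesis using c by (simp add: c_def[symmetric] field_simps)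
qed

lemma opnorm_least: "0 \<le> K \<Longrightarrow> (\<And>v. vnorm Y (mapply Y A v) \<le> K * vnorm Y v) \<Longrightarrow> opnorm Y A \<le> K"
  unfolding opnorm_def
proof (rule cSUP_least)
  have "vnorm Y (\<lambda>_. 0) = 0" by (simp add: vnorm_def L2_set_def)
  then show "{v. vnorm Y v \<le> 1} \<noteq> {}" by (metis (mono_tags) empty_iff mem_Collect_eq zero_le_one)
next
  fix v assume K: "0 \<le> K" "\<And>v. vnorm Y (mapply Y A v) \<le> K * vnorm Y v" "v \<in> {v. vnorm Y v \<le> 1}"
  then have "K * vnorm Y v \<le> K * 1" by (intro mult_left_mono) auto
  then show "vnorm Y (mapply Y A v) \<le> K" using K(2)[of v] by simp
qed

lemma opnorm_nonneg: "0 \<le> opnorm Y A"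
proof -
  have 0: "vnorm Y (\<lambda>_. 0) = 0" by (simp add: vnorm_def L2_set_def)
  have "vnorm Y (mapply Y A (\<lambda>_. 0)) \<le> opnorm Y A"
    unfolding opnorm_def using opnorm_bdd 0 by (intro cSUP_upper) auto
  then show ?thesis using vnorm_nonneg order.trans by blast
qed

lemma opnorm_cong: "(\<And>x y. x \<in> Y \<Longrightarrow> y \<in> Y \<Longrightarrow> A x y = B x y) \<Longrightarrow> opnorm Y A = opnorm Y B"
proof -
  assume "\<And>x y. x \<in> Y \<Longrightarrow> y \<in> Y \<Longrightarrow> A x y = B x y"
  then have "vnorm Y (mapply Y A v) = vnorm Y (mapply Y B v)" for v
    by (intro vnorm_cong) (simp add: mapply_def)
  then show ?thesis by (simp add: opnorm_def)
qed

lemma opnorm_add: "opnorm Y (\<lambda>x y. A x y + B x y) \<le> opnorm Y A + opnorm Y B"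
proof (rule opnorm_least)
  fix v
  have "mapply Y (\<lambda>x y. A x y + B x y) v = (\<lambda>x. mapply Y A v x + mapply Y B v x)"
    by (simp add: mapply_def distrib_right sum.distrib fun_eq_iff)
  then show "vnorm Y (mapply Y (\<lambda>x y. A x y + B x y) v) \<le> (opnorm Y A + opnorm Y B) * vnorm Y v"
    using vnorm_add[of "mapply Y A v" "mapply Y B v"] opnorm_apply[of A v] opnorm_apply[of B v]
    by (simp add: distrib_right)
qed (simp add: opnorm_nonneg)

lemma opnorm_mult: "opnorm Y (\<lambda>x y. \<Sum>z\<in>Y. A x z * B z y) \<le> opnorm Y A * opnorm Y B"
proof (rule opnorm_least)
  fix v
  have "mapply Y (\<lambda>x y. \<Sum>z\<in>Y. A x z * B z y) v = mapply Y A (mapply Y B v)"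
    unfolding mapply_def by (rule ext) (simp add: sum_distrib_left sum_distrib_right mult.assoc, rule sum.swap)
  then have "vnorm Y (mapply Y (\<lambda>x y. \<Sum>z\<in>Y. A x z * B z y) v) \<le> opnorm Y A * vnorm Y (mapply Y B v)"
    using opnorm_apply[of A "mapply Y B v"] by simp
  also have "\<dots> \<le> opnorm Y A * (opnorm Y B * vnorm Y v)"
    by (intro mult_left_mono opnorm_apply opnorm_nonneg)
  finally show "vnorm Y (mapply Y (\<lambda>x y. \<Sum>z\<in>Y. A x z * B z y) v) \<le> opnorm Y A * opnorm Y B * vnorm Y v" by simp
qed (simp add: opnorm_nonneg)

lemma opnorm_scale_le: "opnorm Y (\<lambda>x y. c * A x y) \<le> cmod c * opnorm Y A"
proof (rule opnorm_least)
  fix v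
  have "mapply Y (\<lambda>x y. c * A x y) v = (\<lambda>x. c * mapply Y A v x)"
    by (simp add: mapply_def sum_distrib_left mult_ac fun_eq_iff)
  then show "vnorm Y (mapply Y (\<lambda>x y. c * A x y) v) \<le> cmod c * opnorm Y A * vnorm Y v"
    using opnorm_apply[of A v] by (simp add: vnorm_scale mult.assoc mult_left_mono)
qed (simp add: opnorm_nonneg)

lemma opnorm_scale: "opnorm Y (\<lambda>x y. c * A x y) = cmod c * opnorm Y A"
proof (cases "c = 0")
  case True
  then show ?thesis using opnorm_scale_le[of 0 A] opnorm_nonneg[of "\<lambda>x y. 0 * A x y"] by simp
next
  case False
  have "opnorm Y A = opnorm Y (\<lambda>x y. 1 / c * (c * A x y))" using False by simp
  also have "\<dots> \<le> cmod (1 / c) * opnorm Y (\<lambda>x y. c * A x y)" by (rule opnorm_scale_le)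
  finally have "cmod c * opnorm Y A \<le> opnorm Y (\<lambda>x y. c * A x y)"
    using False by (simp add: norm_divide field_simps)
  then show ?thesis using opnorm_scale_le[of c A] by simp
qed

text \<open>Cauchy-Schwarz applied to \<open>|A v|^2 = <v, B v>\<close>, where \<open>B\<close> is
  the adjoint of \<open>A\<close> times \<open>A\<close>.\<close>

lemma opnorm_cstar_ge: "(opnorm Y A)\<^sup>2 \<le> opnorm Y (\<lambda>x y. \<Sum>z\<in>Y. cnj (A z x) * A z y)"
proof -
  let ?B = "\<lambda>x y. \<Sum>z\<in>Y. cnj (A z x) * A z y"
  have "opnorm Y A \<le> sqrt (opnorm Y ?B)"
  proof (rule opnorm_least)
    fix v
    have "complex_of_real ((vnorm Y (mapply Y A v))\<^sup>2) = (\<Sum>z\<in>Y. cnj (mapply Y A v z) * mapply Y A v z)"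
      unfolding vnorm_square of_real_sum complex_norm_square by (intro sum.cong) (auto simp: mult.commute)
    also have "\<dots> = (\<Sum>z\<in>Y. \<Sum>x\<in>Y. \<Sum>y\<in>Y. cnj (v x) * (cnj (A z x) * A z y * v y))"
      by (simp add: mapply_def sum_distrib_left sum_distrib_right mult_ac)
    also have "\<dots> = (\<Sum>x\<in>Y. \<Sum>y\<in>Y. \<Sum>z\<in>Y. cnj (v x) * (cnj (A z x) * A z y * v y))"
      by (rule trans[OF sum.swap]) (intro sum.cong refl sum.swap)
    also have "\<dots> = (\<Sum>x\<in>Y. cnj (v x) * mapply Y ?B v x)"
      by (simp add: mapply_def sum_distrib_left sum_distrib_right)
    finally have "(vnorm Y (mapply Y A v))\<^sup>2 = cmod (\<Sum>x\<in>Y. cnj (v x) * mapply Y ?B v x)"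
      by (metis abs_of_nonneg norm_of_real zero_le_power2)
    also have "\<dots> \<le> (\<Sum>x\<in>Y. \<bar>cmod (v x)\<bar> * \<bar>cmod (mapply Y ?B v x)\<bar>)"
      by (rule order.trans[OF norm_sum]) (simp add: norm_mult)
    also have "\<dots> \<le> vnorm Y v * vnorm Y (mapply Y ?B v)"
      unfolding vnorm_def by (rule L2_set_mult_ineq)
    also have "\<dots> \<le> vnorm Y v * (opnorm Y ?B * vnorm Y v)"
      by (intro mult_left_mono opnorm_apply vnorm_nonneg)
    finally have "(vnorm Y (mapply Y A v))\<^sup>2 \<le> (sqrt (opnorm Y ?B) * vnorm Y v)\<^sup>2"
      by (simp add: power_mult_distrib opnorm_nonneg power2_eq_square mult_ac)
    then show "vnorm Y (mapply Y A v) \<le> sqrt (opnorm Y ?B) * vnorm Y v"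
      by (rule power2_le_imp_le) (simp add: opnorm_nonneg vnorm_nonneg)
  qed (simp add: opnorm_nonneg)
  then have "(opnorm Y A)\<^sup>2 \<le> (sqrt (opnorm Y ?B))\<^sup>2" by (intro power_mono opnorm_nonneg)
  then show ?thesis by (simp add: opnorm_nonneg)
qed

lemma opnorm_adj_le: "opnorm Y A \<le> opnorm Y (\<lambda>x y. cnj (A y x))"
proof (cases "opnorm Y A = 0")
  case False
  then have "opnorm Y A > 0" using opnorm_nonneg[of A] by simp
  moreover have "opnorm Y A * opnorm Y A \<le> opnorm Y (\<lambda>x y. cnj (A y x)) * opnorm Y A"
    using opnorm_cstar_ge[of A] opnorm_mult[of "\<lambda>x y. cnj (A y x)" A] by (simp add: power2_eq_square)
  ultimately show ?thesis by simp
qed (simp add: opnorm_nonneg)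

lemma opnorm_cstar: "opnorm Y (\<lambda>x y. \<Sum>z\<in>Y. cnj (A z x) * A z y) = (opnorm Y A)\<^sup>2"
proof -
  have "opnorm Y (\<lambda>x y. cnj (A y x)) \<le> opnorm Y A" using opnorm_adj_le[of "\<lambda>x y. cnj (A y x)"] by simp
  then have "opnorm Y (\<lambda>x y. cnj (A y x)) * opnorm Y A \<le> opnorm Y A * opnorm Y A"
    by (intro mult_right_mono opnorm_nonneg)
  then show ?thesis
    using opnorm_cstar_ge[of A] opnorm_mult[of "\<lambda>x y. cnj (A y x)" A] by (simp add: power2_eq_square)
qed

lemma opnorm_eq_0_iff: "opnorm Y A = 0 \<longleftrightarrow> (\<forall>x\<in>Y. \<forall>y\<in>Y. A x y = 0)"
proof
  assume A: "opnorm Y A = 0"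
  show "\<forall>x\<in>Y. \<forall>y\<in>Y. A x y = 0"
  proof (intro ballI)
    fix x y assume xy: "x \<in> Y" "y \<in> Y"
    have "A x y = mapply Y A (\<lambda>z. if z = y then 1 else 0) x"
      using xy Y by (simp add: mapply_def if_distrib cong: if_cong)
    also have "cmod \<dots> \<le> vnorm Y (mapply Y A (\<lambda>z. if z = y then 1 else 0))"
      by (rule component_le_vnorm[OF xy(1)])
    finally have "cmod (A x y) \<le> opnorm Y A * vnorm Y (\<lambda>z. if z = y then 1 else 0)"
      using opnorm_apply by (rule order.trans)
    then show "A x y = 0" unfolding A by simp
  qed
next
  assume "\<forall>x\<in>Y. \<forall>y\<in>Y. A x y = 0"
  then have "opnorm Y A = opnorm Y (\<lambda>x y. 0 * A x y)" by (intro opnorm_cong) auto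
  then show "opnorm Y A = 0" unfolding opnorm_scale by simp
qed

end

section \<open>The universal seminorm of \<open>A\<^sub>o(n)\<close>\<close>

definition free_monoid :: "'g set \<Rightarrow> ('g \<times> bool) list monoid" where
  "free_monoid S = \<lparr>carrier = lists (S \<times> UNIV), mult = (@), one = []\<rparr>"

definition flip :: "('g \<times> bool) list \<Rightarrow> ('g \<times> bool) list" where
  "flip w = rev (map (\<lambda>(x, b). (x, \<not> b)) w)"

lemma free_star_algebra_eq: "free_star_algebra S = monoid_star_algebra (free_monoid S) flip"
  unfolding free_star_algebra_def free_monoid_def flip_def ..

lemma free_monoid_simps [simp]:
  "carrier (free_monoid S) = lists (S \<times> UNIV)" "v \<otimes>\<^bsub>free_monoid S\<^esub> w = v @ w" "\<one>\<^bsub>free_monoid S\<^esub> = []"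
  by (simp_all add: free_monoid_def)

interpretation FM: involutive_monoid_algebra "free_monoid S" flip for S
  by unfold_locales (auto simp: flip_def rev_map o_def split_beta in_lists_conv_set)

lemma map_fst_flip: "map fst (flip w) = rev (map fst w)"
  by (simp add: flip_def rev_map split_beta o_def)

lemma lin_ext_scale_right': "lin_ext (\<lambda>w. u w * c) f = lin_ext u f * c"
  by (simp add: lin_ext_def sum_distrib_right mult.assoc)

section \<open>Finite-dimensional representations and their seminorms\<close>

fun mword :: "'x set \<Rightarrow> ('g \<Rightarrow> 'x \<Rightarrow> 'x \<Rightarrow> complex) \<Rightarrow> 'g list \<Rightarrow> 'x \<Rightarrow> 'x \<Rightarrow> complex" where
  "mword Y m [] x y = (if x = y then 1 else 0)"
| "mword Y m (g # w) x y = (\<Sum>z\<in>Y. m g x z * mword Y m w z y)"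

lemma mword_append:
  assumes "finite Y" "x \<in> Y"
  shows "mword Y m (v @ w) x y = (\<Sum>z\<in>Y. mword Y m v x z * mword Y m w z y)"
  using assms(2)
proof (induction v arbitrary: x)
  case Nil
  have "(\<Sum>z\<in>Y. mword Y m [] x z * mword Y m w z y) = (\<Sum>z\<in>Y. if x = z then mword Y m w z y else 0)"
    by (intro sum.cong) auto
  then show ?case using Nil assms(1) by simp
next
  case (Cons g v)
  have "mword Y m ((g # v) @ w) x y = (\<Sum>z\<in>Y. \<Sum>t\<in>Y. m g x z * (mword Y m v z t * mword Y m w t y))"
    using Cons.IH by (simp add: sum_distrib_left)
  also have "\<dots> = (\<Sum>t\<in>Y. \<Sum>z\<in>Y. m g x z * (mword Y m v z t * mword Y m w t y))" by (rule sum.swap)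
  finally show ?case by (simp add: sum_distrib_right mult.assoc)
qed

lemma mword_rev:
  assumes "finite Y" and herm: "\<And>g x y. x \<in> Y \<Longrightarrow> y \<in> Y \<Longrightarrow> m g x y = cnj (m g y x)"
  shows "x \<in> Y \<Longrightarrow> y \<in> Y \<Longrightarrow> mword Y m (rev w) x y = cnj (mword Y m w y x)"
proof (induction w arbitrary: x y)
  case (Cons g w)
  have one: "mword Y m [g] z y = m g z y" if "z \<in> Y" for z
  proof -
    have "mword Y m [g] z y = (\<Sum>t\<in>Y. if t = y then m g z y else 0)"
      unfolding mword.simps by (intro sum.cong) auto
    then show ?thesis using assms(1) Cons.prems by simp
  qed
  have "mword Y m (rev (g # w)) x y = (\<Sum>z\<in>Y. mword Y m (rev w) x z * m g z y)"
    using assms(1) Cons.prems one by (simp add: mword_append)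
  also have "\<dots> = (\<Sum>z\<in>Y. cnj (mword Y m w z x) * cnj (m g y z))"
  proof (intro sum.cong refl)
    fix z assume z: "z \<in> Y"
    show "mword Y m (rev w) x z * m g z y = cnj (mword Y m w z x) * cnj (m g y z)"
      unfolding Cons.IH[OF Cons.prems(1) z] herm[OF z Cons.prems(2)] ..
  qed
  finally show ?case by (simp add: mult.commute)
qed auto

text \<open>\<open>map fst\<close> drops the adjoint marks of the letters: the generators are to act
  by hermitian matrices, so a letter and its adjoint act alike.\<close>

definition rep_matrix :: "'x set \<Rightarrow> ('g \<Rightarrow> 'x \<Rightarrow> 'x \<Rightarrow> complex) \<Rightarrow> (('g \<times> bool) list \<Rightarrow> complex) \<Rightarrow> 'x \<Rightarrow> 'x \<Rightarrow> complex" where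
  "rep_matrix Y m f x y = lin_ext (\<lambda>w. mword Y m (map fst w) x y) f"

definition rep_seminorm :: "'x set \<Rightarrow> ('g \<Rightarrow> 'x \<Rightarrow> 'x \<Rightarrow> complex) \<Rightarrow> (('g \<times> bool) list \<Rightarrow> complex) \<Rightarrow> real" where
  "rep_seminorm Y m f = opnorm Y (rep_matrix Y m f)"

text \<open>The operator norm pulled back along a *-representation; hermiticity of the generators
  turns the reversal of words into the adjoint of matrices.\<close>

lemma cstar_seminorm_rep:
  assumes Y: "finite Y" and herm: "\<And>g x y. x \<in> Y \<Longrightarrow> y \<in> Y \<Longrightarrow> m g x y = cnj (m g y x)"
  shows "cstar_seminorm (free_star_algebra S) (rep_seminorm Y m)"
  unfolding cstar_seminorm_def free_star_algebra_eq
proof (intro conjI ballI allI)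
  fix f assume f: "f \<in> carrier (FM.M S)"
  show "0 \<le> rep_seminorm Y m f" by (simp add: rep_seminorm_def opnorm_nonneg[OF Y])
  show "rep_seminorm Y m (cscale (FM.M S) c f) = cmod c * rep_seminorm Y m f" for c
    unfolding rep_seminorm_def rep_matrix_def FM.lin_ext_cscale by (rule opnorm_scale[OF Y])
  have mm: "rep_matrix Y m (f \<otimes>\<^bsub>FM.M S\<^esub> g) x y = (\<Sum>z\<in>Y. rep_matrix Y m f x z * rep_matrix Y m g z y)"
    if "x \<in> Y" "f \<in> carrier (FM.M S)" "g \<in> carrier (FM.M S)" for x y f g
    unfolding rep_matrix_def FM.lin_ext_mult[OF that(2,3)]
    by (simp add: mword_append[OF Y that(1)] lin_ext_sum_right lin_ext_scale_right lin_ext_scale_right')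
  have "rep_matrix Y m (adj (FM.M S) f) x y = cnj (rep_matrix Y m f y x)" if "x \<in> Y" "y \<in> Y" for x y
    unfolding rep_matrix_def FM.lin_ext_adj[OF f] map_fst_flip
    by (simp add: mword_rev[OF Y herm that])
  then have "rep_seminorm Y m (adj (FM.M S) f \<otimes>\<^bsub>FM.M S\<^esub> f) =
      opnorm Y (\<lambda>x y. \<Sum>z\<in>Y. cnj (rep_matrix Y m f z x) * rep_matrix Y m f z y)"
    unfolding rep_seminorm_def using f by (intro opnorm_cong[OF Y]) (simp add: mm FM.adj_closed)
  then show "rep_seminorm Y m (adj (FM.M S) f \<otimes>\<^bsub>FM.M S\<^esub> f) = (rep_seminorm Y m f)\<^sup>2"
    by (simp add: opnorm_cstar[OF Y] rep_seminorm_def)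
  fix g assume g: "g \<in> carrier (FM.M S)"
  have "rep_matrix Y m (f \<oplus>\<^bsub>FM.M S\<^esub> g) = (\<lambda>x y. rep_matrix Y m f x y + rep_matrix Y m g x y)"
    using f g by (simp add: rep_matrix_def FM.lin_ext_M fun_eq_iff)
  then show "rep_seminorm Y m (f \<oplus>\<^bsub>FM.M S\<^esub> g) \<le> rep_seminorm Y m f + rep_seminorm Y m g"
    unfolding rep_seminorm_def by (simp add: opnorm_add[OF Y])
  have "rep_seminorm Y m (f \<otimes>\<^bsub>FM.M S\<^esub> g) = opnorm Y (\<lambda>x y. \<Sum>z\<in>Y. rep_matrix Y m f x z * rep_matrix Y m g z y)"
    unfolding rep_seminorm_def using f g by (intro opnorm_cong[OF Y]) (simp add: mm)
  then show "rep_seminorm Y m (f \<otimes>\<^bsub>FM.M S\<^esub> g) \<le> rep_seminorm Y m f * rep_seminorm Y m g"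
    using opnorm_mult[OF Y, of "rep_matrix Y m f" "rep_matrix Y m g"] by (simp add: rep_seminorm_def)
qed

lemma rep_seminorm_eq_0_iff:
  "finite Y \<Longrightarrow> rep_seminorm Y m f = 0 \<longleftrightarrow> (\<forall>x\<in>Y. \<forall>y\<in>Y. rep_matrix Y m f x y = 0)"
  by (simp add: rep_seminorm_def opnorm_eq_0_iff)

text \<open>A representation of the relations of \<open>Ao n\<close> on the Hilbert space with basis
  \<open>Y\<close>; the sums over \<open>z\<close> are entries of matrix products.\<close>

definition orth_rep :: "nat \<Rightarrow> 'x set \<Rightarrow> (nat \<times> nat \<Rightarrow> 'x \<Rightarrow> 'x \<Rightarrow> complex) \<Rightarrow> bool" where
  "orth_rep n Y m \<longleftrightarrow> finite Y \<and>
     (\<forall>g. \<forall>x\<in>Y. \<forall>y\<in>Y. m g x y = cnj (m g y x)) \<and>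
     (\<forall>i\<in>{1..n}. \<forall>j\<in>{1..n}. \<forall>x\<in>Y. \<forall>y\<in>Y.
        (\<Sum>k=1..n. \<Sum>z\<in>Y. m (i, k) x z * m (j, k) z y) = (if i = j \<and> x = y then 1 else 0) \<and>
        (\<Sum>k=1..n. \<Sum>z\<in>Y. m (k, i) x z * m (k, j) z y) = (if i = j \<and> x = y then 1 else 0))"

abbreviation Fn :: "nat \<Rightarrow> (((nat \<times> nat) \<times> bool) list \<Rightarrow> complex) star_algebra" where
  "Fn n \<equiv> FM.M (ao_index n)"

abbreviation gen :: "nat \<Rightarrow> nat \<Rightarrow> ((nat \<times> nat) \<times> bool) list \<Rightarrow> complex" where
  "gen i j \<equiv> delta [((i, j), False)]"

lemma gen_closed: "i \<in> {1..n} \<Longrightarrow> j \<in> {1..n} \<Longrightarrow> gen i j \<in> carrier (Fn n)"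
  by (intro FM.delta_closed) (auto simp: ao_index_def)

lemma ao_relations_eq:
  "ao_relations n =
     {(gen i j, adj (Fn n) (gen i j)) |i j. i \<in> {1..n} \<and> j \<in> {1..n}} \<union>
     {(\<Oplus>\<^bsub>Fn n\<^esub>k\<in>{1..n}. gen i k \<otimes>\<^bsub>Fn n\<^esub> gen j k, if i = j then \<one>\<^bsub>Fn n\<^esub> else \<zero>\<^bsub>Fn n\<^esub>) |i j. i \<in> {1..n} \<and> j \<in> {1..n}} \<union>
     {(\<Oplus>\<^bsub>Fn n\<^esub>k\<in>{1..n}. gen k i \<otimes>\<^bsub>Fn n\<^esub> gen k j, if i = j then \<one>\<^bsub>Fn n\<^esub> else \<zero>\<^bsub>Fn n\<^esub>) |i j. i \<in> {1..n} \<and> j \<in> {1..n}}"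
  unfolding ao_relations_def Let_def free_star_algebra_eq by (rule refl)

lemma lin_ext_diff:
  assumes "f \<in> carrier (FM.M S)" "g \<in> carrier (FM.M S)"
  shows "lin_ext u (diff (FM.M S) f g) = lin_ext u f - lin_ext u g"
  using assms unfolding diff_def by (simp add: FM.lin_ext_M FM.lin_ext_cscale FM.cscale_closed)

lemma gen_products:
  assumes "i \<in> {1..n}" "j \<in> {1..n}" "k \<in> {1..n}" "l \<in> {1..n}"
  shows "gen i j \<otimes>\<^bsub>Fn n\<^esub> gen k l = delta [((i, j), False), ((k, l), False)]"
  using assms FM.delta_mult[of "[((i, j), False)]" "ao_index n" "[((k, l), False)]"] by (auto simp: ao_index_def)

lemma gen_sum_closed:
  assumes "\<And>k. k \<in> A \<Longrightarrow> f k \<in> carrier (Fn n) \<and> g k \<in> carrier (Fn n)"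
  shows "(\<Oplus>\<^bsub>Fn n\<^esub>k\<in>A. f k \<otimes>\<^bsub>Fn n\<^esub> g k) \<in> carrier (Fn n)"
proof -
  interpret complex_algebra "Fn n" by (rule FM.complex_algebra_M)
  show ?thesis using assms by (intro finsum_closed) auto
qed

lemma respects_rep:
  assumes m: "orth_rep n Y m"
  shows "respects_relations (Fn n) (ao_relations n) (rep_seminorm Y m)"
proof -
  have Y: "finite Y"
    and rows: "\<And>i j x y. i \<in> {1..n} \<Longrightarrow> j \<in> {1..n} \<Longrightarrow> x \<in> Y \<Longrightarrow> y \<in> Y \<Longrightarrow>
      (\<Sum>k=1..n. \<Sum>z\<in>Y. m (i, k) x z * m (j, k) z y) = (if i = j \<and> x = y then 1 else 0)"
    and cols: "\<And>i j x y. i \<in> {1..n} \<Longrightarrow> j \<in> {1..n} \<Longrightarrow> x \<in> Y \<Longrightarrow> y \<in> Y \<Longrightarrow>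
      (\<Sum>k=1..n. \<Sum>z\<in>Y. m (k, i) x z * m (k, j) z y) = (if i = j \<and> x = y then 1 else 0)"
    using m unfolding orth_rep_def by blast+
  have one: "mword Y m [g] x y = m g x y" if "y \<in> Y" for g x y
  proof -
    have "mword Y m [g] x y = (\<Sum>t\<in>Y. if t = y then m g x y else 0)"
      unfolding mword.simps by (intro sum.cong) auto
    then show ?thesis using Y that by simp
  qed
  have two: "mword Y m [g, g'] x y = (\<Sum>z\<in>Y. m g x z * m g' z y)" if "x \<in> Y" "y \<in> Y" for g g' x y
    using mword_append[OF Y that(1), of m "[g]" "[g']" y] one that by (simp cong: sum.cong)
  have z: "rep_seminorm Y m (diff (Fn n) a b) = 0"
    if "a \<in> carrier (Fn n)" "b \<in> carrier (Fn n)"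
      "\<And>x y. x \<in> Y \<Longrightarrow> y \<in> Y \<Longrightarrow> rep_matrix Y m a x y = rep_matrix Y m b x y" for a b
    using that unfolding rep_seminorm_eq_0_iff[OF Y] rep_matrix_def by (simp add: lin_ext_diff)
  \<comment> \<open>Rows and columns at once: the functions \<open>a\<close>, \<open>b\<close>,
    \<open>c\<close>, \<open>d\<close> say which indices of the two factors run with
    \<open>k\<close>.\<close>
  have quad: "rep_seminorm Y m (diff (Fn n) (\<Oplus>\<^bsub>Fn n\<^esub>k\<in>{1..n}. gen (a k) (b k) \<otimes>\<^bsub>Fn n\<^esub> gen (c k) (d k))
      (if i = j then \<one>\<^bsub>Fn n\<^esub> else \<zero>\<^bsub>Fn n\<^esub>)) = 0"
    if abcd: "\<And>k. k \<in> {1..n} \<Longrightarrow> a k \<in> {1..n} \<and> b k \<in> {1..n} \<and> c k \<in> {1..n} \<and> d k \<in> {1..n}"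
      and rel: "\<And>x y. x \<in> Y \<Longrightarrow> y \<in> Y \<Longrightarrow>
        (\<Sum>k=1..n. \<Sum>z\<in>Y. m (a k, b k) x z * m (c k, d k) z y) = (if i = j \<and> x = y then 1 else 0)"
    for a b c d :: "nat \<Rightarrow> nat" and i j :: nat
  proof (rule z)
    let ?s = "\<Oplus>\<^bsub>Fn n\<^esub>k\<in>{1..n}. gen (a k) (b k) \<otimes>\<^bsub>Fn n\<^esub> gen (c k) (d k)"
    show "?s \<in> carrier (Fn n)" using abcd by (intro gen_sum_closed conjI gen_closed) blast+
    show "(if i = j then \<one>\<^bsub>Fn n\<^esub> else \<zero>\<^bsub>Fn n\<^esub>) \<in> carrier (Fn n)"
      by (simp add: FM.one_closed FM.zero_closed)
    fix x y assume xy: "x \<in> Y" "y \<in> Y"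
    have "rep_matrix Y m ?s x y = (\<Sum>k=1..n. rep_matrix Y m (gen (a k) (b k) \<otimes>\<^bsub>Fn n\<^esub> gen (c k) (d k)) x y)"
      unfolding rep_matrix_def using abcd by (intro FM.lin_ext_finsum FM.mult_closed gen_closed) blast+
    also have "\<dots> = (\<Sum>k=1..n. \<Sum>z\<in>Y. m (a k, b k) x z * m (c k, d k) z y)"
      using abcd by (intro sum.cong refl) (simp add: gen_products rep_matrix_def two[OF xy] del: mword.simps atLeastAtMost_iff)
    also have "\<dots> = rep_matrix Y m (if i = j then \<one>\<^bsub>Fn n\<^esub> else \<zero>\<^bsub>Fn n\<^esub>) x y"
      unfolding rel[OF xy] by (simp add: rep_matrix_def FM.one_M FM.zero_M lin_ext_def[of _ "\<lambda>_. 0"])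
    finally show "rep_matrix Y m ?s x y = rep_matrix Y m (if i = j then \<one>\<^bsub>Fn n\<^esub> else \<zero>\<^bsub>Fn n\<^esub>) x y" .
  qed
  show ?thesis
    unfolding respects_relations_def
  proof (rule ballI, clarify)
    fix a b assume "(a, b) \<in> ao_relations n"
    then consider (adj) i j where "i \<in> {1..n}" "j \<in> {1..n}" "a = gen i j" "b = adj (Fn n) (gen i j)"
      | (row) i j where "i \<in> {1..n}" "j \<in> {1..n}" "a = (\<Oplus>\<^bsub>Fn n\<^esub>k\<in>{1..n}. gen i k \<otimes>\<^bsub>Fn n\<^esub> gen j k)"
          "b = (if i = j then \<one>\<^bsub>Fn n\<^esub> else \<zero>\<^bsub>Fn n\<^esub>)"
      | (col) i j where "i \<in> {1..n}" "j \<in> {1..n}" "a = (\<Oplus>\<^bsub>Fn n\<^esub>k\<in>{1..n}. gen k i \<otimes>\<^bsub>Fn n\<^esub> gen k j)"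
          "b = (if i = j then \<one>\<^bsub>Fn n\<^esub> else \<zero>\<^bsub>Fn n\<^esub>)"
      unfolding ao_relations_eq by blast
    then show "rep_seminorm Y m (diff (Fn n) a b) = 0"
    proof cases
      case adj
      have w: "[((i, j), False)] \<in> carrier (free_monoid (ao_index n))" using adj by (simp add: ao_index_def)
      have b: "b = delta [((i, j), True)]" using adj FM.adj_delta[OF w] by (simp add: flip_def)
      show ?thesis
      proof (rule z)
        show "a \<in> carrier (Fn n)" "b \<in> carrier (Fn n)" using adj w by (auto intro!: FM.adj_closed)
        show "rep_matrix Y m a x y = rep_matrix Y m b x y" for x y
          unfolding b adj(3) rep_matrix_def by simp
      qed
    next
      case row
      show ?thesis unfolding row(3,4)
        by (rule quad[of "\<lambda>_. i" "\<lambda>k. k" "\<lambda>_. j" "\<lambda>k. k"]) (use row(1,2) rows in blast)+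
    next
      case col
      show ?thesis unfolding col(3,4)
        by (rule quad[of "\<lambda>k. k" "\<lambda>_. i" "\<lambda>k. k" "\<lambda>_. j"]) (use col(1,2) cols in blast)+
    qed
  qed
qed

section \<open>The universal seminorm as a finite supremum\<close>

definition ao_family :: "nat \<Rightarrow> ((((nat \<times> nat) \<times> bool) list \<Rightarrow> complex) \<Rightarrow> real) set" where
  "ao_family n = {p. cstar_seminorm (Fn n) p \<and> respects_relations (Fn n) (ao_relations n) p}"

abbreviation ao_norm :: "nat \<Rightarrow> (((nat \<times> nat) \<times> bool) list \<Rightarrow> complex) \<Rightarrow> real" where
  "ao_norm n \<equiv> universal_seminorm (ao_index n) (ao_relations n)"

lemma ao_norm_eq: "ao_norm n = sup_seminorm (ao_family n)"
  by (simp add: universal_seminorm_def ao_family_def free_star_algebra_eq)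

lemma rep_in_family: "orth_rep n Y m \<Longrightarrow> rep_seminorm Y m \<in> ao_family n"
proof -
  assume m: "orth_rep n Y m"
  then have "finite Y" "\<And>g x y. x \<in> Y \<Longrightarrow> y \<in> Y \<Longrightarrow> m g x y = cnj (m g y x)"
    unfolding orth_rep_def by blast+
  then have "cstar_seminorm (Fn n) (rep_seminorm Y m)"
    unfolding free_star_algebra_eq[symmetric] by (rule cstar_seminorm_rep)
  then show ?thesis unfolding ao_family_def using respects_rep[OF m] by blast
qed

lemma zero_in_family: "(\<lambda>_. 0) \<in> ao_family n"
  by (simp add: ao_family_def cstar_seminorm_def respects_relations_def split_beta)

lemma ao_family_seminorm: "p \<in> ao_family n \<Longrightarrow> cstar_seminormed (Fn n) p"
proof -
  assume p: "p \<in> ao_family n"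
  interpret S: star_algebra "Fn n" by (rule FM.star_algebra_M)
  interpret P: seminormed_algebra "Fn n" p
    using p by (intro cstar_seminormI FM.complex_algebra_M) (auto simp: ao_family_def)
  show ?thesis using p by unfold_locales (auto simp: ao_family_def cstar_seminorm_def)
qed

lemma family_null:
  assumes "p \<in> ao_family n" "(a, b) \<in> ao_relations n"
  shows "p (diff (Fn n) a b) = 0"
  using assms by (auto simp: ao_family_def respects_relations_def)

text \<open>The generators in row \<open>i\<close> have squares summing to 1 up to a null element,
  which is the hypothesis of \<open>generator_bound\<close>. Submultiplicativity carries the bound
  from letters to words.\<close>

lemma family_word_bound:
  assumes p: "p \<in> ao_family n" and w: "w \<in> lists (ao_index n \<times> UNIV)"
  shows "p (delta w) \<le> 1"
proof -
  interpret cstar_seminormed "Fn n" p by (rule ao_family_seminorm[OF p])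
  have gen: "p (gen i j) \<le> 1" if ij: "i \<in> {1..n}" "j \<in> {1..n}" for i j
  proof (rule generator_bound[of "{1..n}" "gen i"])
    fix k assume k: "k \<in> {1..n}"
    have c: "gen i k \<in> carrier (Fn n)" using ij k by (intro gen_closed)
    have "p (diff (Fn n) (gen i k) (adj (Fn n) (gen i k))) = 0"
      using ij k by (intro family_null[OF p]) (auto simp: ao_relations_eq)
    then show "gen i k \<in> carrier (Fn n) \<and> p (gen i k \<ominus>\<^bsub>Fn n\<^esub> adj (Fn n) (gen i k)) = 0"
      using c by (simp add: diff_eq)
  next
    have "p (diff (Fn n) (\<Oplus>\<^bsub>Fn n\<^esub>k\<in>{1..n}. gen i k \<otimes>\<^bsub>Fn n\<^esub> gen i k) \<one>\<^bsub>Fn n\<^esub>) = 0"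
      using ij by (intro family_null[OF p]) (auto simp: ao_relations_eq)
    moreover have "(\<Oplus>\<^bsub>Fn n\<^esub>k\<in>{1..n}. gen i k \<otimes>\<^bsub>Fn n\<^esub> gen i k) \<in> carrier (Fn n)"
      using ij by (intro gen_sum_closed conjI gen_closed)
    ultimately show "p ((\<Oplus>\<^bsub>Fn n\<^esub>k\<in>{1..n}. gen i k \<otimes>\<^bsub>Fn n\<^esub> gen i k) \<ominus>\<^bsub>Fn n\<^esub> \<one>\<^bsub>Fn n\<^esub>) = 0"
      by (simp add: diff_eq)
  qed (use ij in auto)
  have letter: "p (delta [l]) \<le> 1" if l: "l \<in> ao_index n \<times> UNIV" for l
  proof -
    obtain i j b where l': "l = ((i, j), b)" by (cases l) auto
    then have ij: "i \<in> {1..n}" "j \<in> {1..n}" using l by (auto simp: ao_index_def)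
    show ?thesis
    proof (cases b)
      case True
      have "[((i, j), False)] \<in> carrier (free_monoid (ao_index n))" using ij by (simp add: ao_index_def)
      then have "delta [l] = adj (Fn n) (gen i j)" using True l' by (simp add: FM.adj_delta flip_def)
      then show ?thesis using p_adj[OF gen_closed[OF ij]] gen[OF ij] by simp
    next
      case False
      then show ?thesis using gen[OF ij] l' by simp
    qed
  qed
  show ?thesis using w
  proof (induction w)
    case Nil
    then show ?case using p_one by (simp add: FM.one_M)
  next
    case (Cons l w)
    have l: "[l] \<in> carrier (free_monoid (ao_index n))" and w: "w \<in> carrier (free_monoid (ao_index n))"
      using Cons by auto
    have "p (delta (l # w)) \<le> p (delta [l]) * p (delta w)"
      using FM.delta_mult[OF l w] p_mult[OF FM.delta_closed[OF l] FM.delta_closed[OF w]] by simp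
    also have "\<dots> \<le> 1 * 1"
      using Cons letter[of l] p_nonneg[OF FM.delta_closed[OF w]] by (intro mult_mono) auto
    finally show ?case by simp
  qed
qed

lemma family_bdd:
  assumes "f \<in> carrier (Fn n)"
  shows "bdd_above ((\<lambda>p. p f) ` ao_family n)"
proof (rule bdd_aboveI2)
  fix p assume p: "p \<in> ao_family n"
  show "p f \<le> (\<Sum>w | f w \<noteq> 0. cmod (f w) * 1)"
    using ao_family_seminorm[OF p] family_word_bound[OF p] assms
    by (intro FM.seminorm_le_sum[where B = "\<lambda>_. 1"]) (auto simp: cstar_seminormed_def)
qed

lemma ao_norm_seminormed: "seminormed_algebra (Fn n) (ao_norm n)"
  unfolding ao_norm_eq
proof (rule seminormed_sup[OF FM.complex_algebra_M])
  show "ao_family n \<noteq> {}" using zero_in_family by blast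
  show "cstar_seminorm (Fn n) p" if "p \<in> ao_family n" for p using that by (simp add: ao_family_def)
qed (rule family_bdd)

lemma family_le_ao_norm: "p \<in> ao_family n \<Longrightarrow> f \<in> carrier (Fn n) \<Longrightarrow> p f \<le> ao_norm n f"
  unfolding ao_norm_eq sup_seminorm_def by (intro cSUP_upper family_bdd)

lemma ao_norm_null: "(a, b) \<in> ao_relations n \<Longrightarrow> ao_norm n (diff (Fn n) a b) = 0"
proof -
  assume ab: "(a, b) \<in> ao_relations n"
  have "(\<lambda>p. p (diff (Fn n) a b)) ` ao_family n = {0}"
    using zero_in_family[of n] family_null[OF _ ab] by force
  then show ?thesis unfolding ao_norm_eq sup_seminorm_def by simp
qed

lemma Ao_eq: "Ao n = cstar_completion (Fn n) (ao_norm n)"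
  by (simp add: Ao_def universal_cstar_algebra_def free_star_algebra_eq)

section \<open>Moments of the Haar functional\<close>

context seminormed_algebra
begin

text \<open>\<open>cnorm\<close> is a definite description, so the limit must be shown to exist and
  to be the same for all representatives. Both follow from
  \<open>|p x - p y| \<le> p (x - y)\<close>.\<close>

lemma cnorm_nonneg:
  assumes "S \<in> carrier Q"
  shows "0 \<le> cnorm Q S"
proof -
  obtain a where a: "a \<in> C" "S = cls a" using assms by (rule carrier_Q_cases)
  have lip: "\<bar>p x - p y\<bar> \<le> p (x \<ominus> y)" if "x \<in> carrier X" "y \<in> carrier X" for x y
    using p_le_diff[OF that] p_le_diff[OF that(2,1)] p_diff_commute[OF that] by linarith
  have "Cauchy (\<lambda>k. p (a k))"
  proof (rule metric_CauchyI)
    fix e :: real assume "e > 0"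
    then obtain N where N: "\<forall>j\<ge>N. \<forall>k\<ge>N. p (a j \<ominus> a k) < e" using C_cauchy[OF a(1)] by blast
    have "dist (p (a j)) (p (a k)) < e" if "j \<ge> N" "k \<ge> N" for j k
      using lip[OF C_carrier[OF a(1), of j] C_carrier[OF a(1), of k]] N that by (fastforce simp: dist_real_def)
    then show "\<exists>N. \<forall>j\<ge>N. \<forall>k\<ge>N. dist (p (a j)) (p (a k)) < e" by blast
  qed
  then obtain L where L: "(\<lambda>k. p (a k)) \<longlonglongrightarrow> L" by (auto simp: Cauchy_convergent_iff convergent_def)
  have all: "(\<lambda>k. p (b k)) \<longlonglongrightarrow> L" if b: "b \<in> S" for b
  proof -
    have ab: "(a, b) \<in> R" using b a by simp
    note H = R_C[OF ab]
    have "(\<lambda>k. p (b k) - p (a k)) \<longlonglongrightarrow> 0"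
    proof (rule Lim_null_comparison)
      show "\<forall>\<^sub>F k in sequentially. norm (p (b k) - p (a k)) \<le> p (a k \<ominus> b k)"
        using lip H by (auto simp: C_carrier abs_minus_commute)
    qed (use H in simp)
    then have "(\<lambda>k. (p (b k) - p (a k)) + p (a k)) \<longlonglongrightarrow> 0 + L" using L by (rule tendsto_add)
    then show ?thesis by simp
  qed
  have aS: "a \<in> S" using a equiv_class_self[OF equiv_R a(1)] by simp
  have "cnorm Q S = (THE r. \<forall>a\<in>S. (\<lambda>k. p (a k)) \<longlonglongrightarrow> r)" by (simp add: cstar_completion_def)
  also have "\<dots> = L"
    using all aS by (intro the_equality) (auto intro: LIMSEQ_unique)
  also have "L \<ge> 0"
    using L C_carrier[OF a(1)] by (intro LIMSEQ_le_const) auto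
  finally show ?thesis .
qed

end

context monoid_algebra
begin

lemma comb_empty: "comb {} c w = \<zero>\<^bsub>M\<^esub>"
proof -
  interpret complex_algebra M by (rule complex_algebra_M)
  show ?thesis by (simp add: comb_def)
qed

lemma comb_insert:
  assumes "finite A" "k \<notin> A" "\<And>j. j \<in> insert k A \<Longrightarrow> w j \<in> carrier G"
  shows "comb (insert k A) c w = cscale M (c k) (delta (w k)) \<oplus>\<^bsub>M\<^esub> comb A c w"
proof -
  interpret complex_algebra M by (rule complex_algebra_M)
  show ?thesis unfolding comb_def using assms by (intro finsum_insert) auto
qed

end

text \<open>Nonnegativity of \<open>cnorm\<close> puts the zero seminorm into the family; the supremum of an empty
  family would be a junk value.\<close>

lemma tensor_seminormed:
  assumes A: "complex_algebra A" and nn: "\<And>a. a \<in> carrier A \<Longrightarrow> 0 \<le> cnorm A a"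
  shows "seminormed_algebra (pre_tensor A A) (tensor_seminorm A A)"
proof -
  interpret A: complex_algebra A by (rule A)
  have AA: "monoid (A \<times>\<times> A)" by (intro DirProd_monoid A.monoid_axioms)
  interpret T: monoid_algebra "A \<times>\<times> A" "\<lambda>(a, b). (adj A a, adj A b)"
    using AA by (simp add: monoid_algebra_def)
  let ?P = "{p. cstar_seminorm (pre_tensor A A) p \<and>
                respects_relations (pre_tensor A A) (bilinear_relations A A) p \<and>
                (\<forall>a\<in>carrier A. \<forall>b\<in>carrier A. p (delta (a, b)) \<le> cnorm A a * cnorm A b)}"
  show ?thesis unfolding tensor_seminorm_def
  proof (rule seminormed_sup)
    show "complex_algebra (pre_tensor A A)" unfolding pre_tensor_def by (rule T.complex_algebra_M)
    have "(\<lambda>_. 0) \<in> ?P"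
      using nn by (simp add: cstar_seminorm_def respects_relations_def split_beta)
    then show "?P \<noteq> {}" by blast
    show "cstar_seminorm (pre_tensor A A) p" if "p \<in> ?P" for p using that by simp
    fix f assume f: "f \<in> carrier (pre_tensor A A)"
    show "bdd_above ((\<lambda>p. p f) ` ?P)"
    proof (rule bdd_aboveI2)
      fix p assume p: "p \<in> ?P"
      show "p f \<le> (\<Sum>w | f w \<noteq> 0. cmod (f w) * (cnorm A (fst w) * cnorm A (snd w)))"
      proof (rule T.seminorm_le_sum)
        show "seminormed_algebra T.M p"
          using p T.complex_algebra_M by (intro cstar_seminormI) (auto simp: pre_tensor_def)
        show "p (delta w) \<le> cnorm A (fst w) * cnorm A (snd w)" if "w \<in> carrier (A \<times>\<times> A)" for w
          using p that by (cases w) auto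
        show "f \<in> carrier T.M" using f by (simp add: pre_tensor_def)
      qed
    qed
  qed
qed

section \<open>\<open>Ao n\<close> and its tensor square as completions\<close>

interpretation SU: seminormed_algebra "Fn n" "ao_norm n" for n
  by (rule ao_norm_seminormed)

interpretation A: complex_algebra "Ao n" for n
  unfolding Ao_eq by (rule SU.complex_algebra_Q)

lemma monoid_AA: "monoid (Ao n \<times>\<times> Ao n)"
  by (intro DirProd_monoid A.monoid_axioms)

interpretation T: monoid_algebra "Ao n \<times>\<times> Ao n" "\<lambda>(a, b). (adj (Ao n) a, adj (Ao n) b)" for n
  using monoid_AA by (simp add: monoid_algebra_def)

lemma pre_tensor_eq: "pre_tensor (Ao n) (Ao n) = T.M n"
  by (simp add: pre_tensor_def)

abbreviation ao_tensor_norm where "ao_tensor_norm n \<equiv> tensor_seminorm (Ao n) (Ao n)"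

interpretation ST: seminormed_algebra "T.M n" "ao_tensor_norm n" for n
  unfolding pre_tensor_eq[symmetric]
proof (rule tensor_seminormed)
  show "complex_algebra (Ao n)" by (rule A.complex_algebra_axioms)
  show "0 \<le> cnorm (Ao n) a" if "a \<in> carrier (Ao n)" for a
    using that unfolding Ao_eq by (rule SU.cnorm_nonneg)
qed

lemma cstar_tensor_eq: "cstar_tensor (Ao n) (Ao n) = ST.Q n"
  by (simp add: cstar_tensor_def pre_tensor_eq)

interpretation B: complex_algebra "ST.Q n" for n
  by (rule ST.complex_algebra_Q)

lemma tens_eq: "tens (Ao n) (Ao n) a b = ST.emb n (delta (a, b))"
  by (simp add: tens_def pre_tensor_eq)

abbreviation letters :: "(nat \<times> nat) list \<Rightarrow> ((nat \<times> nat) \<times> bool) list" where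
  "letters w \<equiv> map (\<lambda>g. (g, False)) w"

text \<open>Monomials in the generators. They are mostly used with \<open>w = zip I J\<close>, the
  entry of a tensor power of \<open>u\<close> in the row \<open>I\<close> and the column
  \<open>J\<close>.\<close>

definition uword :: "nat \<Rightarrow> (nat \<times> nat) list \<Rightarrow> ao_elem" where
  "uword n w = SU.emb n (delta (letters w))"

lemma letters_closed [simp]: "set w \<subseteq> {1..n} \<times> {1..n} \<Longrightarrow> letters w \<in> lists (ao_index n \<times> UNIV)"
  by (auto simp: ao_index_def)

lemma letters_carrier: "set w \<subseteq> {1..n} \<times> {1..n} \<Longrightarrow> letters w \<in> carrier (free_monoid (ao_index n))"
  by (simp only: free_monoid_simps letters_closed)

lemma uword_closed: "set w \<subseteq> {1..n} \<times> {1..n} \<Longrightarrow> uword n w \<in> carrier (Ao n)"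
  unfolding uword_def Ao_eq by (intro SU.embed_closed FM.delta_closed letters_carrier)

lemma uword_Nil: "uword n [] = \<one>\<^bsub>Ao n\<^esub>"
  unfolding uword_def Ao_eq SU.embed_one[symmetric] by (simp add: FM.one_M)

lemma uword_append:
  assumes "set v \<subseteq> {1..n} \<times> {1..n}" "set w \<subseteq> {1..n} \<times> {1..n}"
  shows "uword n (v @ w) = uword n v \<otimes>\<^bsub>Ao n\<^esub> uword n w"
proof -
  note v = letters_carrier[OF assms(1)] and w = letters_carrier[OF assms(2)]
  have "delta (letters (v @ w)) = delta (letters v) \<otimes>\<^bsub>Fn n\<^esub> delta (letters w)"
    using FM.delta_mult[OF v w] by simp
  then show ?thesis unfolding uword_def Ao_eq
    using SU.embed_mult[OF FM.delta_closed[OF v] FM.delta_closed[OF w]] by simp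
qed

lemma ao_u_eq: "ao_u n i j = uword n [(i, j)]"
  by (simp add: ao_u_def universal_generator_def uword_def free_star_algebra_eq)

text \<open>The matrix rule \<open>u_IJ \<mapsto> \<Sum>K. u_IK \<otimes> u_KJ\<close> for tensor
  powers. Multiplicativity splits off the first letters, and the product of the two sums is the sum
  over the words \<open>k # K\<close>.\<close>

lemma comultiplication_uword:
  assumes \<Delta>: "is_comultiplication n \<Delta>"
  shows "I \<in> words n m \<Longrightarrow> J \<in> words n m \<Longrightarrow>
    \<Delta> (uword n (zip I J)) = ST.emb n (T.comb n (words n m) (\<lambda>_. 1) (\<lambda>K. (uword n (zip I K), uword n (zip K J))))"
proof (induction m arbitrary: I J)
  case 0
  let ?U = "T.comb n {[]} (\<lambda>_. 1) (\<lambda>K. (uword n (zip I K), uword n (zip K J)))"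
  have "?U = \<one>\<^bsub>T.M n\<^esub>"
  proof (rule T.carrier_eqI)
    have c: "(uword n (zip I K), uword n (zip K J)) \<in> carrier (Ao n \<times>\<times> Ao n)" if "K \<in> {[]}" for K
      using that by (simp add: uword_Nil)
    show "?U \<in> carrier (T.M n)"
      by (rule T.comb_closed[OF c])
    show "\<one>\<^bsub>T.M n\<^esub> \<in> carrier (T.M n)" by (rule T.one_closed)
    show "lin_ext u (?U) = lin_ext u \<one>\<^bsub>T.M n\<^esub>" for u
      by (subst T.lin_ext_comb[OF _ c]) (simp_all add: uword_Nil T.one_M)
  qed
  moreover have "\<Delta> \<one>\<^bsub>Ao n\<^esub> = \<one>\<^bsub>ST.Q n\<^esub>"
    using \<Delta> by (simp add: is_comultiplication_def unital_star_hom_def cstar_tensor_eq)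
  ultimately show ?case using 0 by (simp add: uword_Nil ST.embed_one)
next
  case (Suc m)
  obtain i I' j J' where ij: "I = i # I'" "J = j # J'" "i \<in> {1..n}" "j \<in> {1..n}"
    and IJ: "I' \<in> words n m" "J' \<in> words n m" using Suc.prems by (auto simp: words_Suc)
  have s1: "set [(k, l)] \<subseteq> {1..n} \<times> {1..n}" if "k \<in> {1..n}" "l \<in> {1..n}" for k l using that by simp
  have s2: "set (zip I' K) \<subseteq> {1..n} \<times> {1..n}" "set (zip K J') \<subseteq> {1..n} \<times> {1..n}" if "K \<in> words n m" for K
    using set_zip_words IJ that by blast+
  have s3: "set (zip I' J') \<subseteq> {1..n} \<times> {1..n}" using set_zip_words[OF IJ] .
  let ?v = "\<lambda>k. (uword n [(i, k)], uword n [(k, j)])"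
  let ?w = "\<lambda>K. (uword n (zip I' K), uword n (zip K J'))"
  let ?V = "T.comb n {1..n} (\<lambda>_. 1) ?v" and ?W = "T.comb n (words n m) (\<lambda>_. 1) ?w"
  let ?U = "T.comb n (words n (Suc m)) (\<lambda>_. 1) (\<lambda>K. (uword n (zip I K), uword n (zip K J)))"
  let ?S = "\<Oplus>\<^bsub>T.M n\<^esub>k\<in>{1..n}. delta (?v k)"
  have vc: "?v k \<in> carrier (Ao n \<times>\<times> Ao n)" if "k \<in> {1..n}" for k
    using that ij s1 by (auto intro!: uword_closed)
  have wc: "?w K \<in> carrier (Ao n \<times>\<times> Ao n)" if "K \<in> words n m" for K
    using s2[OF that] by (auto intro!: uword_closed)
  have "\<Delta> (uword n [(i, j)]) = (\<Oplus>\<^bsub>ST.Q n\<^esub>k\<in>{1..n}. ST.emb n (delta (?v k)))"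
    using \<Delta> ij unfolding is_comultiplication_def cstar_tensor_eq ao_u_eq tens_eq by blast
  also have "\<dots> = ST.emb n ?S"
    using vc by (intro ST.embed_finsum[symmetric] T.delta_closed) auto
  also have "?S = ?V"
  proof (rule T.carrier_eqI)
    show "?S \<in> carrier (T.M n)"
      using vc T.delta_closed by (intro abelian_monoid.finsum_closed ring.is_abelian_group[THEN abelian_group.axioms(1)] ST.ring_axioms) auto
    show "?V \<in> carrier (T.M n)" using vc by (rule T.comb_closed)
    show "lin_ext u ?S = lin_ext u (?V)" for u
      using vc T.delta_closed by (subst T.lin_ext_finsum T.lin_ext_comb; simp)+
  qed
  finally have d1: "\<Delta> (uword n [(i, j)]) = ST.emb n (?V)" .
  have "uword n (zip I J) = uword n [(i, j)] \<otimes>\<^bsub>Ao n\<^esub> uword n (zip I' J')"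
    using uword_append[OF s1[OF ij(3,4)] s3] ij by simp
  then have "\<Delta> (uword n (zip I J)) = \<Delta> (uword n [(i, j)]) \<otimes>\<^bsub>ST.Q n\<^esub> \<Delta> (uword n (zip I' J'))"
    using \<Delta> uword_closed[OF s1[OF ij(3,4)]] uword_closed[OF s3]
    by (simp add: is_comultiplication_def unital_star_hom_def cstar_tensor_eq)
  also have "\<dots> = ST.emb n (?V \<otimes>\<^bsub>T.M n\<^esub> ?W)"
    unfolding d1 Suc.IH[OF IJ] by (intro ST.embed_mult[symmetric] T.comb_closed vc wc)
  also have "?V \<otimes>\<^bsub>T.M n\<^esub> ?W =
    ?U"
  proof (rule T.carrier_eqI)
    have c: "(uword n (zip I K), uword n (zip K J)) \<in> carrier (Ao n \<times>\<times> Ao n)" if "K \<in> words n (Suc m)" for K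
      using set_zip_words[OF Suc.prems(1) that] set_zip_words[OF that Suc.prems(2)] by (auto intro!: uword_closed)
    show "?V \<otimes>\<^bsub>T.M n\<^esub> ?W \<in> carrier (T.M n)"
      by (intro T.mult_closed T.comb_closed vc wc)
    show "?U \<in> carrier (T.M n)"
      by (intro T.comb_closed c)
    fix u
    have "lin_ext u (?V \<otimes>\<^bsub>T.M n\<^esub> ?W) =
      (\<Sum>k\<in>{1..n}. 1 * (\<Sum>K\<in>words n m. 1 * u (?v k \<otimes>\<^bsub>Ao n \<times>\<times> Ao n\<^esub> ?w K)))"
    proof -
      have "?V \<in> carrier (T.M n)" by (rule T.comb_closed[OF vc])
      moreover have "?W \<in> carrier (T.M n)" by (rule T.comb_closed[OF wc])
      moreover have "lin_ext u (?V) = (\<Sum>k\<in>{1..n}. 1 * u (?v k))" for u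
        by (rule T.lin_ext_comb[OF finite_atLeastAtMost vc])
      moreover have "lin_ext u (?W) = (\<Sum>K\<in>words n m. 1 * u (?w K))" for u
        by (rule T.lin_ext_comb[OF finite_words wc])
      ultimately show ?thesis by (simp only: T.lin_ext_mult)
    qed
    also have "\<dots> = (\<Sum>k\<in>{1..n}. \<Sum>K\<in>words n m. u (uword n (zip I (k # K)), uword n (zip (k # K) J)))"
      unfolding mult_1
    proof (intro sum.cong refl)
      fix k K assume k: "k \<in> {1..n}" and K: "K \<in> words n m"
      show "u (?v k \<otimes>\<^bsub>Ao n \<times>\<times> Ao n\<^esub> ?w K) = u (uword n (zip I (k # K)), uword n (zip (k # K) J))"
        using uword_append[OF s1[OF ij(3) k] s2(1)[OF K]] uword_append[OF s1[OF k ij(4)] s2(2)[OF K]] ij by simp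
    qed
    also have "\<dots> = lin_ext u (?U)"
    proof -
      have "lin_ext u (?U) =
        (\<Sum>K\<in>words n (Suc m). 1 * u (uword n (zip I K), uword n (zip K J)))"
        by (rule T.lin_ext_comb[OF finite_words c])
      then show ?thesis by (simp only: mult_1 sum_words_Suc)
    qed
    finally show "lin_ext u (?V \<otimes>\<^bsub>T.M n\<^esub> ?W) =
      lin_ext u (?U)" .
  qed
  finally show ?case .
qed

lemma embed_zero_Ao: "SU.emb n \<zero>\<^bsub>Fn n\<^esub> = \<zero>\<^bsub>Ao n\<^esub>"
  by (simp add: Ao_eq SU.embed_zero)

text \<open>Serves both slice maps of the Haar functional: each sends the elementary tensors in
  question to scalar multiples of monomials.\<close>

lemma linear_map_comb:
  assumes L: "linear_between (ST.Q n) (Ao n) L" and fin: "finite K"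
    and v: "\<And>k. k \<in> K \<Longrightarrow> v k \<in> carrier (Ao n \<times>\<times> Ao n)"
    and w: "\<And>k. k \<in> K \<Longrightarrow> w k \<in> carrier (free_monoid (ao_index n))"
    and Lv: "\<And>k. k \<in> K \<Longrightarrow> L (ST.emb n (delta (v k))) = cscale (Ao n) (c k) (SU.emb n (delta (w k)))"
  shows "L (ST.emb n (T.comb n K (\<lambda>_. 1) v)) = SU.emb n (FM.comb (ao_index n) K c w)"
  using fin v w Lv
proof (induction K rule: finite_induct)
  case empty
  have z: "\<zero>\<^bsub>ST.Q n\<^esub> \<in> carrier (ST.Q n)" by simp
  then have Lz: "L \<zero>\<^bsub>ST.Q n\<^esub> \<in> carrier (Ao n)" using L by (auto simp: linear_between_def)
  \<comment> \<open>\<open>linear_between\<close> does not mention zero; it is reached by scaling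
    with 0.\<close>
  have "L (cscale (ST.Q n) 0 \<zero>\<^bsub>ST.Q n\<^esub>) = cscale (Ao n) 0 (L \<zero>\<^bsub>ST.Q n\<^esub>)"
    using L z unfolding linear_between_def by blast
  then have "L \<zero>\<^bsub>ST.Q n\<^esub> = \<zero>\<^bsub>Ao n\<^esub>" using Lz by (simp add: B.cscale_zero A.cscale_0)
  then show ?case unfolding T.comb_empty FM.comb_empty ST.embed_zero embed_zero_Ao .
next
  case (insert k K)
  have d: "delta (v k) \<in> carrier (T.M n)" "T.comb n K (\<lambda>_. 1) v \<in> carrier (T.M n)"
    using insert.prems by (auto intro!: T.comb_closed simp del: carrier_DirProd)
  have e: "delta (w k) \<in> carrier (Fn n)" "FM.comb (ao_index n) K c w \<in> carrier (Fn n)"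
    using insert.prems by (auto intro!: FM.comb_closed simp del: free_monoid_simps)
  have "T.comb n (insert k K) (\<lambda>_. 1) v = delta (v k) \<oplus>\<^bsub>T.M n\<^esub> T.comb n K (\<lambda>_. 1) v"
    using T.comb_insert[OF insert.hyps(1,2) insert.prems(1)] d by (simp add: ST.cscale_one)
  then have "L (ST.emb n (T.comb n (insert k K) (\<lambda>_. 1) v)) =
     L (ST.emb n (delta (v k)) \<oplus>\<^bsub>ST.Q n\<^esub> ST.emb n (T.comb n K (\<lambda>_. 1) v))"
    using ST.embed_add[OF d] by simp
  also have "\<dots> = L (ST.emb n (delta (v k))) \<oplus>\<^bsub>Ao n\<^esub> L (ST.emb n (T.comb n K (\<lambda>_. 1) v))"
    using L ST.embed_closed[OF d(1)] ST.embed_closed[OF d(2)] unfolding linear_between_def by blast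
  also have "\<dots> = cscale (Ao n) (c k) (SU.emb n (delta (w k))) \<oplus>\<^bsub>Ao n\<^esub> SU.emb n (FM.comb (ao_index n) K c w)"
    using insert by simp
  also have "\<dots> = SU.emb n (cscale (Fn n) (c k) (delta (w k)) \<oplus>\<^bsub>Fn n\<^esub> FM.comb (ao_index n) K c w)"
    unfolding Ao_eq using e by (simp add: SU.embed_cscale SU.embed_add)
  also have "\<dots> = SU.emb n (FM.comb (ao_index n) (insert k K) c w)"
    using FM.comb_insert[OF insert.hyps(1,2) insert.prems(2)] by simp
  finally show ?case .
qed

lemma linear_form_comb:
  assumes h: "linear_form (Ao n) h" and fin: "finite K"
    and w: "\<And>k. k \<in> K \<Longrightarrow> w k \<in> carrier (free_monoid (ao_index n))"
  shows "h (SU.emb n (FM.comb (ao_index n) K c w)) = (\<Sum>k\<in>K. c k * h (SU.emb n (delta (w k))))"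
  using fin w
proof (induction K rule: finite_induct)
  case empty
  have "h (cscale (Ao n) 0 \<zero>\<^bsub>Ao n\<^esub>) = 0 * h \<zero>\<^bsub>Ao n\<^esub>" using h A.zero_closed unfolding linear_form_def by blast
  then have "h \<zero>\<^bsub>Ao n\<^esub> = 0" by (simp add: A.cscale_zero)
  then show ?case by (simp add: FM.comb_empty embed_zero_Ao)
next
  case (insert k K)
  have e: "delta (w k) \<in> carrier (Fn n)" "FM.comb (ao_index n) K c w \<in> carrier (Fn n)"
    using insert.prems by (auto intro!: FM.comb_closed simp del: free_monoid_simps)
  have e': "SU.emb n (delta (w k)) \<in> carrier (Ao n)" "SU.emb n (FM.comb (ao_index n) K c w) \<in> carrier (Ao n)"
    unfolding Ao_eq using e by auto
  have "SU.emb n (FM.comb (ao_index n) (insert k K) c w) =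
     cscale (Ao n) (c k) (SU.emb n (delta (w k))) \<oplus>\<^bsub>Ao n\<^esub> SU.emb n (FM.comb (ao_index n) K c w)"
    unfolding Ao_eq using FM.comb_insert[OF insert.hyps(1,2) insert.prems] e
    by (simp add: SU.embed_cscale SU.embed_add)
  then have "h (SU.emb n (FM.comb (ao_index n) (insert k K) c w)) =
     c k * h (SU.emb n (delta (w k))) + h (SU.emb n (FM.comb (ao_index n) K c w))"
    using h e' A.cscale_closed[OF e'(1)] unfolding linear_form_def by simp
  then show ?case using insert by simp
qed

text \<open>Elements with equal images in \<open>Ao n\<close> have a difference of universal
  seminorm 0, and the seminorm of the representation belongs to the family of which this is the
  supremum.\<close>

lemma embed_eq_rep:
  assumes m: "orth_rep n Y m" and xy: "x \<in> Y" "y \<in> Y"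
    and f: "f \<in> carrier (Fn n)" and g: "g \<in> carrier (Fn n)" and fg: "SU.emb n f = SU.emb n g"
  shows "rep_matrix Y m f x y = rep_matrix Y m g x y"
proof -
  have Y: "finite Y" using m by (simp add: orth_rep_def)
  have d: "diff (Fn n) f g \<in> carrier (Fn n)" using f g by (simp add: SU.diff_eq)
  have "ao_norm n (diff (Fn n) f g) = 0" using SU.embed_eq_iff[OF f g] fg f g by (simp add: SU.diff_eq)
  then have "rep_seminorm Y m (diff (Fn n) f g) \<le> 0"
    using family_le_ao_norm[OF rep_in_family[OF m] d] by simp
  then have "rep_seminorm Y m (diff (Fn n) f g) = 0"
    using opnorm_nonneg[OF Y] unfolding rep_seminorm_def by (simp add: order_antisym)
  then show ?thesis using xy f g unfolding rep_seminorm_eq_0_iff[OF Y] rep_matrix_def by (simp add: lin_ext_diff)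
qed

section \<open>Haar moments as fixed tensors\<close>

context
  fixes n :: nat and h :: "ao_elem \<Rightarrow> complex"
  assumes haar: "haar_functional n h"
begin

definition moment :: "(nat \<times> nat) list \<Rightarrow> complex" where
  "moment w = h (uword n w)"

lemma linear: "linear_form (Ao n) h"
  using haar by (simp add: haar_functional_def)

lemma moment_Nil: "moment [] = 1"
  using haar by (simp add: haar_functional_def moment_def uword_Nil)

text \<open>The two invariance axioms at the monomial of \<open>zip I J\<close>. Both sides are
  written as images of elements of the free algebra, the form that \<open>embed_eq_rep\<close> can
  evaluate.\<close>

lemma invariance:
  assumes IJ: "I \<in> words n m" "J \<in> words n m"
  shows "SU.emb n (FM.comb (ao_index n) (words n m) (\<lambda>K. moment (zip K J)) (\<lambda>K. letters (zip I K))) =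
      SU.emb n (cscale (Fn n) (moment (zip I J)) (delta []))"
    and "SU.emb n (FM.comb (ao_index n) (words n m) (\<lambda>K. moment (zip I K)) (\<lambda>K. letters (zip K J))) =
      SU.emb n (cscale (Fn n) (moment (zip I J)) (delta []))"
proof -
  let ?l = "SU.emb n (FM.comb (ao_index n) (words n m) (\<lambda>K. moment (zip K J)) (\<lambda>K. letters (zip I K)))"
    and ?l' = "SU.emb n (FM.comb (ao_index n) (words n m) (\<lambda>K. moment (zip I K)) (\<lambda>K. letters (zip K J)))"
    and ?r = "SU.emb n (cscale (Fn n) (moment (zip I J)) (delta []))"
  obtain \<Delta> E E' where \<Delta>: "is_comultiplication n \<Delta>" and E: "is_id_tensor_form (Ao n) h E"
    and E': "is_form_tensor_id (Ao n) h E'"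
    and inv: "\<And>a. a \<in> carrier (Ao n) \<Longrightarrow> E (\<Delta> a) = cscale (Ao n) (h a) \<one>\<^bsub>Ao n\<^esub>"
      "\<And>a. a \<in> carrier (Ao n) \<Longrightarrow> E' (\<Delta> a) = cscale (Ao n) (h a) \<one>\<^bsub>Ao n\<^esub>"
    using haar unfolding haar_functional_def by blast
  have zc: "set (zip I K) \<subseteq> {1..n} \<times> {1..n}" "set (zip K J) \<subseteq> {1..n} \<times> {1..n}" if "K \<in> words n m" for K
    using set_zip_words IJ that by blast+
  have uc: "uword n (zip I K) \<in> carrier (Ao n)" "uword n (zip K J) \<in> carrier (Ao n)" if "K \<in> words n m" for K
    using zc[OF that] by (auto intro!: uword_closed)
  have one: "cscale (Ao n) (h (uword n (zip I J))) \<one>\<^bsub>Ao n\<^esub> = ?r"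
  proof -
    have "delta [] = \<one>\<^bsub>Fn n\<^esub>" by (simp add: FM.one_M)
    then show ?thesis unfolding moment_def Ao_eq by (simp add: SU.embed_cscale SU.embed_one)
  qed
  have "E (\<Delta> (uword n (zip I J))) = ?l"
    unfolding comultiplication_uword[OF \<Delta> IJ]
  proof (rule linear_map_comb)
    show "linear_between (ST.Q n) (Ao n) E" using E by (simp add: is_id_tensor_form_def cstar_tensor_eq)
    fix K assume K: "K \<in> words n m"
    show "(uword n (zip I K), uword n (zip K J)) \<in> carrier (Ao n \<times>\<times> Ao n)" using uc[OF K] by simp
    show "letters (zip I K) \<in> carrier (free_monoid (ao_index n))" by (rule letters_carrier[OF zc(1)[OF K]])
    show "E (ST.emb n (delta (uword n (zip I K), uword n (zip K J)))) =
         cscale (Ao n) (moment (zip K J)) (SU.emb n (delta (letters (zip I K))))"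
      using E uc[OF K] unfolding is_id_tensor_form_def tens_eq moment_def uword_def[symmetric] by blast
  qed simp
  then show "?l = ?r"
    using inv(1)[OF uc(1)[OF IJ(2)]] one by simp
  have "E' (\<Delta> (uword n (zip I J))) = ?l'"
    unfolding comultiplication_uword[OF \<Delta> IJ]
  proof (rule linear_map_comb)
    show "linear_between (ST.Q n) (Ao n) E'" using E' by (simp add: is_form_tensor_id_def cstar_tensor_eq)
    fix K assume K: "K \<in> words n m"
    show "(uword n (zip I K), uword n (zip K J)) \<in> carrier (Ao n \<times>\<times> Ao n)" using uc[OF K] by simp
    show "letters (zip K J) \<in> carrier (free_monoid (ao_index n))" by (rule letters_carrier[OF zc(2)[OF K]])
    show "E' (ST.emb n (delta (uword n (zip I K), uword n (zip K J)))) =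
         cscale (Ao n) (moment (zip I K)) (SU.emb n (delta (letters (zip K J))))"
      using E' uc[OF K] unfolding is_form_tensor_id_def tens_eq moment_def uword_def[symmetric] by blast
  qed simp
  then show "?l' = ?r"
    using inv(2)[OF uc(1)[OF IJ(2)]] one by simp
qed

lemma rep_comb:
  assumes "finite K" "\<And>k. k \<in> K \<Longrightarrow> set (w k) \<subseteq> {1..n} \<times> {1..n}"
  shows "rep_matrix Y m (FM.comb (ao_index n) K c (\<lambda>k. letters (w k))) x y = (\<Sum>k\<in>K. c k * mword Y m (w k) x y)"
  unfolding rep_matrix_def using assms by (subst FM.lin_ext_comb) (auto simp: letters_carrier o_def simp del: free_monoid_simps)

text \<open>Evaluated in a representation, invariance says that the moments form a fixed tensor in
  the row word and, from the other side, in the column word.\<close>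

lemma moment_rep:
  assumes m': "orth_rep n Y m'" and xy: "x \<in> Y" "y \<in> Y" and IJ: "I \<in> words n m" "J \<in> words n m"
  shows "(\<Sum>K\<in>words n m. moment (zip K J) * mword Y m' (zip I K) x y) = (if x = y then moment (zip I J) else 0)"
    and "(\<Sum>K\<in>words n m. moment (zip I K) * mword Y m' (zip K J) x y) = (if x = y then moment (zip I J) else 0)"
proof -
  have zc: "set (zip I K) \<subseteq> {1..n} \<times> {1..n}" "set (zip K J) \<subseteq> {1..n} \<times> {1..n}" if "K \<in> words n m" for K
    using set_zip_words IJ that by blast+
  have one: "rep_matrix Y m' (cscale (Fn n) c (delta [])) x y = (if x = y then c else 0)" for c
    by (simp add: rep_matrix_def FM.lin_ext_cscale)
  have oc: "cscale (Fn n) c (delta []) \<in> carrier (Fn n)" for c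
    by (intro FM.cscale_closed FM.delta_closed) simp
  have cc: "FM.comb (ao_index n) (words n m) c (\<lambda>K. letters (zip I K)) \<in> carrier (Fn n)"
      "FM.comb (ao_index n) (words n m) c (\<lambda>K. letters (zip K J)) \<in> carrier (Fn n)" for c
    by (intro FM.comb_closed letters_carrier zc; assumption)+
  show "(\<Sum>K\<in>words n m. moment (zip K J) * mword Y m' (zip I K) x y) = (if x = y then moment (zip I J) else 0)"
    using embed_eq_rep[OF m' xy cc(1) oc invariance(1)[OF IJ]] by (simp only: rep_comb[OF finite_words zc(1)] one)
  show "(\<Sum>K\<in>words n m. moment (zip I K) * mword Y m' (zip K J) x y) = (if x = y then moment (zip I J) else 0)"
    using embed_eq_rep[OF m' xy cc(2) oc invariance(2)[OF IJ]] by (simp only: rep_comb[OF finite_words zc(2)] one)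
qed

text \<open>The row relation holds in \<open>Ao n\<close> and may be multiplied by monomials on both
  sides before \<open>h\<close> is applied.\<close>

lemma moment_contracts: "contracts n moment"
  unfolding contracts_def
proof (intro allI ballI impI)
  fix v w i t assume it: "i \<in> {1..n}" "t \<in> {1..n}"
    and v: "set v \<subseteq> {1..n} \<times> {1..n}" and w: "set w \<subseteq> {1..n} \<times> {1..n}"
  let ?s = "\<Oplus>\<^bsub>Fn n\<^esub>k\<in>{1..n}. gen i k \<otimes>\<^bsub>Fn n\<^esub> gen t k"
  let ?d = "if i = t then \<one>\<^bsub>Fn n\<^esub> else \<zero>\<^bsub>Fn n\<^esub>"
  let ?c = "FM.comb (ao_index n) {1..n} (\<lambda>_. 1) (\<lambda>k. letters (v @ (i, k) # (t, k) # w))"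
  let ?dv = "delta (letters v)" and ?dw = "delta (letters w)"
  have c: "?dv \<in> carrier (Fn n)" "?dw \<in> carrier (Fn n)" "?d \<in> carrier (Fn n)"
    using v w by (auto intro!: FM.delta_closed letters_carrier simp: FM.zero_closed FM.one_closed simp del: free_monoid_simps)
  have s: "?s \<in> carrier (Fn n)" using it by (intro gen_sum_closed conjI gen_closed)
  have k: "set (v @ (i, k) # (t, k) # w) \<subseteq> {1..n} \<times> {1..n}" if "k \<in> {1..n}" for k using it that v w by auto
  have "ao_norm n (diff (Fn n) ?s ?d) = 0" using it by (intro ao_norm_null) (auto simp: ao_relations_eq)
  then have sd: "SU.emb n ?s = SU.emb n ?d" using s c(3) by (simp add: SU.embed_eq_iff SU.diff_eq)
  have "SU.emb n (?dv \<otimes>\<^bsub>Fn n\<^esub> ?s \<otimes>\<^bsub>Fn n\<^esub> ?dw) = SU.emb n (?dv \<otimes>\<^bsub>Fn n\<^esub> ?d \<otimes>\<^bsub>Fn n\<^esub> ?dw)"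
    using s c sd by (simp only: SU.embed_mult SU.m_closed)
  also have "?dv \<otimes>\<^bsub>Fn n\<^esub> ?d \<otimes>\<^bsub>Fn n\<^esub> ?dw = (if i = t then delta (letters (v @ w)) else \<zero>\<^bsub>Fn n\<^esub>)"
    using c FM.delta_mult[OF letters_carrier[OF v] letters_carrier[OF w]] by simp
  also have "?dv \<otimes>\<^bsub>Fn n\<^esub> ?s \<otimes>\<^bsub>Fn n\<^esub> ?dw = ?c"
  proof (rule FM.carrier_eqI)
    show "?dv \<otimes>\<^bsub>Fn n\<^esub> ?s \<otimes>\<^bsub>Fn n\<^esub> ?dw \<in> carrier (Fn n)" using s c by simp
    show "?c \<in> carrier (Fn n)"
      by (intro FM.comb_closed letters_carrier k)
    fix u
    have "lin_ext u (?dv \<otimes>\<^bsub>Fn n\<^esub> ?s \<otimes>\<^bsub>Fn n\<^esub> ?dw) = lin_ext (\<lambda>y. u (letters v @ y @ letters w)) ?s"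
      using s c by (simp add: FM.lin_ext_mult)
    also have "\<dots> = (\<Sum>k\<in>{1..n}. lin_ext (\<lambda>y. u (letters v @ y @ letters w)) (gen i k \<otimes>\<^bsub>Fn n\<^esub> gen t k))"
      using it by (intro FM.lin_ext_finsum FM.mult_closed gen_closed) auto
    also have "\<dots> = (\<Sum>k\<in>{1..n}. 1 * u (letters (v @ (i, k) # (t, k) # w)))"
      using it by (intro sum.cong refl) (simp add: gen_products)
    also have "\<dots> = lin_ext u (?c)"
      by (intro FM.lin_ext_comb[symmetric] letters_carrier k) auto
    finally show "lin_ext u (?dv \<otimes>\<^bsub>Fn n\<^esub> ?s \<otimes>\<^bsub>Fn n\<^esub> ?dw) =
      lin_ext u (?c)" .
  qed
  finally have eq: "SU.emb n (?c) =
     SU.emb n (if i = t then delta (letters (v @ w)) else \<zero>\<^bsub>Fn n\<^esub>)" .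
  have z: "h (SU.emb n \<zero>\<^bsub>Fn n\<^esub>) = 0"
    using linear_form_comb[OF linear, of "{}"] by (simp add: FM.comb_empty)
  have "(\<Sum>j=1..n. moment (v @ (i, j) # (t, j) # w)) =
     h (SU.emb n (?c))"
  proof -
    have "h (SU.emb n (?c)) =
      (\<Sum>k\<in>{1..n}. 1 * h (SU.emb n (delta (letters (v @ (i, k) # (t, k) # w)))))"
      by (rule linear_form_comb[OF linear finite_atLeastAtMost letters_carrier[OF k]])
    then show ?thesis by (simp only: mult_1 moment_def uword_def)
  qed
  then show "(\<Sum>j=1..n. moment (v @ (i, j) # (t, j) # w)) = (if i = t then moment (v @ w) else 0)"
    unfolding eq using z by (simp add: moment_def uword_def)
qed

text \<open>Expanding the power of the sum of diagonal generators produces the monomials with equal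
  row and column words; the scalar is carried along inside the combination.\<close>

lemma power_trace:
  assumes s: "s \<le> n"
  shows "cscale (Ao n) c (ao_o s n) [^]\<^bsub>Ao n\<^esub> (m::nat) =
    SU.emb n (FM.comb (ao_index n) (words s m) (\<lambda>_. c ^ m) (\<lambda>I. letters (zip I I)))"
proof -
  let ?o = "FM.comb (ao_index n) {1..s} (\<lambda>_. c) (\<lambda>i. letters [(i, i)])" and ?g = "(\<Oplus>\<^bsub>Fn n\<^esub>i\<in>{1..s}. gen i i)"
  let ?w = "\<lambda>m. FM.comb (ao_index n) (words s m) (\<lambda>_. c ^ m) (\<lambda>I. letters (zip I I))"
  have zc: "set (zip I I) \<subseteq> {1..n} \<times> {1..n}" if "I \<in> words s m" for I m
    using that s set_zip_words[of I n m I m] by (force simp: words_def)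
  have k: "set [(i, i)] \<subseteq> {1..n} \<times> {1..n}" if "i \<in> {1..s}" for i using that s by auto
  have "ao_o s n = SU.emb n ?g"
    unfolding ao_o_def ao_u_eq uword_def Ao_eq using s by (subst SU.embed_finsum) (auto intro!: gen_closed)
  moreover have sc: "?g \<in> carrier (Fn n)"
    using s by (intro SU.finsum_closed) (auto intro!: gen_closed)
  ultimately have "cscale (Ao n) c (ao_o s n) = SU.emb n (cscale (Fn n) c ?g)"
    unfolding Ao_eq by (simp add: SU.embed_cscale)
  also have "cscale (Fn n) c ?g = ?o"
  proof (rule FM.carrier_eqI)
    show "?o \<in> carrier (Fn n)"
      by (intro FM.comb_closed letters_carrier k)
    show "cscale (Fn n) c ?g \<in> carrier (Fn n)" using sc by simp
    fix u
    have "lin_ext u (cscale (Fn n) c ?g) = c * (\<Sum>i\<in>{1..s}. lin_ext u (gen i i))"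
      unfolding FM.lin_ext_cscale using s by (subst FM.lin_ext_finsum) (auto intro!: gen_closed)
    also have "\<dots> = (\<Sum>i\<in>{1..s}. c * u (letters [(i, i)]))" by (simp add: sum_distrib_left)
    also have "\<dots> = lin_ext u (?o)"
      by (intro FM.lin_ext_comb[symmetric] letters_carrier k) auto
    finally show "lin_ext u (cscale (Fn n) c ?g) =
       lin_ext u (?o)" .
  qed
  finally have o: "cscale (Ao n) c (ao_o s n) = SU.emb n (?o)" .
  have cc: "?o \<in> carrier (Fn n)"
    by (intro FM.comb_closed letters_carrier k)
  have oc: "cscale (Ao n) c (ao_o s n) \<in> carrier (Ao n)" unfolding o unfolding Ao_eq using cc by simp
  show ?thesis
  proof (induction m)
    case 0
    have "FM.comb (ao_index n) {[]} (\<lambda>_. 1) (\<lambda>I. letters (zip I I)) = \<one>\<^bsub>Fn n\<^esub>"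
    proof (rule FM.carrier_eqI)
      show "FM.comb (ao_index n) {[]} (\<lambda>_. 1) (\<lambda>I. letters (zip I I)) \<in> carrier (Fn n)"
        by (intro FM.comb_closed) auto
      show "lin_ext u (FM.comb (ao_index n) {[]} (\<lambda>_. 1) (\<lambda>I. letters (zip I I))) = lin_ext u \<one>\<^bsub>Fn n\<^esub>" for u
        by (subst FM.lin_ext_comb) (auto simp: FM.one_M)
    qed (rule FM.one_closed)
    then show ?case by (simp add: SU.embed_one Ao_eq)
  next
    case (Suc m)
    have wc: "?w m \<in> carrier (Fn n)" for m
      by (intro FM.comb_closed letters_carrier zc)
    have "cscale (Ao n) c (ao_o s n) [^]\<^bsub>Ao n\<^esub> Suc m =
        cscale (Ao n) c (ao_o s n) \<otimes>\<^bsub>Ao n\<^esub> cscale (Ao n) c (ao_o s n) [^]\<^bsub>Ao n\<^esub> m"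
      by (rule A.nat_pow_Suc2[OF oc])
    also have "\<dots> = SU.emb n (?o \<otimes>\<^bsub>Fn n\<^esub>
         ?w m)"
      unfolding Suc.IH unfolding o unfolding Ao_eq by (rule SU.embed_mult[OF cc wc, symmetric])
    also have "?o \<otimes>\<^bsub>Fn n\<^esub>
         ?w m =
       ?w (Suc m)"
    proof (rule FM.carrier_eqI)
      fix u
      have "lin_ext u (?o \<otimes>\<^bsub>Fn n\<^esub>
         ?w m) =
        (\<Sum>i\<in>{1..s}. c * (\<Sum>I\<in>words s m. c ^ m * u (letters [(i, i)] @ letters (zip I I))))"
      proof -
        have "lin_ext u (?o) = (\<Sum>i\<in>{1..s}. c * u (letters [(i, i)]))" for u
          by (rule FM.lin_ext_comb[OF finite_atLeastAtMost letters_carrier[OF k]])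
        moreover have "lin_ext u (?w m) =
            (\<Sum>I\<in>words s m. c ^ m * u (letters (zip I I)))" for u
          by (rule FM.lin_ext_comb[OF finite_words letters_carrier[OF zc]])
        ultimately show ?thesis by (simp only: FM.lin_ext_mult[OF cc wc] free_monoid_simps)
      qed
      also have "\<dots> = (\<Sum>I\<in>words s (Suc m). c ^ Suc m * u (letters (zip I I)))"
        by (simp add: sum_words_Suc sum_distrib_left mult.assoc)
      also have "\<dots> = lin_ext u (?w (Suc m))"
        by (rule FM.lin_ext_comb[OF finite_words letters_carrier[OF zc], symmetric])
      finally show "lin_ext u (?o \<otimes>\<^bsub>Fn n\<^esub>
         ?w m) =
        lin_ext u (?w (Suc m))" .
    qed (rule FM.mult_closed[OF cc wc], rule wc)
    finally show ?case .
  qed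
qed

lemma haar_power_trace:
  assumes s: "s \<le> n"
  shows "h (cscale (Ao n) c (ao_o s n) [^]\<^bsub>Ao n\<^esub> (m::nat)) = c ^ m * (\<Sum>I\<in>words s m. moment (zip I I))"
proof -
  have zc: "set (zip I I) \<subseteq> {1..n} \<times> {1..n}" if "I \<in> words s m" for I
    using that s set_zip_words[of I n m I m] by (force simp: words_def)
  have "h (SU.emb n (FM.comb (ao_index n) (words s m) (\<lambda>_. c ^ m) (\<lambda>I. letters (zip I I)))) =
     (\<Sum>I\<in>words s m. c ^ m * h (SU.emb n (delta (letters (zip I I)))))"
    by (intro linear_form_comb linear letters_carrier zc) auto
  then show ?thesis unfolding power_trace[OF s] by (simp add: moment_def uword_def sum_distrib_left)
qed

end

section \<open>Two representations and the conclusion\<close>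

lemma orth_rep_scalar:
  assumes "orth n R"
  shows "orth_rep n {()} (\<lambda>(i, j) _ _. of_real (R i j))"
proof -
  have "(\<Sum>k=1..n. complex_of_real (R i k) * of_real (R j k)) = (if i = j then 1 else 0)"
    "(\<Sum>k=1..n. complex_of_real (R k i) * of_real (R k j)) = (if i = j then 1 else 0)"
    if "i \<in> {1..n}" "j \<in> {1..n}" for i j
  proof -
    have "(\<Sum>k=1..n. R i k * R j k) = (if i = j then 1 else 0)" "(\<Sum>k=1..n. R k i * R k j) = (if i = j then 1 else 0)"
      using assms that unfolding orth_def by blast+
    then show "(\<Sum>k=1..n. complex_of_real (R i k) * of_real (R j k)) = (if i = j then 1 else 0)"
      "(\<Sum>k=1..n. complex_of_real (R k i) * of_real (R k j)) = (if i = j then 1 else 0)"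
      unfolding of_real_mult[symmetric] of_real_sum[symmetric] by simp_all
  qed
  then show ?thesis unfolding orth_rep_def by simp
qed

lemma mword_scalar: "mword {()} (\<lambda>(i, j) _ _. of_real (R i j)) w x y = of_real (weight R w)"
proof (induction w arbitrary: x)
  case (Cons g w)
  then show ?case by (cases g) simp
qed simp

text \<open>In the second identity of \<open>moment_rep\<close> the summation word \<open>K\<close>
  is the row word of the matrix entries; transposing restores the form required by
  \<open>invariant\<close>.\<close>

lemma orth_transpose: "orth n R \<Longrightarrow> orth n (\<lambda>i j. R j i)"
  by (auto simp: orth_def)

lemma weight_transpose: "length K = length J \<Longrightarrow> weight (\<lambda>i j. R j i) (zip K J) = weight R (zip J K)"
  by (induction K J rule: list_induct2) auto

text \<open>The ball of radius \<open>m\<close> in the Cayley graph of the free product of copies of the group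
  of order two. The generator \<open>i\<close> acts by \<open>trunc m i\<close>, that is, by multiplication, except that
  it fixes the words that it would move out of the ball.\<close>

definition ball_words :: "nat \<Rightarrow> nat \<Rightarrow> nat list set" where
  "ball_words n m = {y. set y \<subseteq> {1..n} \<and> length y \<le> m \<and> distinct_adj y}"

definition trunc :: "nat \<Rightarrow> nat \<Rightarrow> nat list \<Rightarrow> nat list" where
  "trunc m i y = (if y \<noteq> [] \<and> hd y = i then tl y else if length y < m then i # y else y)"

lemma finite_ball_words: "finite (ball_words n m)"
proof -
  have "ball_words n m \<subseteq> {y. set y \<subseteq> {1..n} \<and> length y \<le> m}" by (auto simp: ball_words_def)
  then show ?thesis by (rule finite_subset) (simp add: finite_lists_length_le)
qed

lemma trunc_closed: "i \<in> {1..n} \<Longrightarrow> y \<in> ball_words n m \<Longrightarrow> trunc m i y \<in> ball_words n m"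
  by (cases y) (auto simp: ball_words_def trunc_def distinct_adj_Cons)

text \<open>A word starting with \<open>i\<close> loses it and gets it back, as its tail is shorter
  than \<open>m\<close> and does not start with \<open>i\<close>; a word of full length not starting
  with \<open>i\<close> stays fixed.\<close>

lemma trunc_trunc: "y \<in> ball_words n m \<Longrightarrow> trunc m i (trunc m i y) = y"
  by (cases y; cases "tl y") (auto simp: ball_words_def trunc_def)

text \<open>Each letter lengthens the word by at most one, so the boundary of the ball is never
  felt.\<close>

lemma fold_trunc_reduce: "length y + length I \<le> m \<Longrightarrow> fold (trunc m) I y = fold reduce I y"
proof (induction I arbitrary: y)
  case (Cons i I)
  then have "trunc m i y = reduce i y" "length (reduce i y) \<le> Suc (length y)" by (auto simp: trunc_def reduce_def)
  then show ?case using Cons by simp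
qed simp

definition tree_rep :: "nat \<Rightarrow> nat \<times> nat \<Rightarrow> nat list \<Rightarrow> nat list \<Rightarrow> complex" where
  "tree_rep m = (\<lambda>(i, j) x y. if i = j \<and> y = trunc m i x then 1 else 0)"

text \<open>As an involution, \<open>trunc m i\<close> has a hermitian matrix with square 1, and a
  diagonal matrix of such operators satisfies the relations.\<close>

lemma orth_rep_tree: "orth_rep n (ball_words n m) (tree_rep m)"
proof -
  let ?Y = "ball_words n m"
  have sym: "y = trunc m i x \<longleftrightarrow> x = trunc m i y" if "x \<in> ?Y" "y \<in> ?Y" for x y i
    using trunc_trunc[OF that(1), of i] trunc_trunc[OF that(2), of i] by metis
  have inner: "(\<Sum>z\<in>?Y. tree_rep m (i, k) x z * tree_rep m (j, l) z y) = (if i = k \<and> j = l \<and> y = trunc m j (trunc m i x) then 1 else 0)"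
    if "x \<in> ?Y" "i \<in> {1..n}" for x y i j k l
  proof -
    have "(\<Sum>z\<in>?Y. tree_rep m (i, k) x z * tree_rep m (j, l) z y) =
       (\<Sum>z\<in>?Y. if z = trunc m i x then (if i = k \<and> j = l \<and> y = trunc m j (trunc m i x) then 1 else 0) else 0)"
      by (intro sum.cong) (auto simp: tree_rep_def)
    then show ?thesis using trunc_closed[OF that(2,1)] finite_ball_words by simp
  qed
  have row: "(\<Sum>k=1..n. \<Sum>z\<in>?Y. tree_rep m (i, k) x z * tree_rep m (j, k) z y) = (if i = j \<and> x = y then 1 else 0)"
    if "x \<in> ?Y" "i \<in> {1..n}" for x y i j
  proof -
    have "(\<Sum>k=1..n. \<Sum>z\<in>?Y. tree_rep m (i, k) x z * tree_rep m (j, k) z y) =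
      (\<Sum>k=1..n. if k = i then (if i = j \<and> x = y then 1 else 0) else 0)"
      using trunc_trunc[OF that(1), of i] by (intro sum.cong refl) (auto simp: inner[OF that])
    then show ?thesis using that by simp
  qed
  have col: "(\<Sum>k=1..n. \<Sum>z\<in>?Y. tree_rep m (k, i) x z * tree_rep m (k, j) z y) = (if i = j \<and> x = y then 1 else 0)"
    if "x \<in> ?Y" "i \<in> {1..n}" for x y i j
  proof -
    have "(\<Sum>k=1..n. \<Sum>z\<in>?Y. tree_rep m (k, i) x z * tree_rep m (k, j) z y) =
      (\<Sum>k=1..n. if k = i then (if i = j \<and> x = y then 1 else 0) else 0)"
      using trunc_trunc[OF that(1), of i] by (intro sum.cong refl) (auto simp: inner[OF that(1)])
    then show ?thesis using that by simp
  qed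
  have "tree_rep m g x y = cnj (tree_rep m g y x)" if "x \<in> ?Y" "y \<in> ?Y" for g x y
    using sym[OF that] by (cases g) (auto simp: tree_rep_def)
  then show ?thesis unfolding orth_rep_def using finite_ball_words row col by blast
qed

text \<open>Generators off the diagonal act as 0, so only \<open>K = I\<close> survives. The letters
  move the row index from left to right, hence \<open>fold\<close>.\<close>

lemma mword_tree:
  assumes "length I = length K" "set I \<subseteq> {1..n}" "x \<in> ball_words n m"
  shows "mword (ball_words n m) (tree_rep m) (zip I K) x y = (if I = K \<and> y = fold (trunc m) I x then 1 else 0)"
  using assms
proof (induction I K arbitrary: x rule: list_induct2)
  case (Cons i I k K)
  have t: "trunc m i x \<in> ball_words n m" using Cons.prems trunc_closed by simp
  have "mword (ball_words n m) (tree_rep m) (zip (i # I) (k # K)) x y =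
    (\<Sum>z\<in>ball_words n m. if z = trunc m i x then (if i = k then mword (ball_words n m) (tree_rep m) (zip I K) z y else 0) else 0)"
    by (auto simp: tree_rep_def intro!: sum.cong)
  also have "\<dots> = (if i = k then mword (ball_words n m) (tree_rep m) (zip I K) (trunc m i x) y else 0)"
    using t finite_ball_words by simp
  finally show ?case using Cons t by auto
qed auto

lemma fold_trunc_closed:
  "set I \<subseteq> {1..n} \<Longrightarrow> y \<in> ball_words n m \<Longrightarrow> fold (trunc m) I y \<in> ball_words n m"
  by (induction I arbitrary: y) (auto simp: trunc_closed)

context
  fixes n :: nat and h :: "ao_elem \<Rightarrow> complex"
  assumes haar: "haar_functional n h"
begin

lemma moment_invariant_left:
  assumes J: "J \<in> words n m"
  shows "invariant n m (\<lambda>I. moment n h (zip I J))"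
  unfolding invariant_def
proof (intro allI impI ballI)
  fix R I assume R: "orth n R" and I: "I \<in> words n m"
  show "(\<Sum>K\<in>words n m. of_real (weight R (zip I K)) * moment n h (zip K J)) = moment n h (zip I J)"
    using moment_rep(1)[OF haar orth_rep_scalar[OF R] _ _ I J, of "()" "()"]
    by (simp add: mword_scalar mult.commute)
qed

lemma moment_invariant_right:
  assumes I: "I \<in> words n m"
  shows "invariant n m (\<lambda>J. moment n h (zip I J))"
  unfolding invariant_def
proof (intro allI impI ballI)
  fix R J assume R: "orth n R" and J: "J \<in> words n m"
  have "(\<Sum>K\<in>words n m. moment n h (zip I K) * of_real (weight (\<lambda>i j. R j i) (zip K J))) = moment n h (zip I J)"
    using moment_rep(2)[OF haar orth_rep_scalar[OF orth_transpose[OF R]] _ _ I J, of "()" "()"]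
    by (simp add: mword_scalar)
  moreover have "weight (\<lambda>i j. R j i) (zip K J) = weight R (zip J K)" if "K \<in> words n m" for K
    using that J by (intro weight_transpose) (simp add: words_def)
  ultimately show "(\<Sum>K\<in>words n m. of_real (weight R (zip J K)) * moment n h (zip I K)) = moment n h (zip I J)"
    by (simp add: mult.commute)
qed

text \<open>Invariance is read at the matrix entry from \<open>[]\<close> to the point that the word
  reaches from \<open>[]\<close>. Without a noncrossing pairing this point is not \<open>[]\<close>,
  so the entry is off the diagonal and the right side of \<open>moment_rep\<close> is 0, while on
  the left only the moment of \<open>zip I J\<close> remains.\<close>

lemma moment_eq_0:
  assumes IJ: "I \<in> words n m" "J \<in> words n m"
  shows "\<nexists>d. nc d [] I \<Longrightarrow> moment n h (zip I J) = 0" "\<nexists>d. nc d [] J \<Longrightarrow> moment n h (zip I J) = 0"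
proof -
  let ?Y = "ball_words n m"
  have e: "[] \<in> ?Y" by (simp add: ball_words_def)
  have y: "fold (trunc m) L [] \<in> ?Y" if "L \<in> words n m" for L
    using that e by (intro fold_trunc_closed) (auto simp: words_def)
  have yr: "fold (trunc m) L [] \<noteq> []" if "L \<in> words n m" "\<nexists>d. nc d [] L" for L
    using that reduce_nc[of L "[]"] fold_trunc_reduce[of "[]" L m] by (auto simp: words_def)
  show "moment n h (zip I J) = 0" if no: "\<nexists>d. nc d [] I"
  proof -
    have "(\<Sum>K\<in>words n m. moment n h (zip K J) * mword ?Y (tree_rep m) (zip I K) [] (fold (trunc m) I [])) = 0"
      using moment_rep(1)[OF haar orth_rep_tree e y[OF IJ(1)] IJ] yr[OF IJ(1) no] by simp
    also have "(\<Sum>K\<in>words n m. moment n h (zip K J) * mword ?Y (tree_rep m) (zip I K) [] (fold (trunc m) I [])) =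
      (\<Sum>K\<in>words n m. if K = I then moment n h (zip I J) else 0)"
      using IJ e by (intro sum.cong refl, subst mword_tree) (auto simp: words_def)
    finally show ?thesis using IJ by simp
  qed
  show "moment n h (zip I J) = 0" if no: "\<nexists>d. nc d [] J"
  proof -
    have "(\<Sum>K\<in>words n m. moment n h (zip I K) * mword ?Y (tree_rep m) (zip K J) [] (fold (trunc m) J [])) = 0"
      using moment_rep(2)[OF haar orth_rep_tree e y[OF IJ(2)] IJ] yr[OF IJ(2) no] by simp
    also have "(\<Sum>K\<in>words n m. moment n h (zip I K) * mword ?Y (tree_rep m) (zip K J) [] (fold (trunc m) J [])) =
      (\<Sum>K\<in>words n m. if K = J then moment n h (zip I J) else 0)"
      using IJ e by (intro sum.cong refl, subst mword_tree) (auto simp: words_def)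
    finally show ?thesis using IJ by simp
  qed
qed

end

theorem corollary5p2:
  fixes s :: nat and haar :: "nat \<Rightarrow> ao_elem \<Rightarrow> complex"
  assumes "s \<ge> 1"
    and "\<And>n. n \<ge> s \<Longrightarrow> haar_functional n (haar n)"
  shows "\<forall>m\<ge>1.
    (\<lambda>n. haar n (cscale (Ao n) (complex_of_real (sqrt (real n / real s))) (ao_o s n) [^]\<^bsub>Ao n\<^esub> (m::nat)))
      \<longlonglongrightarrow> complex_of_real (1 / (2 * pi) * integral {-2..2} (\<lambda>x::real. x ^ m * sqrt (4 - x\<^sup>2)))"
proof (intro allI impI)
  fix m :: nat
  have "(\<lambda>n. of_real (sqrt (real n / real s)) ^ m * (\<Sum>I\<in>words s m. moment n (haar n) (zip I I))) \<longlonglongrightarrow> of_nat (paths m 0)"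
    using assms
    by (intro moments_limit[where \<phi> = "\<lambda>n. moment n (haar n)"])
      (auto intro: moment_Nil moment_contracts moment_invariant_left moment_invariant_right moment_eq_0)
  moreover have "\<forall>\<^sub>F n in sequentially. of_real (sqrt (real n / real s)) ^ m * (\<Sum>I\<in>words s m. moment n (haar n) (zip I I)) =
     haar n (cscale (Ao n) (complex_of_real (sqrt (real n / real s))) (ao_o s n) [^]\<^bsub>Ao n\<^esub> m)"
    using eventually_ge_at_top[of s] by eventually_elim (rule haar_power_trace[OF assms(2), symmetric])
  ultimately have "(\<lambda>n. haar n (cscale (Ao n) (complex_of_real (sqrt (real n / real s))) (ao_o s n) [^]\<^bsub>Ao n\<^esub> m))
     \<longlonglongrightarrow> of_nat (paths m 0)" by (rule Lim_transform_eventually)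
  then show "(\<lambda>n. haar n (cscale (Ao n) (complex_of_real (sqrt (real n / real s))) (ao_o s n) [^]\<^bsub>Ao n\<^esub> (m::nat)))
      \<longlonglongrightarrow> complex_of_real (1 / (2 * pi) * integral {-2..2} (\<lambda>x::real. x ^ m * sqrt (4 - x\<^sup>2)))"
    unfolding semicircle_moment by simp
qed

end
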